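(* Let $a\geq 2$ be an integer, let $k$ be an algebraically closed field of characteristic $p>0$, and let $\pi: X=\mathcal{H}_a\to\mathbb{P}^1_k$ be the Hirzebruch surface of degree $a$ over $k$, a ruled surface over $\mathbb{P}^1_k$. Let $D_1$ be the divisor class of a fiber of $\pi$ and let $D_4$ be the divisor class of the torus-invariant section of $\pi$ with self-intersection $D_4^2=a$. Let $c,d\geq 1$ be integers and let $\mathcal{L}$ be the ample line bundle on $X$ corresponding to the divisor class $cD_1+dD_4$. If $R=\bigoplus_{n\in\mathbb{Z}}H^0(X,\mathcal{L}^{\otimes n})$ is the section ring of $\mathcal{L}$, then its $F$-signature is $$s(R)=\begin{cases}\dfrac{6d^2-c^2}{6d^2(ad+c)} & \text{if } c\leq d,\\[2ex] \dfrac{6d^3-(2d-c)^3}{6cd^2(ad+c)} & \text{if } d\leq c\leq 2d,\\[2ex] \dfrac{d}{c(ad+c)} & \text{if } 2d\leq c.\end{cases}$$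
   Context: The Hirzebruch surface $\mathcal{H}_a$ over $k$ is the smooth projective toric surface whose complete fan in $\mathbb{R}^2$ (lattice $\mathbb{Z}^2$) has rays with primitive generators $\vec{v}_1=\vec{e}_1$, $\vec{v}_2=\vec{e}_2$, $\vec{v}_3=-\vec{e}_1+a\vec{e}_2$, $\vec{v}_4=-\vec{e}_2$, with two-dimensional cones spanned by consecutive rays in cyclic order $\vec v_1,\vec v_2,\vec v_3,\vec v_4$. Let $D_i$ be the torus-invariant prime divisor corresponding to $\vec{v}_i$. Projection of the fan to the first coordinate induces $\pi:\mathcal{H}_a\to\mathbb{P}^1_k$; $D_1\sim D_3$ are fibers of $\pi$, while $D_2$ and $D_4$ are sections with $D_2\sim D_4-aD_3$. Every divisor on $\mathcal{H}_a$ is linearly equivalent to a unique $cD_1+dD_4$ with $c,d\in\mathbb{Z}$, and it is ample if and only if $c>0$ and $d>0$. $R$ is an $\mathbb{N}$-graded finitely generated normal domain of dimension $3$ over $R_0=k$ (the graded pieces with $n<0$ are zero), and $s(R)$ denotes the $F$-signature of the localization of $R$ at its homogeneous maximal ideal $\mathfrak{m}=\bigoplus_{n>0}R_n$. For an $F$-finite Noetherian local domain $(A,\mathfrak{m},k)$ of characteristic $p$ (Frobenius is a finite map), of Krull dimension $\delta$ and with perfect residue field, the $F$-signature is $$s(A)=\lim_{e\to\infty}\frac{\operatorname{frk}_A(A^{1/p^e})}{p^{e\delta}},$$ where $\operatorname{frk}_A(M)$ is the largest $N$ such that there is a surjective $A$-linear map $M\twoheadrightarrow A^{\oplus N}$;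 this limit is known to exist. *)

theory Defs
  imports
    "HOL-Analysis.Analysis"
    "HOL-Algebra.Algebraic_Closure_Type"
    "HOL-Library.Poly_Mapping"
begin

section \<open>Subrings of a field: localization, Krull dimension, \<open>F\<close>-signature\<close>

text \<open>A domain is given as a subset of a field, closed under the ring operations of that field.\<close>

definition subring_record :: "'a::field set \<Rightarrow> 'a ring" where
  "subring_record A = ring_of_type_algebra \<lparr>carrier := A\<rparr>"

definition localization :: "'a::field set \<Rightarrow> 'a set \<Rightarrow> 'a set" where
  "localization A P = {x / y | x y. x \<in> A \<and> y \<in> A - P}"

definition krull_dim :: "'a::field set \<Rightarrow> enat" where
  "krull_dim A = Sup {enat n | n. \<exists>P :: nat \<Rightarrow> 'a set.
     (\<forall>i\<le>n. primeideal (P i) (subring_record A)) \<and> (\<forall>i<n. P i \<subset> P (Suc i))}"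

text \<open>The largest \<open>N\<close> such that the \<open>A\<close>-module \<open>M\<close> surjects onto \<open>A\<^sup>N\<close>; the tuples in \<open>A\<^sup>N\<close> are
  extensional functions on \<open>{..<N}\<close>.\<close>

definition free_rank :: "'a::field set \<Rightarrow> ('a \<Rightarrow> 'm \<Rightarrow> 'm) \<Rightarrow> 'm::ab_group_add set \<Rightarrow> nat" where
  "free_rank A act M = (GREATEST N. \<exists>\<phi> :: 'm \<Rightarrow> nat \<Rightarrow> 'a.
     (\<forall>x\<in>M. \<forall>y\<in>M. \<forall>i<N. \<phi> (x + y) i = \<phi> x i + \<phi> y i) \<and>
     (\<forall>r\<in>A. \<forall>x\<in>M. \<forall>i<N. \<phi> (act r x) i = r * \<phi> x i) \<and>
     \<phi> ` M = ({..<N} \<rightarrow>\<^sub>E A))"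

text \<open>\<open>A\<^sup>1\<^sup>/\<^sup>q\<close>, formed inside an algebraic closure of the ambient field.\<close>

definition roots_ring :: "'a::field set \<Rightarrow> nat \<Rightarrow> 'a alg_closure set" where
  "roots_ring A q = {x. x ^ q \<in> to_ac ` A}"

definition has_F_signature :: "'a::field set \<Rightarrow> real \<Rightarrow> bool" where
  "has_F_signature A s \<longleftrightarrow>
     (\<lambda>e. real (free_rank A (\<lambda>r x. to_ac r * x) (roots_ring A (CHAR('a) ^ e)))
            / real (CHAR('a) ^ (e * the_enat (krull_dim A)))) \<longlonglongrightarrow> s"


section \<open>Divisors on a variety\<close>

text \<open>A separated integral scheme with function field \<open>K\<close> is encoded as the set of the local rings
  of its points, which are subrings of \<open>K\<close>; for such a scheme, distinct points have distinct local
  rings. A prime divisor is encoded as the local ring at its generic point, that is, at a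
  point of codimension one.\<close>

definition prime_divisors :: "'a::field set set \<Rightarrow> 'a set set" where
  "prime_divisors V = {E \<in> V. krull_dim E = 1}"

definition max_ideal :: "'a::field set \<Rightarrow> 'a set" where
  "max_ideal E = {x \<in> E. x = 0 \<or> inverse x \<notin> E}"

text \<open>Only meaningful when \<open>E\<close> is a discrete valuation ring and \<open>f \<noteq> 0\<close>.\<close>

definition vanishing_order :: "'a::field set \<Rightarrow> 'a \<Rightarrow> int" where
  "vanishing_order E f = (THE n. \<exists>\<pi> u. max_ideal E = (\<lambda>x. \<pi> * x) ` E \<and>
     u \<in> E - max_ideal E \<and> f = \<pi> powi n * u)"

definition divisors :: "'a::field set set \<Rightarrow> ('a set \<Rightarrow>\<^sub>0 int) set" where
  "divisors V = {D. Poly_Mapping.keys D \<subseteq> prime_divisors V}"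

definition linearly_equivalent ::
    "'a::field set set \<Rightarrow> ('a set \<Rightarrow>\<^sub>0 int) \<Rightarrow> ('a set \<Rightarrow>\<^sub>0 int) \<Rightarrow> bool" where
  "linearly_equivalent V D D' \<longleftrightarrow> (\<exists>f. f \<noteq> 0 \<and> (\<forall>E\<in>prime_divisors V.
     Poly_Mapping.lookup D E = Poly_Mapping.lookup D' E + vanishing_order E f))"

text \<open>\<open>H\<^sup>0(V, \<O>\<^sub>V(D))\<close>\<close>

definition global_sections :: "'a::field set set \<Rightarrow> ('a set \<Rightarrow>\<^sub>0 int) \<Rightarrow> 'a set" where
  "global_sections V D = {f. f \<noteq> 0 \<longrightarrow>
     (\<forall>E\<in>prime_divisors V. vanishing_order E f + Poly_Mapping.lookup D E \<ge> 0)}"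

text \<open>The section ring of \<open>\<O>\<^sub>V(D)\<close>, as a subring of the ring \<open>K[t, t\<^sup>-\<^sup>1]\<close> of finitely supported
  functions \<open>\<int> \<Rightarrow> K\<close> under convolution.\<close>

definition section_ring :: "'a::field set set \<Rightarrow> ('a set \<Rightarrow>\<^sub>0 int) \<Rightarrow> (int \<Rightarrow>\<^sub>0 'a) set" where
  "section_ring V D =
     {s. \<forall>n. Poly_Mapping.lookup s n \<in> global_sections V (frag_cmul n D)}"

definition irrelevant_ideal :: "(int \<Rightarrow>\<^sub>0 'a::field) set \<Rightarrow> (int \<Rightarrow>\<^sub>0 'a) set" where
  "irrelevant_ideal R = {s \<in> R. \<forall>n\<le>0. Poly_Mapping.lookup s n = 0}"

definition localized_section_ring ::
    "'a::field set set \<Rightarrow> ('a set \<Rightarrow>\<^sub>0 int) \<Rightarrow> (int \<Rightarrow>\<^sub>0 'a) fract set" where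
  "localized_section_ring V D =
     (let R = section_ring V D in localization (to_fract ` R) (to_fract ` irrelevant_ideal R))"


section \<open>Toric surfaces\<close>

text \<open>The function field of a toric surface over \<open>k\<close> is \<open>k(x, y)\<close>, with \<open>x\<close> the inner and \<open>y\<close> the
  outer polynomial variable. Characters of the torus are indexed by \<open>\<int>\<^sup>2\<close>.\<close>

type_synonym 'k ratfun = "'k poly poly fract"

definition scalar :: "'k::field \<Rightarrow> 'k ratfun" where
  "scalar c = to_fract [:[:c:]:]"

definition character :: "int \<times> int \<Rightarrow> 'k::field ratfun" where
  "character m = to_fract [:[:0, 1:]:] powi fst m * to_fract [:0, 1:] powi snd m"

definition character_span :: "(int \<times> int) set \<Rightarrow> 'k::field ratfun set" where
  "character_span S = {\<Sum>m\<in>T. scalar (c m) * character m | T c. finite T \<and> T \<subseteq> S}"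

definition real_vec :: "int \<times> int \<Rightarrow> real \<times> real" where
  "real_vec m = (real_of_int (fst m), real_of_int (snd m))"

definition dual_monoid :: "(real \<times> real) set \<Rightarrow> (int \<times> int) set" where
  "dual_monoid \<sigma> = {m. \<forall>u\<in>\<sigma>. real_vec m \<bullet> u \<ge> 0}"

definition chart_ring :: "(real \<times> real) set \<Rightarrow> 'k::field ratfun set" where
  "chart_ring \<sigma> = character_span (dual_monoid \<sigma>)"

definition toric_variety :: "(real \<times> real) set set \<Rightarrow> 'k::field ratfun set set" where
  "toric_variety \<Sigma> = {localization (chart_ring \<sigma>) P | \<sigma> P.
     \<sigma> \<in> \<Sigma> \<and> primeideal P (subring_record (chart_ring \<sigma>))}"

text \<open>The divisor of a ray with primitive generator \<open>v\<close> is the closure of the torus orbit of the ray.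
  That orbit is the closed subscheme of the chart of the ray whose ideal is spanned by the
  characters \<open>m\<close> with \<open>\<langle>m, v\<rangle> > 0\<close>.\<close>

definition ray_divisor :: "int \<times> int \<Rightarrow> 'k::field ratfun set" where
  "ray_divisor v =
     (let \<rho> = convex_cone hull {real_vec v}
      in localization (chart_ring \<rho>)
           (character_span {m \<in> dual_monoid \<rho>. real_vec m \<bullet> real_vec v > 0}))"

definition hirzebruch_ray :: "int \<Rightarrow> nat \<Rightarrow> int \<times> int" where
  "hirzebruch_ray a i =
     (if i = 1 then (1, 0) else if i = 2 then (0, 1) else if i = 3 then (-1, a) else (0, -1))"

definition hirzebruch_fan :: "int \<Rightarrow> (real \<times> real) set set" where
  "hirzebruch_fan a = (\<lambda>I. convex_cone hull ((\<lambda>i. real_vec (hirzebruch_ray a i)) ` I)) `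
     {{}, {1}, {2}, {3}, {4}, {1, 2}, {2, 3}, {3, 4}, {4, 1}}"

definition hirzebruch :: "int \<Rightarrow> 'k::field ratfun set set" where
  "hirzebruch a = toric_variety (hirzebruch_fan a)"

definition hirzebruch_divisor :: "int \<Rightarrow> nat \<Rightarrow> 'k::field ratfun set" where
  "hirzebruch_divisor a i = ray_divisor (hirzebruch_ray a i)"

end

theory Submission
  imports Defs "Berlekamp_Zassenhaus.Unique_Factorization_Poly"
begin

text \<open>Up to a twist by a rational function, the section ring is the semigroup ring of the lattice points of a
  three-dimensional cone with four facets. For such a ring \<open>A\<close> with facet functionals \<open>l\<close>, a monomial of
  \<open>A\<^sup>1\<^sup>/\<^sup>q\<close> generates a free direct summand when all its facet functionals are less than \<open>1\<close>, and is sent into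
  the maximal ideal by every homomorphism to \<open>A\<close> otherwise. So the free rank of \<open>A\<^sup>1\<^sup>/\<^sup>q\<close> is the number of
  lattice points \<open>w\<close> with \<open>0 \<le> l w < q\<close>, and the \<open>F\<close>-signature is the volume of the polytope
  \<open>0 \<le> l \<le> 1\<close>.

  The identification of the sections rests on unique factorization in the maximal charts, which are polynomial
  rings: every codimension one point is the localization at a prime element.\<close>

hide_const (open) Divisibility.prime Divisibility.irreducible up_ring.monom up_ring.coeff
  module.smult Polynomials.degree

text \<open>The twist is a rational function \<open>z\<close> with D - (c D_1 + d D_4) = div z. The
  four facets are the four rays: on an exponent (m, y) in degree n the functionals are m + n c, y, a
  y - m and n d - y.

  Since k is perfect, A^(1/q) is spanned over k by roots of monomials, up to denominators from A,
  and splits along classes of exponents modulo q. A class meets the box at most once. The free rank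
  is therefore exactly a lattice point count for each q = p^e, and analysis enters only in the limit
  of these counts.

  The hypothesis a \<ge> 2 enters the count: a y + c n = (a y - m) + (m + n c) < 2 q forces y < q,
  so one of the eight inequalities follows from the others. For fixed n and y the number of m is
  then close to q times a tent function of (a y + c n) / q. Two summations replace this tent by its
  second antiderivative, and only the value at c / d survives as a nonlinear term. The knots 1 and 2
  of the tent become the cases c \<le> d, d \<le> c \<le> 2 d and 2 d \<le> c.

  The F-signature is normalized by a Krull dimension defined through chains of primes, so the value
  3 has to be established from both sides.\<close>

abbreviation lookup :: "('a \<Rightarrow>\<^sub>0 'b::zero) \<Rightarrow> 'a \<Rightarrow> 'b" where "lookup \<equiv> Poly_Mapping.lookup"

abbreviation keys :: "('a \<Rightarrow>\<^sub>0 'b::zero) \<Rightarrow> 'a set" where "keys \<equiv> Poly_Mapping.keys"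

abbreviation single :: "'a \<Rightarrow> 'b::zero \<Rightarrow> 'a \<Rightarrow>\<^sub>0 'b" where "single \<equiv> Poly_Mapping.single"

section \<open>Subrings of a field and their prime ideals\<close>

definition ring_closed :: "'a::comm_ring_1 set \<Rightarrow> bool" where
  "ring_closed A \<longleftrightarrow> 1 \<in> A \<and> (\<forall>x\<in>A. \<forall>y\<in>A. x + y \<in> A \<and> x * y \<in> A) \<and> (\<forall>x\<in>A. - x \<in> A)"

lemma ring_closedD:
  assumes "ring_closed A"
  shows "1 \<in> A" "0 \<in> A" "x \<in> A \<Longrightarrow> y \<in> A \<Longrightarrow> x + y \<in> A" "x \<in> A \<Longrightarrow> y \<in> A \<Longrightarrow> x * y \<in> A"
    "x \<in> A \<Longrightarrow> - x \<in> A" "x \<in> A \<Longrightarrow> y \<in> A \<Longrightarrow> x - y \<in> A" "x \<in> A \<Longrightarrow> x ^ n \<in> A"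
proof -
  show 1: "1 \<in> A" and add: "\<And>x y. x \<in> A \<Longrightarrow> y \<in> A \<Longrightarrow> x + y \<in> A"
    and mult: "\<And>x y. x \<in> A \<Longrightarrow> y \<in> A \<Longrightarrow> x * y \<in> A" and neg: "\<And>x. x \<in> A \<Longrightarrow> - x \<in> A"
    using assms by (auto simp: ring_closed_def)
  show "0 \<in> A" using add[OF 1 neg[OF 1]] by simp
  show "x \<in> A \<Longrightarrow> y \<in> A \<Longrightarrow> x - y \<in> A" using add[of x "- y"] neg[of y] by simp
  show "x \<in> A \<Longrightarrow> x ^ n \<in> A" by (induction n) (auto intro: 1 mult)
qed

text \<open>An elementwise counterpart of \<open>primeideal\<close>, to which
  \<open>primeideal_subring_record\<close> translates. The type is any commutative ring, so the same
  predicate serves for ideals of group algebras before they are embedded in a field.\<close>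

definition prime_ideal_of :: "'a::comm_ring_1 set \<Rightarrow> 'a set \<Rightarrow> bool" where
  "prime_ideal_of A P \<longleftrightarrow> P \<subseteq> A \<and> 0 \<in> P \<and> 1 \<notin> P \<and> (\<forall>x\<in>P. \<forall>y\<in>P. x + y \<in> P) \<and>
     (\<forall>x\<in>A. \<forall>y\<in>P. x * y \<in> P) \<and> (\<forall>x\<in>A. \<forall>y\<in>A. x * y \<in> P \<longrightarrow> x \<in> P \<or> y \<in> P)"

lemma subring_record_simps [simp]:
  "carrier (subring_record A) = A"
  "mult (subring_record A) x y = x * y"
  "add (subring_record A) x y = x + y"
  "one (subring_record A) = 1"
  "zero (subring_record A) = 0"
  by (simp_all add: subring_record_def ring_of_type_algebra_def)

lemma cring_subring_record:
  assumes "ring_closed A"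
  shows "cring (subring_record A)"
proof -
  note cl = ring_closedD[OF assms]
  have 1: "\<exists>y\<in>A. y + x = 0" if "x \<in> A" for x
    using cl(5)[OF that] by (intro bexI[of _ "- x"]) auto
  show ?thesis
  proof (rule cringI)
    show "abelian_group (subring_record A)"
      by (rule abelian_groupI) (use cl 1 in \<open>simp_all add: add_ac\<close>)
    show "Group.comm_monoid (subring_record A)"
      by (rule comm_monoidI) (use cl in \<open>simp_all add: mult_ac\<close>)
  qed (simp add: algebra_simps)
qed

lemma primeideal_subring_record:
  assumes "ring_closed A"
  shows "primeideal P (subring_record A) \<longleftrightarrow> prime_ideal_of A P"
proof
  note cl = ring_closedD[OF assms]
  assume "primeideal P (subring_record A)"
  then interpret primeideal P "subring_record A" .
  have "1 \<notin> P" using I_notcarr one_imp_carrier by auto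
  moreover have "x \<in> P \<Longrightarrow> x \<in> A" for x using a_subset by auto
  moreover have "0 \<in> P" using additive_subgroup.zero_closed[OF is_additive_subgroup] by simp
  moreover have "x \<in> P \<Longrightarrow> y \<in> P \<Longrightarrow> x + y \<in> P" for x y
    using additive_subgroup.a_closed[OF is_additive_subgroup] by simp
  moreover have "x \<in> A \<Longrightarrow> y \<in> P \<Longrightarrow> x * y \<in> P" for x y using I_l_closed[of y x] by simp
  moreover have "x \<in> A \<Longrightarrow> y \<in> A \<Longrightarrow> x * y \<in> P \<Longrightarrow> x \<in> P \<or> y \<in> P" for x y using I_prime[of x y] by simp
  ultimately show "prime_ideal_of A P" unfolding prime_ideal_of_def by (intro conjI ballI subsetI impI)
next
  note cl = ring_closedD[OF assms]
  assume P: "prime_ideal_of A P"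
  have neg: "- x \<in> P" if "x \<in> P" for x
  proof -
    have "- 1 \<in> A" using cl by blast
    then have "(- 1) * x \<in> P" using that P unfolding prime_ideal_of_def by blast
    then show ?thesis by simp
  qed
  interpret cring "subring_record A" by (rule cring_subring_record[OF assms])
  have inv: "a_inv (subring_record A) x = - x" if "x \<in> A" for x
    using that cl(5)[OF that] by (intro minus_equality) auto
  have "ideal P (subring_record A)"
  proof (rule idealI)
    show "subgroup P (add_monoid (subring_record A))"
    proof (rule group.subgroupI)
      show "group (add_monoid (subring_record A))" by (rule add.is_group)
    next
      fix x assume "x \<in> P"
      then show "inv\<^bsub>add_monoid (subring_record A)\<^esub> x \<in> P"
        using inv[of x] neg[of x] P by (auto simp: a_inv_def prime_ideal_of_def)
    next
      show "P \<subseteq> carrier (add_monoid (subring_record A))" "P \<noteq> {}"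
        using P by (auto simp: prime_ideal_of_def)
    next
      fix x y assume "x \<in> P" "y \<in> P"
      then show "x \<otimes>\<^bsub>add_monoid (subring_record A)\<^esub> y \<in> P" using P unfolding prime_ideal_of_def by simp
    qed
  next
    fix a x assume "a \<in> P" "x \<in> carrier (subring_record A)"
    moreover have "x * a \<in> P" using calculation P by (auto simp: prime_ideal_of_def)
    ultimately show "x \<otimes>\<^bsub>subring_record A\<^esub> a \<in> P" "a \<otimes>\<^bsub>subring_record A\<^esub> x \<in> P"
      by (simp_all add: mult.commute)
  qed (rule ring_axioms)
  then show "primeideal P (subring_record A)"
  proof (rule primeidealI[OF _ is_cring])
    show "carrier (subring_record A) \<noteq> P" using P cl(1) by (auto simp: prime_ideal_of_def)
  next
    fix a b assume "a \<in> carrier (subring_record A)" "b \<in> carrier (subring_record A)"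
      "a \<otimes>\<^bsub>subring_record A\<^esub> b \<in> P"
    then show "a \<in> P \<or> b \<in> P" using P unfolding prime_ideal_of_def subring_record_simps by blast
  qed
qed

lemma prime_ideal_of_diff:
  assumes "ring_closed A" "prime_ideal_of A P" "x \<in> P" "y \<in> P"
  shows "x - y \<in> P"
proof -
  have "- 1 \<in> A" using ring_closedD[OF assms(1)] by blast
  then have "(- 1) * y \<in> P" using assms(2,4) unfolding prime_ideal_of_def by blast
  then have "x + (- 1) * y \<in> P" using assms(2,3) unfolding prime_ideal_of_def by blast
  then show ?thesis by simp
qed

lemma prime_ideal_of_zero:
  assumes "ring_closed (A :: 'a::idom set)"
  shows "prime_ideal_of A {0}"
  using ring_closedD[OF assms] by (auto simp: prime_ideal_of_def)

section \<open>Bounds on the Krull dimension by chains of primes\<close>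

lemma krull_dim_ge:
  fixes A :: "'a::field set"
  assumes "ring_closed A" "\<And>i. i \<le> n \<Longrightarrow> prime_ideal_of A (P i)" "\<And>i. i < n \<Longrightarrow> P i \<subset> P (Suc i)"
  shows "enat n \<le> krull_dim A"
  unfolding krull_dim_def
  by (rule Sup_upper) (use assms in \<open>auto simp: primeideal_subring_record intro!: exI[of _ P]\<close>)

text \<open>Refuting chains of exactly n + 2 primes is enough, since a longer chain contains such an
  initial segment.\<close>

lemma krull_dim_le:
  fixes A :: "'a::field set"
  assumes "ring_closed A"
    and "\<And>P. (\<And>i. i \<le> Suc n \<Longrightarrow> prime_ideal_of A (P i)) \<Longrightarrow> (\<And>i. i \<le> n \<Longrightarrow> P i \<subset> P (Suc i)) \<Longrightarrow> False"
  shows "krull_dim A \<le> enat n"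
  unfolding krull_dim_def
proof (rule Sup_least)
  fix x assume "x \<in> {enat n |n. \<exists>P. (\<forall>i\<le>n. primeideal (P i) (subring_record A)) \<and> (\<forall>i<n. P i \<subset> P (Suc i))}"
  then obtain m P where x: "x = enat m" and P: "\<forall>i\<le>m. prime_ideal_of A (P i)" "\<forall>i<m. P i \<subset> P (Suc i)"
    using primeideal_subring_record[OF assms(1)] by auto
  have "m \<le> n"
  proof (rule ccontr)
    assume "\<not> m \<le> n"
    then show False using assms(2)[of P] P by auto
  qed
  then show "x \<le> enat n" using x by simp
qed

section \<open>Localization at a prime and the primes below it\<close>

lemma ring_closed_localization:
  fixes A :: "'a::field set"
  assumes A: "ring_closed A" and P: "prime_ideal_of A P"
  shows "ring_closed (localization A P)"
  unfolding ring_closed_def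
proof (intro conjI ballI)
  note cl = ring_closedD[OF A]
  show "1 \<in> localization A P"
    using cl P unfolding localization_def prime_ideal_of_def
    by (intro CollectI exI[of _ 1] conjI) simp_all
  have prod: "y * y' \<in> A - P" if "y \<in> A - P" "y' \<in> A - P" for y y'
    using that P cl(4) unfolding prime_ideal_of_def by blast
  have nz: "y \<noteq> 0" if "y \<in> A - P" for y using that P by (auto simp: prime_ideal_of_def)
  fix x x' assume "x \<in> localization A P" "x' \<in> localization A P"
  then obtain a b a' b' where *: "x = a / b" "x' = a' / b'" "a \<in> A" "a' \<in> A" "b \<in> A - P" "b' \<in> A - P"
    unfolding localization_def by auto
  have "x + x' = (a * b' + a' * b) / (b * b')" using nz * by (simp add: field_simps)
  moreover have "a * b' + a' * b \<in> A" using * cl by auto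
  ultimately show "x + x' \<in> localization A P" unfolding localization_def using prod[OF *(5,6)] by blast
  have "x * x' = (a * a') / (b * b')" using * by simp
  moreover have "a * a' \<in> A" using * cl by auto
  ultimately show "x * x' \<in> localization A P" unfolding localization_def using prod[OF *(5,6)] by blast
next
  note cl = ring_closedD[OF A]
  fix x assume "x \<in> localization A P"
  then obtain a b where *: "x = a / b" "a \<in> A" "b \<in> A - P" unfolding localization_def by auto
  have "- x = (- a) / b" using * by simp
  moreover have "- a \<in> A" using * cl by auto
  ultimately show "- x \<in> localization A P" unfolding localization_def using * by blast
qed

text \<open>From x y' = y x' in Q with y' outside P, hence outside Q, primality gives x in Q. So Q
  can be recovered from its extension, and strict inclusions of primes stay strict after
  localization.\<close>

lemma localization_numerator_mem:
  fixes A :: "'a::field set"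
  assumes A: "ring_closed A" and P: "prime_ideal_of A P" and Q: "prime_ideal_of A Q" "Q \<subseteq> P"
    and "x \<in> A" "y \<in> A - P" "x / y \<in> {x / y | x y. x \<in> Q \<and> y \<in> A - P}"
  shows "x \<in> Q"
proof -
  obtain x' y' where *: "x / y = x' / y'" "x' \<in> Q" "y' \<in> A - P" using assms(7) by auto
  have "y \<noteq> 0" "y' \<noteq> 0" using * assms(6) P by (auto simp: prime_ideal_of_def)
  then have "x * y' = y * x'" using *(1) by (simp add: field_simps)
  moreover have "y * x' \<in> Q" using *(2) assms(6) Q(1) unfolding prime_ideal_of_def by simp
  ultimately have "x * y' \<in> Q" by simp
  then have "x \<in> Q \<or> y' \<in> Q" using *(3) assms(5) Q(1) unfolding prime_ideal_of_def by blast
  then show "x \<in> Q" using *(3) Q(2) by blast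
qed

lemma prime_ideal_of_localization:
  fixes A :: "'a::field set"
  assumes A: "ring_closed A" and P: "prime_ideal_of A P" and Q: "prime_ideal_of A Q" "Q \<subseteq> P"
  shows "prime_ideal_of (localization A P) {x / y | x y. x \<in> Q \<and> y \<in> A - P}" (is "prime_ideal_of ?L ?Q")
proof -
  note cl = ring_closedD[OF A]
  have prod: "y * y' \<in> A - P" if "y \<in> A - P" "y' \<in> A - P" for y y'
    using that P cl(4) unfolding prime_ideal_of_def by blast
  have nz: "y \<noteq> 0" if "y \<in> A - P" for y using that P by (auto simp: prime_ideal_of_def)
  have QA: "Q \<subseteq> A" "0 \<in> Q" and Qadd: "\<And>x y. x \<in> Q \<Longrightarrow> y \<in> Q \<Longrightarrow> x + y \<in> Q"
    and Qm: "\<And>x y. x \<in> A \<Longrightarrow> y \<in> Q \<Longrightarrow> x * y \<in> Q"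
    and Qp: "\<And>x y. x \<in> A \<Longrightarrow> y \<in> A \<Longrightarrow> x * y \<in> Q \<Longrightarrow> x \<in> Q \<or> y \<in> Q"
    using Q unfolding prime_ideal_of_def by auto
  have one: "1 \<in> A - P" using P cl by (auto simp: prime_ideal_of_def)
  have num: "x \<in> Q" if "x \<in> A" "y \<in> A - P" "x / y \<in> ?Q" for x y
    using localization_numerator_mem[OF A P Q that] .
  show ?thesis unfolding prime_ideal_of_def
  proof (intro conjI ballI impI)
    show "?Q \<subseteq> ?L" using QA unfolding localization_def by auto
    show "0 \<in> ?Q" using QA(2) one by (metis (mono_tags, lifting) div_by_1 mem_Collect_eq)
    show "1 \<notin> ?Q" using num[of 1 1] one Q by (auto simp: prime_ideal_of_def)
  next
    fix x x' assume "x \<in> ?Q" "x' \<in> ?Q"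
    then obtain a b a' b' where *: "x = a / b" "x' = a' / b'" "a \<in> Q" "a' \<in> Q" "b \<in> A - P" "b' \<in> A - P"
      by auto
    have "x + x' = (b' * a + b * a') / (b * b')" using nz * by (simp add: field_simps)
    moreover have "b' * a + b * a' \<in> Q" using * Qadd Qm by auto
    ultimately show "x + x' \<in> ?Q" using prod[OF *(5,6)] by blast
  next
    fix x x' assume "x \<in> ?L" "x' \<in> ?Q"
    then obtain a b a' b' where *: "x = a / b" "x' = a' / b'" "a \<in> A" "a' \<in> Q" "b \<in> A - P" "b' \<in> A - P"
      unfolding localization_def by auto
    have "x * x' = (a * a') / (b * b')" using * by simp
    then show "x * x' \<in> ?Q" using prod[OF *(5,6)] Qm *(3,4) by blast
  next
    fix x x' assume "x \<in> ?L" "x' \<in> ?L" and in_Q: "x * x' \<in> ?Q"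
    then obtain a b a' b' where *: "x = a / b" "x' = a' / b'" "a \<in> A" "a' \<in> A" "b \<in> A - P" "b' \<in> A - P"
      unfolding localization_def by auto
    have "x * x' = (a * a') / (b * b')" using * by simp
    then have "a * a' \<in> Q" using num[of "a * a'" "b * b'"] prod[OF *(5,6)] cl(4)[OF *(3,4)] in_Q by simp
    then show "x \<in> ?Q \<or> x' \<in> ?Q" using Qp * by blast
  qed
qed

section \<open>Group algebras and their evaluation in a ring\<close>

lemma single_eq_0_iff: "single w c = 0 \<longleftrightarrow> c = 0"
  by (metis lookup_single_eq lookup_zero single_zero)

lemma poly_mapping_sum_single:
  assumes "finite T" "keys f \<subseteq> T"
  shows "f = (\<Sum>w\<in>T. single w (lookup f w))"
proof (rule poly_mapping_eqI)
  fix k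
  have "lookup (\<Sum>w\<in>T. single w (lookup f w)) k
      = (\<Sum>w\<in>T. if w = k then lookup f k else 0)"
    by (simp add: lookup_sum lookup_single when_def cong: if_cong)
  also have "\<dots> = lookup f k"
    using assms by (auto simp: in_keys_iff)
  finally show "lookup f k
      = lookup (\<Sum>w\<in>T. single w (lookup f w)) k" ..
qed

text \<open>Additive identities need only be checked on monomials. The coefficient may be 0, which
  makes the zero element an instance of the case \<open>single\<close>.\<close>

lemma poly_mapping_single_plus_induct [case_names single plus]:
  fixes f :: "'a \<Rightarrow>\<^sub>0 'b::comm_monoid_add"
  assumes single: "\<And>w c. P (single w c)" and plus: "\<And>f g. P f \<Longrightarrow> P g \<Longrightarrow> P (f + g)"
  shows "P f"
proof -
  have "P (\<Sum>w\<in>T. single w (lookup f w))" if "finite T" for T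
    using that
  proof (induction T)
    case empty
    have "P (single undefined 0)" by (rule single)
    then show ?case by simp
  qed (simp add: single plus)
  from this[OF finite_keys, of f] show ?thesis
    by (simp only: poly_mapping_sum_single[OF finite_keys subset_refl, symmetric])
qed

lemma lookup_map_zero: "h 0 = 0 \<Longrightarrow> lookup (Poly_Mapping.map h f) w = h (lookup f w)"
  by (simp add: Poly_Mapping.map.rep_eq when_def)

lemma lookup_const_mult: "lookup (single 0 c * f) w = c * lookup f w"
  for c :: "'k::comm_ring_1"
  unfolding mult_map_scale_conv_mult[symmetric] by (simp add: lookup_map_zero)

text \<open>Scalars act through constant monomials. This opens the theory of spans and independence
  for the two dimension counts, \<open>free_rank_upper\<close> and
  \<open>algebraically_dependent\<close>.\<close>

lemma vector_space_poly_mapping: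
  "vector_space (\<lambda>(c :: 'k::field) (f :: 'g::comm_monoid_add \<Rightarrow>\<^sub>0 'k). single 0 c * f)"
  by standard (simp_all add: algebra_simps single_add mult_single flip: mult.assoc)

text \<open>Evaluation of an element of a group algebra, kept generic because it is used for five
  pairs of maps: in the ambient field, in its algebraic closure, for the dilation of exponents, for
  characters of the torus and for sections.\<close>

definition mon_eval :: "('k::zero \<Rightarrow> 'r::comm_ring_1) \<Rightarrow> ('g \<Rightarrow> 'r) \<Rightarrow> ('g \<Rightarrow>\<^sub>0 'k) \<Rightarrow> 'r" where
  "mon_eval \<iota> \<mu> f = (\<Sum>w\<in>keys f. \<iota> (lookup f w) * \<mu> w)"

locale monomial_eval =
  fixes \<iota> :: "'k::comm_ring_1 \<Rightarrow> 'r::comm_ring_1" and \<mu> :: "'g::comm_monoid_add \<Rightarrow> 'r"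
  assumes \<iota>_1: "\<iota> 1 = 1" and \<iota>_add: "\<iota> (x + y) = \<iota> x + \<iota> y" and \<iota>_mult: "\<iota> (x * y) = \<iota> x * \<iota> y"
    and \<mu>_0: "\<mu> 0 = 1" and \<mu>_add: "\<mu> (u + v) = \<mu> u * \<mu> v"
begin

abbreviation ev :: "('g \<Rightarrow>\<^sub>0 'k) \<Rightarrow> 'r" where "ev \<equiv> mon_eval \<iota> \<mu>"

lemma \<iota>_0: "\<iota> 0 = 0"
  using \<iota>_add[of 0 0] by simp

lemma \<iota>_uminus: "\<iota> (- x) = - \<iota> x"
  using \<iota>_add[of x "- x"] \<iota>_0 by (simp add: add_eq_0_iff)

lemma \<iota>_power: "\<iota> (x ^ n) = \<iota> x ^ n"
  by (induction n) (simp_all add: \<iota>_1 \<iota>_mult)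

lemma ev_superset:
  assumes "finite T" "keys f \<subseteq> T"
  shows "ev f = (\<Sum>w\<in>T. \<iota> (lookup f w) * \<mu> w)"
  unfolding mon_eval_def
  by (rule sum.mono_neutral_left) (use assms in \<open>auto simp: in_keys_iff \<iota>_0\<close>)

lemma ev_single [simp]: "ev (single w c) = \<iota> c * \<mu> w"
  using ev_superset[of "{w}" "single w c"] by (simp split: if_splits)

lemma ev_0 [simp]: "ev 0 = 0"
  by (simp add: mon_eval_def)

lemma ev_add [simp]: "ev (f + g) = ev f + ev g"
proof -
  let ?T = "keys f \<union> keys g"
  have "keys (f + g) \<subseteq> ?T" by (rule keys_add)
  then show ?thesis
    by (simp add: ev_superset[of ?T] lookup_add \<iota>_add distrib_right sum.distrib)
qed

lemma ev_uminus [simp]: "ev (- f) = - ev f"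
  using ev_add[of f "- f"] by (simp add: add_eq_0_iff)

lemma ev_diff [simp]: "ev (f - g) = ev f - ev g"
  using ev_add[of f "- g"] by simp

lemma ev_1 [simp]: "ev 1 = 1"
  using ev_single[of 0 1] by (simp add: \<iota>_1 \<mu>_0)

lemma ev_mult [simp]: "ev (f * g) = ev f * ev g"
proof (induction f rule: poly_mapping_single_plus_induct)
  case (single w c)
  show ?case
    by (induction g rule: poly_mapping_single_plus_induct)
       (simp_all add: mult_single \<iota>_mult \<mu>_add algebra_simps)
qed (simp add: algebra_simps)

lemma ev_power [simp]: "ev (f ^ n) = ev f ^ n"
  by (induction n) simp_all

lemma ev_sum: "ev (sum f T) = (\<Sum>i\<in>T. ev (f i))"
  by (induction T rule: infinite_finite_induct) simp_all

end

section \<open>Elements of a group algebra with exponents in a given set\<close>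

definition supported :: "'g set \<Rightarrow> ('g \<Rightarrow>\<^sub>0 'k::zero) set" where
  "supported T = {f. keys f \<subseteq> T}"

lemma supported_0 [simp]: "0 \<in> supported T"
  by (simp add: supported_def)

lemma supported_add: "f \<in> supported T \<Longrightarrow> g \<in> supported T \<Longrightarrow> f + g \<in> supported T"
  for f :: "'g \<Rightarrow>\<^sub>0 'k::monoid_add"
  using keys_add[of f g] by (auto simp: supported_def)

lemma supported_uminus: "f \<in> supported T \<Longrightarrow> - f \<in> supported T"
  for f :: "'g \<Rightarrow>\<^sub>0 'k::ab_group_add"
  by (auto simp: supported_def in_keys_iff)

lemma supported_diff: "f \<in> supported T \<Longrightarrow> g \<in> supported T \<Longrightarrow> f - g \<in> supported T"
  for f :: "'g \<Rightarrow>\<^sub>0 'k::ab_group_add"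
  using supported_add[of f T "- g"] supported_uminus[of g T] by simp

lemma supported_single: "w \<in> T \<Longrightarrow> single w c \<in> supported T"
  by (auto simp: supported_def split: if_splits)

lemma supported_sum: "(\<And>i. i \<in> I \<Longrightarrow> f i \<in> supported T) \<Longrightarrow> sum f I \<in> supported T"
  for f :: "'i \<Rightarrow> 'g \<Rightarrow>\<^sub>0 'k::comm_monoid_add"
  by (induction I rule: infinite_finite_induct) (auto intro: supported_add)

lemma supported_mult:
  assumes "f \<in> supported T" "g \<in> supported U" "\<And>u v. u \<in> T \<Longrightarrow> v \<in> U \<Longrightarrow> u + v \<in> V"
  shows "f * g \<in> supported V"
proof -
  have "w \<in> V" if w: "w \<in> keys (f * g)" for w
  proof -
    obtain u v where "w = u + v" "u \<in> keys f" "v \<in> keys g"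
      using subsetD[OF keys_mult w] by blast
    then show ?thesis using assms by (auto simp: supported_def)
  qed
  then show ?thesis by (auto simp: supported_def)
qed

lemma ring_closed_supported:
  fixes T :: "'g::comm_monoid_add set"
  assumes "0 \<in> T" "\<And>u v. u \<in> T \<Longrightarrow> v \<in> T \<Longrightarrow> u + v \<in> T"
  shows "ring_closed (supported T :: ('g \<Rightarrow>\<^sub>0 'k::comm_ring_1) set)"
  unfolding ring_closed_def
proof (intro conjI ballI)
  show "1 \<in> (supported T :: ('g \<Rightarrow>\<^sub>0 'k) set)" using assms(1) by (simp add: supported_def)
next
  fix f g :: "'g \<Rightarrow>\<^sub>0 'k" assume fg: "f \<in> supported T" "g \<in> supported T"
  show "f + g \<in> supported T" using fg by (rule supported_add)
  show "f * g \<in> supported T" using fg assms(2) by (rule supported_mult)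
qed (rule supported_uminus)

definition keys_in :: "'g set \<Rightarrow> ('g \<Rightarrow>\<^sub>0 'k) \<Rightarrow> 'g \<Rightarrow>\<^sub>0 'k::comm_monoid_add" where
  "keys_in T f = (\<Sum>w\<in>keys f \<inter> T. single w (lookup f w))"

lemma lookup_keys_in: "lookup (keys_in T f) w = (if w \<in> T then lookup f w else 0)"
proof -
  have "lookup (keys_in T f) w
      = (\<Sum>v\<in>keys f \<inter> T. if v = w then lookup f w else 0)"
    by (simp add: keys_in_def lookup_sum lookup_single when_def cong: if_cong)
  also have "\<dots> = (if w \<in> T then lookup f w else 0)"
    by (auto simp: in_keys_iff)
  finally show ?thesis .
qed

lemma keys_in_supported: "keys_in T f \<in> supported T" "f \<in> supported S \<Longrightarrow> keys_in T f \<in> supported S"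
  by (auto simp: supported_def in_keys_iff lookup_keys_in split: if_splits)

lemma diff_keys_in_supported: "f \<in> supported S \<Longrightarrow> f - keys_in T f \<in> supported (S - T)"
  for f :: "'g \<Rightarrow>\<^sub>0 'k::ab_group_add"
  by (auto simp: supported_def in_keys_iff lookup_keys_in lookup_minus split: if_splits)

text \<open>The complement of G in S behaves like a face: it is closed under addition, while G
  absorbs S. Dropping the terms with exponents in G changes a product only by terms in G. The
  truncated product is supported both in G and in its complement, so it vanishes, and the domain
  hypothesis kills one truncated factor.\<close>

lemma prime_ideal_of_supported:
  fixes S G :: "'g::comm_monoid_add set"
  assumes dom: "\<And>f g. f \<in> supported S \<Longrightarrow> g \<in> supported S \<Longrightarrow> f * g = 0 \<Longrightarrow> f = 0 \<or> g = (0 :: 'g \<Rightarrow>\<^sub>0 'k::comm_ring_1)"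
    and G: "G \<subseteq> S" "0 \<notin> G" "\<And>u v. u \<in> S \<Longrightarrow> v \<in> G \<Longrightarrow> u + v \<in> G"
    and face: "\<And>u v. u \<in> S - G \<Longrightarrow> v \<in> S - G \<Longrightarrow> u + v \<in> S - G"
  shows "prime_ideal_of (supported S) (supported G :: ('g \<Rightarrow>\<^sub>0 'k) set)"
  unfolding prime_ideal_of_def
proof (intro conjI ballI impI)
  show "supported G \<subseteq> (supported S :: ('g \<Rightarrow>\<^sub>0 'k) set)" using G by (auto simp: supported_def)
  show "1 \<notin> (supported G :: ('g \<Rightarrow>\<^sub>0 'k) set)" using G by (simp add: supported_def)
next
  fix f g :: "'g \<Rightarrow>\<^sub>0 'k" assume f: "f \<in> supported S" and g: "g \<in> supported S" and fg: "f * g \<in> supported G"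
  let ?f = "keys_in (S - G) f" and ?g = "keys_in (S - G) g"
  have f1: "f - ?f \<in> supported G" and g1: "g - ?g \<in> supported G"
    using diff_keys_in_supported[OF f, of "S - G"] diff_keys_in_supported[OF g, of "S - G"] G(1)
    by (auto simp: double_diff)
  have "f * g - ?f * ?g = g * (f - ?f) + ?f * (g - ?g)" by (simp add: algebra_simps)
  also have "\<dots> \<in> supported G"
    by (intro supported_add supported_mult[OF g f1] supported_mult[OF keys_in_supported(2)[OF f] g1] G)
  finally have "f * g - (f * g - ?f * ?g) \<in> supported G" using fg by (rule supported_diff[rotated])
  then have "?f * ?g \<in> supported G" by simp
  moreover have "?f * ?g \<in> supported (S - G)"
    by (rule supported_mult[OF keys_in_supported(1) keys_in_supported(1)]) (rule face)
  ultimately have "w \<notin> keys (?f * ?g)" for w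
    unfolding supported_def by blast
  then have "?f * ?g = 0"
    by (intro poly_mapping_eqI) (simp add: in_keys_iff)
  then have "?f = 0 \<or> ?g = 0" using dom keys_in_supported(2) f g by blast
  then show "f \<in> supported G \<or> g \<in> supported G" using f1 g1 by auto
next
  fix f g :: "'g \<Rightarrow>\<^sub>0 'k" assume "f \<in> supported S" "g \<in> supported G"
  then show "f * g \<in> supported G" using G(3) by (rule supported_mult)
qed (auto intro: supported_add)

section \<open>Frobenius roots in a field\<close>

lemma frobenius_inj:
  fixes x y :: "'a::field"
  assumes "prime CHAR('a)" "x ^ CHAR('a) ^ e = y ^ CHAR('a) ^ e"
  shows "x = y"
proof -
  have "(x - y + y) ^ CHAR('a) ^ e = (x - y) ^ CHAR('a) ^ e + y ^ CHAR('a) ^ e"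
    by (rule freshmans_dream'[OF assms(1) refl])
  then have "(x - y) ^ CHAR('a) ^ e = 0" using assms(2) by simp
  then show ?thesis by simp
qed

definition frobenius_root :: "nat \<Rightarrow> 'a::field \<Rightarrow> 'a" where
  "frobenius_root q x = (SOME y. y ^ q = x)"

lemma frobenius_root_power:
  fixes x :: "'a::alg_closed_field"
  assumes "q > 0"
  shows "frobenius_root q x ^ q = x"
  unfolding frobenius_root_def using nth_root_exists[OF assms] by (rule someI_ex)

section \<open>Affine toric rings\<close>

text \<open>The exponent side of Frobenius: \<open>\<mu> (dilate q w) = \<mu> w ^ q\<close>.\<close>

primrec dilate :: "nat \<Rightarrow> 'g::ab_group_add \<Rightarrow> 'g" where
  "dilate 0 w = 0"
| "dilate (Suc q) w = w + dilate q w"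

lemma dilate_0_right [simp]: "dilate q 0 = 0"
  by (induction q) simp_all

lemma dilate_add: "dilate q (u + v) = dilate q u + dilate q v"
  by (induction q) (simp_all add: add_ac)

text \<open>The functionals are the primitive inner normals of a pointed cone. Here
  \<open>independent\<close> embeds the group algebra in the field, and \<open>separating\<close>
  makes the cone pointed. By \<open>facet\<close> each inequality can be violated alone, by the
  least possible amount -1; \<open>interior\<close> supplies a point that moves such a vector back
  into the cone.\<close>

locale toric_ring = monomial_eval \<iota> \<mu>
  for \<iota> :: "'k::alg_closed_field \<Rightarrow> 'l::field" and \<mu> :: "'g::ab_group_add \<Rightarrow> 'l" +
  fixes \<Lambda> :: "('g \<Rightarrow> int) set"
  assumes independent: "mon_eval \<iota> \<mu> f = 0 \<Longrightarrow> f = 0"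
    and char_pos: "CHAR('k) > 0"
    and functional_add: "l \<in> \<Lambda> \<Longrightarrow> l (u + v) = l u + l v"
    and separating: "(\<And>l. l \<in> \<Lambda> \<Longrightarrow> l w = 0) \<Longrightarrow> w = 0"
    and finite_box: "finite {w. \<forall>l\<in>\<Lambda>. 0 \<le> l w \<and> l w < int q}"
    and facet: "l \<in> \<Lambda> \<Longrightarrow> \<exists>s. l s = -1 \<and> (\<forall>l'\<in>\<Lambda>. l' \<noteq> l \<longrightarrow> l' s \<ge> 0)"
    and interior: "\<exists>t. \<forall>l\<in>\<Lambda>. l t \<ge> 1"
begin

definition cone :: "'g set" where "cone = {w. \<forall>l\<in>\<Lambda>. 0 \<le> l w}"

definition box :: "nat \<Rightarrow> 'g set" where "box q = {w. \<forall>l\<in>\<Lambda>. 0 \<le> l w \<and> l w < int q}"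

abbreviation kS :: "('g \<Rightarrow>\<^sub>0 'k) set" where "kS \<equiv> supported cone"

abbreviation kS_max :: "('g \<Rightarrow>\<^sub>0 'k) set" where "kS_max \<equiv> supported (cone - {0})"

definition local_ring :: "'l set" where "local_ring = localization (ev ` kS) (ev ` kS_max)"

lemma ev_inj: "ev f = ev g \<longleftrightarrow> f = g"
  using independent[of "f - g"] by auto

lemma ev_eq_0_iff: "ev f = 0 \<longleftrightarrow> f = 0"
  using ev_inj[of f 0] by simp

lemma group_algebra_domain: "f * g = 0 \<Longrightarrow> f = 0 \<or> g = (0 :: 'g \<Rightarrow>\<^sub>0 'k)"
  using ev_mult[of f g] by (auto simp: ev_eq_0_iff)

lemma \<iota>_eq_0_iff: "\<iota> c = 0 \<longleftrightarrow> c = 0"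
  using ev_eq_0_iff[of "single 0 c"] by (simp add: \<mu>_0 single_eq_0_iff)

lemma char_prime: "prime CHAR('k)"
  using prime_CHAR_semidom[OF char_pos] .

lemma \<iota>_of_nat: "\<iota> (of_nat n) = of_nat n"
  by (induction n) (simp_all add: \<iota>_0 \<iota>_1 \<iota>_add)

lemma CHAR_target: "CHAR('l) = CHAR('k)"
  by (rule CHAR_eqI) (metis \<iota>_0 \<iota>_of_nat of_nat_CHAR, metis \<iota>_eq_0_iff \<iota>_of_nat of_nat_eq_0_iff_char_dvd)

lemma \<mu>_nonzero: "\<mu> w \<noteq> 0"
  using ev_eq_0_iff[of "single w 1"] by (simp add: \<iota>_1 single_eq_0_iff)

lemma functional_0: "l \<in> \<Lambda> \<Longrightarrow> l 0 = 0"
  using functional_add[of l 0 0] by simp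

lemma functional_dilate: "l \<in> \<Lambda> \<Longrightarrow> l (dilate q w) = int q * l w"
  by (induction q) (simp_all add: functional_0 functional_add algebra_simps)

lemma functional_uminus: "l \<in> \<Lambda> \<Longrightarrow> l (- w) = - l w"
  using functional_add[of l w "- w"] by (simp add: functional_0)

lemma dilate_inj:
  fixes u v :: 'g
  assumes "q > 0" "dilate q u = dilate q v"
  shows "u = v"
proof -
  have "u - v = 0"
  proof (rule separating)
    fix l assume l: "l \<in> \<Lambda>"
    have "int q * l u = int q * l v" using assms(2) functional_dilate[OF l] by metis
    then show "l (u - v) = 0"
      using assms(1) functional_add[OF l, of u "- v"] functional_uminus[OF l, of v] by simp
  qed
  then show ?thesis by simp
qed

lemma \<mu>_dilate: "\<mu> (dilate q w) = \<mu> w ^ q"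
  by (induction q) (simp_all add: \<mu>_add \<mu>_0)

lemma cone_0: "0 \<in> cone" and cone_add: "u \<in> cone \<Longrightarrow> v \<in> cone \<Longrightarrow> u + v \<in> cone"
  by (simp_all add: cone_def functional_0 functional_add)

lemma cone_pointed:
  assumes "u \<in> cone" "v \<in> cone" "u + v = 0"
  shows "u = 0"
proof (rule separating)
  fix l assume l: "l \<in> \<Lambda>"
  then have "l u + l v = 0" using assms(3) functional_add[OF l, of u v] functional_0[OF l] by simp
  then show "l u = 0" using assms(1,2) l by (fastforce simp: cone_def)
qed

lemma ring_closed_kS: "ring_closed kS"
  by (rule ring_closed_supported[OF cone_0 cone_add])

lemma prime_ideal_kS_max: "prime_ideal_of kS kS_max"
proof (rule prime_ideal_of_supported)
  fix u v assume uv: "u \<in> cone" "v \<in> cone - {0}"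
  then show "u + v \<in> cone - {0}" using cone_pointed[of v u] cone_add[of u v] by (auto simp: add.commute)
next
  fix u v assume "u \<in> cone - (cone - {0})" "v \<in> cone - (cone - {0})"
  then show "u + v \<in> cone - (cone - {0})" by auto
qed (use group_algebra_domain in auto)

lemma kS_max_iff: "f \<in> kS \<Longrightarrow> f \<in> kS_max \<longleftrightarrow> lookup f 0 = 0"
  by (auto simp: supported_def in_keys_iff)

lemma prime_ideal_of_ev:
  assumes "prime_ideal_of B Q"
  shows "prime_ideal_of (ev ` B) (ev ` Q)"
proof -
  have mem: "ev f \<in> ev ` T \<longleftrightarrow> f \<in> T" for f T by (auto simp: ev_inj)
  have *: "1 \<in> ev ` T \<longleftrightarrow> 1 \<in> T" "0 \<in> ev ` T \<longleftrightarrow> 0 \<in> T" for T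
    using mem[of 1] mem[of 0] by simp_all
  show ?thesis using assms unfolding prime_ideal_of_def
    by (simp add: * mem image_mono flip: ev_mult ev_add)
qed

lemma ring_closed_ev:
  assumes "ring_closed B"
  shows "ring_closed (ev ` B)"
proof -
  have mem: "ev f \<in> ev ` T \<longleftrightarrow> f \<in> T" for f T by (auto simp: ev_inj)
  show ?thesis using assms mem[of 1 B] unfolding ring_closed_def
    by (simp add: mem flip: ev_mult ev_add ev_uminus)
qed

section \<open>Fractions, constant terms and residues in the local ring\<close>

lemma ring_closed_local_ring: "ring_closed local_ring"
  unfolding local_ring_def
  by (rule ring_closed_localization[OF ring_closed_ev[OF ring_closed_kS] prime_ideal_of_ev[OF prime_ideal_kS_max]])

lemma local_ring_iff:
  "x \<in> local_ring \<longleftrightarrow> (\<exists>f\<in>kS. \<exists>g\<in>kS. lookup g 0 \<noteq> 0 \<and> x = ev f / ev g)"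
proof -
  have "ev g \<in> ev ` kS - ev ` kS_max \<longleftrightarrow> g \<in> kS \<and> lookup g 0 \<noteq> 0" for g
    using kS_max_iff[of g] by (auto simp: ev_inj)
  then show ?thesis unfolding local_ring_def localization_def by blast
qed

text \<open>Splitting off constant terms leaves elements of \<open>kS_max\<close>, which is an ideal
  because the cone is pointed; the mixed products therefore contribute nothing to the constant
  term.\<close>

lemma lookup_mult_0:
  assumes f: "f \<in> kS" and g: "g \<in> kS"
  shows "lookup (f * g) 0 = lookup f 0 * lookup g 0"
proof -
  define f' g' where "f' = f - single 0 (lookup f 0)"
    and "g' = g - single 0 (lookup g 0)"
  have f': "f' \<in> kS" and g': "g' \<in> kS"
    unfolding f'_def g'_def by (intro supported_diff supported_single f g cone_0)+
  have f'm: "f' \<in> kS_max" and g'm: "g' \<in> kS_max"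
    using kS_max_iff[OF f'] kS_max_iff[OF g'] by (simp_all add: f'_def g'_def lookup_minus)
  let ?c = "\<lambda>h. single 0 (lookup h 0) :: 'g \<Rightarrow>\<^sub>0 'k"
  have "f * g = ?c f * ?c g + (?c f * g' + g * f')"
    unfolding f'_def g'_def by (simp add: algebra_simps)
  moreover have c: "?c f \<in> kS" by (intro supported_single cone_0)
  have "?c f * g' + g * f' \<in> kS_max"
  proof (rule supported_add)
    show "?c f * g' \<in> kS_max" using prime_ideal_kS_max c g'm unfolding prime_ideal_of_def by simp
    show "g * f' \<in> kS_max" using prime_ideal_kS_max g f'm unfolding prime_ideal_of_def by simp
  qed
  then have "lookup (?c f * g' + g * f') 0 = 0"
    by (auto simp: supported_def in_keys_iff)
  ultimately show ?thesis by (simp add: lookup_add mult_single)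
qed

lemma lookup_power_0:
  assumes "f \<in> kS"
  shows "lookup (f ^ n) 0 = lookup f 0 ^ n"
  by (induction n) (simp_all add: lookup_mult_0 assms ring_closedD(7)[OF ring_closed_kS])

lemmas kS_mult = ring_closedD(4)[OF ring_closed_kS]
lemmas kS_power = ring_closedD(7)[OF ring_closed_kS]

lemma lookup_0_nonzero: "lookup g 0 \<noteq> 0 \<Longrightarrow> ev g \<noteq> 0"
  by (auto simp: ev_eq_0_iff)

text \<open>The projection to the residue field, which is k itself. That the quotient of constant
  terms does not depend on the fraction is \<open>residue_fraction\<close>.\<close>

definition residue :: "'l \<Rightarrow> 'k" where
  "residue x = (THE c. \<exists>f\<in>kS. \<exists>g\<in>kS. lookup g 0 \<noteq> 0 \<and> x = ev f / ev g \<and>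
     c = lookup f 0 / lookup g 0)"

lemma residue_fraction:
  assumes "f \<in> kS" "g \<in> kS" "lookup g 0 \<noteq> 0"
  shows "residue (ev f / ev g) = lookup f 0 / lookup g 0"
  unfolding residue_def
proof (rule the_equality)
  fix c assume "\<exists>f'\<in>kS. \<exists>g'\<in>kS. lookup g' 0 \<noteq> 0 \<and> ev f / ev g = ev f' / ev g' \<and>
     c = lookup f' 0 / lookup g' 0"
  then obtain f' g' where *: "f' \<in> kS" "g' \<in> kS" "lookup g' 0 \<noteq> 0" "ev f / ev g = ev f' / ev g'"
    "c = lookup f' 0 / lookup g' 0" by auto
  have "ev (f * g') = ev (f' * g)"
    using *(4) lookup_0_nonzero[OF *(3)] lookup_0_nonzero[OF assms(3)] by (simp add: field_simps)
  then have "f * g' = f' * g" by (simp only: ev_inj)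
  then have "lookup f 0 * lookup g' 0 = lookup f' 0 * lookup g 0"
    using lookup_mult_0 * assms by metis
  then show "c = lookup f 0 / lookup g 0"
    using *(3,5) assms(3) by (simp add: frac_eq_eq)
qed (use assms in blast)

lemma residue_add:
  assumes "x \<in> local_ring" "y \<in> local_ring"
  shows "residue (x + y) = residue x + residue y"
proof -
  obtain f g f' g' where *: "f \<in> kS" "g \<in> kS" "lookup g 0 \<noteq> 0" "x = ev f / ev g"
    "f' \<in> kS" "g' \<in> kS" "lookup g' 0 \<noteq> 0" "y = ev f' / ev g'"
    using assms unfolding local_ring_iff by blast
  have "x + y = ev (f * g' + f' * g) / ev (g * g')"
    using *(4,8) lookup_0_nonzero[OF *(3)] lookup_0_nonzero[OF *(7)] by (simp add: add_frac_eq)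
  moreover have "residue \<dots> = lookup f 0 / lookup g 0
      + lookup f' 0 / lookup g' 0"
    using * by (subst residue_fraction) (auto intro: supported_add kS_mult simp: lookup_mult_0 lookup_add add_frac_eq)
  ultimately show ?thesis using * by (simp add: residue_fraction)
qed

lemma residue_mult:
  assumes "x \<in> local_ring" "y \<in> local_ring"
  shows "residue (x * y) = residue x * residue y"
proof -
  obtain f g f' g' where *: "f \<in> kS" "g \<in> kS" "lookup g 0 \<noteq> 0" "x = ev f / ev g"
    "f' \<in> kS" "g' \<in> kS" "lookup g' 0 \<noteq> 0" "y = ev f' / ev g'"
    using assms unfolding local_ring_iff by blast
  have "x * y = ev (f * f') / ev (g * g')" using * by simp
  moreover have "residue \<dots> = (lookup f 0 / lookup g 0)
      * (lookup f' 0 / lookup g' 0)"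
    using * by (subst residue_fraction) (auto intro: kS_mult simp: lookup_mult_0)
  ultimately show ?thesis using * by (simp add: residue_fraction)
qed

lemma ev_in_local_ring: "f \<in> kS \<Longrightarrow> ev f \<in> local_ring"
  unfolding local_ring_iff using ring_closedD(1)[OF ring_closed_kS]
  by (metis div_by_1 ev_1 lookup_one_zero one_neq_zero)

lemma residue_ev: "f \<in> kS \<Longrightarrow> residue (ev f) = lookup f 0"
  using residue_fraction[of f 1] ring_closedD(1)[OF ring_closed_kS] by simp

end

lemma lookup_single_mult:
  fixes f :: "'g::ab_group_add \<Rightarrow>\<^sub>0 'k::comm_ring_1"
  shows "lookup (single x c * f) y = c * lookup f (y - x)"
proof (induction f rule: poly_mapping_single_plus_induct)
  case (single w d)
  show ?case by (auto simp: mult_single lookup_single when_def)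
qed (simp add: lookup_add algebra_simps)

section \<open>The free rank of the ring of Frobenius roots\<close>

locale toric_ring_root = toric_ring \<iota> \<mu> \<Lambda>
  for \<iota> :: "'k::alg_closed_field \<Rightarrow> 'l::field" and \<mu> :: "'g::ab_group_add \<Rightarrow> 'l" and \<Lambda> +
  fixes q e :: nat
  assumes q_eq: "q = CHAR('k) ^ e"
begin

lemma q_pos: "q > 0"
  using char_pos by (simp add: q_eq)

lemma root_inj: "x ^ q = y ^ q \<Longrightarrow> x = y" for x y :: "'l alg_closure"
  using frobenius_inj[of x e y] char_prime by (simp add: CHAR_target q_eq)

text \<open>The choice hidden in \<open>frobenius_root\<close> is forced: p^e-th roots are unique in
  characteristic p. The same uniqueness makes \<open>root_mon\<close> multiplicative.\<close>

definition root_mon :: "'g \<Rightarrow> 'l alg_closure" where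
  "root_mon w = frobenius_root q (to_ac (\<mu> w))"

lemma root_mon_power: "root_mon w ^ q = to_ac (\<mu> w)"
  unfolding root_mon_def by (rule frobenius_root_power[OF q_pos])

sublocale root: monomial_eval "\<lambda>c. to_ac (\<iota> c)" root_mon
proof
  show "root_mon 0 = 1" by (rule root_inj) (simp add: root_mon_power \<mu>_0)
  show "root_mon (u + v) = root_mon u * root_mon v" for u v
    by (rule root_inj) (simp add: root_mon_power \<mu>_add power_mult_distrib)
qed (simp_all add: \<iota>_1 \<iota>_add \<iota>_mult)

text \<open>Multiplies exponents by q and leaves coefficients alone. By \<open>root_dil\<close>,
  multiplying a root by a ring element is multiplication by a dilated element on the level of
  exponents.\<close>

sublocale dil: monomial_eval "single 0" "\<lambda>w. single (dilate q w) (1 :: 'k)"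
  by standard (simp_all add: single_add mult_single dilate_add)

lemma dil_single: "dil.ev (single w c) = single (dilate q w) c"
  by (simp add: mult_single)

lemma root_mon_dilate: "root_mon (dilate q w) = to_ac (\<mu> w)"
  by (rule root_inj) (simp add: root_mon_power \<mu>_dilate)

lemma root_dil: "root.ev (dil.ev b) = to_ac (ev b)"
  by (induction b rule: poly_mapping_single_plus_induct) (simp_all add: mult_single root_mon_dilate)

text \<open>Frobenius on coefficients only. The q-th power of \<open>root.ev f\<close> has the same
  exponents, because the q in the power and the root in \<open>root_mon\<close> cancel. It is
  surjective because k contains all q-th roots.\<close>

abbreviation power_coeffs :: "('g \<Rightarrow>\<^sub>0 'k) \<Rightarrow> ('g \<Rightarrow>\<^sub>0 'k)" where
  "power_coeffs \<equiv> Poly_Mapping.map (\<lambda>c. c ^ q)"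

lemma lookup_power_coeffs: "lookup (power_coeffs f) w = lookup f w ^ q"
  using q_pos by (simp add: lookup_map_zero)

lemma keys_power_coeffs: "keys (power_coeffs f) = keys f"
  using q_pos by (auto simp: in_keys_iff lookup_power_coeffs)

lemma root_ev_power: "root.ev f ^ q = to_ac (ev (power_coeffs f))"
proof -
  have "root.ev f ^ q = (\<Sum>w\<in>keys f. (to_ac (\<iota> (lookup f w)) * root_mon w) ^ q)"
    unfolding mon_eval_def
    by (rule freshmans_dream_sum'[where n = e]) (simp_all add: CHAR_target char_prime q_eq)
  also have "\<dots> = to_ac (ev (power_coeffs f))"
    unfolding mon_eval_def keys_power_coeffs
    by (simp add: to_ac_sum power_mult_distrib root_mon_power lookup_power_coeffs \<iota>_power)
  finally show ?thesis .
qed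

lemma root_ev_inj: "root.ev f = root.ev g \<longleftrightarrow> f = g"
proof
  assume "root.ev f = root.ev g"
  then have "to_ac (ev (power_coeffs (f - g))) = 0"
    using q_pos unfolding root_ev_power[symmetric] by simp
  then have "power_coeffs (f - g) = 0" by (simp add: ev_eq_0_iff)
  then have "lookup (f - g) w ^ q = 0" for w using lookup_power_coeffs[of "f - g" w] by simp
  then have "f - g = 0" by (intro poly_mapping_eqI) simp
  then show "f = g" by simp
qed simp

lemma power_coeffs_surj: "\<exists>f. power_coeffs f = h"
proof -
  have "frobenius_root q (0 :: 'k) = 0" using frobenius_root_power[OF q_pos, of "0 :: 'k"] by simp
  then have "power_coeffs (Poly_Mapping.map (frobenius_root q) h) = h"
    by (intro poly_mapping_eqI) (simp add: lookup_power_coeffs lookup_map_zero frobenius_root_power q_pos)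
  then show ?thesis ..
qed

abbreviation root_ring :: "'l alg_closure set" where "root_ring \<equiv> roots_ring local_ring q"

text \<open>Multiplying f / g by g^(q - 1) above and below makes the denominator a q-th power. The
  root of the fraction then has the old denominator g, and its numerator comes from extracting roots
  of coefficients.\<close>

lemma root_ring_iff:
  "x \<in> root_ring \<longleftrightarrow>
    (\<exists>f\<in>kS. \<exists>g\<in>kS. lookup g 0 \<noteq> 0 \<and> x = root.ev f / to_ac (ev g))"
proof
  assume "x \<in> root_ring"
  then obtain f g where fg: "f \<in> kS" "g \<in> kS" "lookup g 0 \<noteq> 0" "x ^ q = to_ac (ev f / ev g)"
    unfolding roots_ring_def by (auto simp: local_ring_iff)
  obtain h where h: "power_coeffs h = f * g ^ (q - 1)" using power_coeffs_surj by blast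
  have g0: "ev g \<noteq> 0" using fg(3) by (rule lookup_0_nonzero)
  have "ev g ^ q = ev g * ev g ^ (q - 1)" using q_pos by (metis Suc_pred' power_Suc)
  then have "ev f / ev g = ev (f * g ^ (q - 1)) / ev g ^ q" using g0 by simp
  then have "x ^ q = to_ac (ev (f * g ^ (q - 1)) / ev g ^ q)" using fg(4) by (simp only:)
  also have "\<dots> = (root.ev h / to_ac (ev g)) ^ q"
    by (simp only: power_divide root_ev_power h to_ac_divide to_ac_power)
  finally have "x ^ q = (root.ev h / to_ac (ev g)) ^ q" .
  then have "x = root.ev h / to_ac (ev g)" by (rule root_inj)
  moreover have "f * g ^ (q - 1) \<in> kS" using fg by (intro kS_mult kS_power)
  then have "h \<in> kS" using keys_power_coeffs[of h] h by (simp add: supported_def)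
  ultimately show "\<exists>f\<in>kS. \<exists>g\<in>kS. lookup g 0 \<noteq> 0 \<and> x = root.ev f / to_ac (ev g)"
    using fg by blast
next
  assume "\<exists>f\<in>kS. \<exists>g\<in>kS. lookup g 0 \<noteq> 0 \<and> x = root.ev f / to_ac (ev g)"
  then obtain f g where fg: "f \<in> kS" "g \<in> kS" "lookup g 0 \<noteq> 0" "x = root.ev f / to_ac (ev g)"
    by blast
  have "x ^ q = to_ac (ev (power_coeffs f) / ev (g ^ q))"
    unfolding fg(4) by (simp add: power_divide root_ev_power)
  moreover have "power_coeffs f \<in> kS" using fg(1) by (simp add: supported_def keys_power_coeffs)
  moreover have "lookup (g ^ q) 0 \<noteq> 0" using fg by (simp add: lookup_power_0)
  ultimately show "x \<in> root_ring"
    unfolding roots_ring_def using local_ring_iff kS_power[OF fg(2)] by blast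
qed

lemma dil_kS: "f \<in> kS \<Longrightarrow> dil.ev f \<in> kS"
proof -
  assume f: "f \<in> kS"
  have "dilate q w \<in> cone" if "w \<in> cone" for w
    using that by (auto simp: cone_def functional_dilate)
  then show ?thesis using f unfolding mon_eval_def
    by (intro supported_sum) (auto simp: mult_single supported_def)
qed

lemma root_ring_add:
  assumes "x \<in> root_ring" "y \<in> root_ring"
  shows "x + y \<in> root_ring"
proof -
  obtain f g f' g' where *: "f \<in> kS" "g \<in> kS" "lookup g 0 \<noteq> 0" "x = root.ev f / to_ac (ev g)"
    "f' \<in> kS" "g' \<in> kS" "lookup g' 0 \<noteq> 0" "y = root.ev f' / to_ac (ev g')"
    using assms unfolding root_ring_iff by blast
  have "x + y = root.ev (f * dil.ev g' + f' * dil.ev g) / to_ac (ev (g * g'))"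
    using *(4,8) lookup_0_nonzero[OF *(3)] lookup_0_nonzero[OF *(7)] by (simp add: root_dil add_frac_eq)
  moreover have "f * dil.ev g' + f' * dil.ev g \<in> kS" "g * g' \<in> kS" "lookup (g * g') 0 \<noteq> 0"
    using * by (auto intro: supported_add kS_mult dil_kS simp: lookup_mult_0)
  ultimately show ?thesis unfolding root_ring_iff by blast
qed

lemma root_ring_scale:
  assumes "r \<in> local_ring" "x \<in> root_ring"
  shows "to_ac r * x \<in> root_ring"
proof -
  obtain f g f' g' where *: "f \<in> kS" "g \<in> kS" "lookup g 0 \<noteq> 0" "r = ev f / ev g"
    "f' \<in> kS" "g' \<in> kS" "lookup g' 0 \<noteq> 0" "x = root.ev f' / to_ac (ev g')"
    using assms unfolding root_ring_iff local_ring_iff by blast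
  have "to_ac r * x = root.ev (dil.ev f * f') / to_ac (ev (g * g'))" using * by (simp add: root_dil)
  moreover have "dil.ev f * f' \<in> kS" "g * g' \<in> kS" "lookup (g * g') 0 \<noteq> 0"
    using * by (auto intro: kS_mult dil_kS simp: lookup_mult_0)
  ultimately show ?thesis unfolding root_ring_iff by blast
qed

lemma root_ev_mem: "f \<in> kS \<Longrightarrow> root.ev f \<in> root_ring"
  unfolding root_ring_iff using ring_closedD(1)[OF ring_closed_kS]
  by (metis div_by_1 ev_1 to_ac_1 lookup_one_zero one_neq_zero)

section \<open>Coordinates along the monomials of the box\<close>

definition part :: "'g \<Rightarrow> ('g \<Rightarrow>\<^sub>0 'k) \<Rightarrow> ('g \<Rightarrow>\<^sub>0 'k)" where
  "part u f = Poly_Mapping.map_key (\<lambda>v. u + dilate q v) f"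

lemma lookup_part: "lookup (part u f) v = lookup f (u + dilate q v)"
proof -
  have "inj (\<lambda>v. u + dilate q v)" using dilate_inj[OF q_pos] by (intro injI) simp
  then show ?thesis unfolding part_def by (simp add: map_key.rep_eq)
qed

lemma part_add: "part u (f + g) = part u f + part u g"
  by (rule poly_mapping_eqI) (simp add: lookup_part lookup_add)

text \<open>\<open>part u\<close> collects the terms in the class u + q G and divides out, so it is
  the coordinate along \<open>root_mon u\<close>. Multiplication by a dilated element preserves
  classes; this gives linearity over the local ring and makes \<open>component\<close> independent
  of the fraction.\<close>

lemma part_dil_mult: "part u (dil.ev b * f) = b * part u f"
proof (induction b rule: poly_mapping_single_plus_induct)
  case (single w c)
  have "u + dilate q v - dilate q w = u + dilate q (v - w)" for v
    using dilate_add[of q "v - w" w] by (simp add: algebra_simps)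
  then show ?case
    by (intro poly_mapping_eqI) (simp only: dil_single lookup_part lookup_single_mult)
qed (simp add: part_add distrib_right)

text \<open>Values of a functional on the box differ by less than q, so a difference divisible by q
  is 0.\<close>

lemma box_unique:
  assumes "u \<in> box q" "u' \<in> box q" "u = u' + dilate q v"
  shows "v = 0"
proof (rule separating)
  fix l assume l: "l \<in> \<Lambda>"
  have "l u = l u' + int q * l v" using assms(3) l by (simp add: functional_add functional_dilate)
  moreover have "0 \<le> l u" "l u < int q" "0 \<le> l u'" "l u' < int q" using assms(1,2) l by (auto simp: box_def)
  ultimately have "\<bar>int q * l v\<bar> < int q" by linarith
  then show "l v = 0" using q_pos by (simp add: abs_mult)
qed

lemma box_subset_cone: "box q \<subseteq> cone"
  by (auto simp: box_def cone_def)

text \<open>The upper bound defining the box is used here: l u < q and l u + q (l v) \<ge> 0 force l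
  v > -1, hence l v \<ge> 0 by integrality.\<close>

lemma part_kS:
  assumes "u \<in> box q" "f \<in> kS"
  shows "part u f \<in> kS"
proof -
  have "v \<in> cone" if "u + dilate q v \<in> cone" for v
    unfolding cone_def
  proof (intro CollectI ballI)
    fix l assume l: "l \<in> \<Lambda>"
    have "0 \<le> l u + int q * l v" using that l by (simp add: cone_def functional_add functional_dilate)
    moreover have "l u < int q" using assms(1) l by (auto simp: box_def)
    ultimately have "int q * (l v + 1) > 0" by (simp add: distrib_left)
    then show "0 \<le> l v" using q_pos by (simp add: zero_less_mult_iff)
  qed
  then show ?thesis using assms(2) by (auto simp: supported_def in_keys_iff lookup_part)
qed

definition component :: "'g \<Rightarrow> 'l alg_closure \<Rightarrow> 'l" where
  "component u x = (THE y. \<exists>f\<in>kS. \<exists>g\<in>kS. lookup g 0 \<noteq> 0 \<and>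
     x = root.ev f / to_ac (ev g) \<and> y = ev (part u f) / ev g)"

lemma component_fraction:
  assumes "f \<in> kS" "g \<in> kS" "lookup g 0 \<noteq> 0"
  shows "component u (root.ev f / to_ac (ev g)) = ev (part u f) / ev g"
  unfolding component_def
proof (rule the_equality)
  fix y assume "\<exists>f'\<in>kS. \<exists>g'\<in>kS. lookup g' 0 \<noteq> 0 \<and>
     root.ev f / to_ac (ev g) = root.ev f' / to_ac (ev g') \<and> y = ev (part u f') / ev g'"
  then obtain f' g' where *: "f' \<in> kS" "g' \<in> kS" "lookup g' 0 \<noteq> 0"
    "root.ev f / to_ac (ev g) = root.ev f' / to_ac (ev g')" "y = ev (part u f') / ev g'" by blast
  have nz: "ev g \<noteq> 0" "ev g' \<noteq> 0" using * assms lookup_0_nonzero by auto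
  have "root.ev (dil.ev g' * f) = root.ev (dil.ev g * f')"
    using *(4) nz by (simp add: root_dil frac_eq_eq mult.commute)
  then have "dil.ev g' * f = dil.ev g * f'" by (simp only: root_ev_inj)
  then have "ev (g' * part u f) = ev (g * part u f')" by (metis part_dil_mult)
  then show "y = ev (part u f) / ev g" using nz *(5) by (simp add: frac_eq_eq mult.commute)
qed (use assms in blast)

lemma component_mem:
  assumes "u \<in> box q" "x \<in> root_ring"
  shows "component u x \<in> local_ring"
proof -
  obtain f g where *: "f \<in> kS" "g \<in> kS" "lookup g 0 \<noteq> 0" "x = root.ev f / to_ac (ev g)"
    using assms(2) unfolding root_ring_iff by blast
  then show ?thesis using component_fraction[of f g u] part_kS[OF assms(1) *(1)] local_ring_iff by blast
qed

lemma component_add: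
  assumes "x \<in> root_ring" "y \<in> root_ring"
  shows "component u (x + y) = component u x + component u y"
proof -
  obtain f g f' g' where *: "f \<in> kS" "g \<in> kS" "lookup g 0 \<noteq> 0" "x = root.ev f / to_ac (ev g)"
    "f' \<in> kS" "g' \<in> kS" "lookup g' 0 \<noteq> 0" "y = root.ev f' / to_ac (ev g')"
    using assms unfolding root_ring_iff by blast
  have nz: "ev g \<noteq> 0" "ev g' \<noteq> 0" using * lookup_0_nonzero by auto
  have "x + y = root.ev (dil.ev g' * f + dil.ev g * f') / to_ac (ev (g * g'))"
    using *(4,8) nz by (simp add: root_dil add_frac_eq mult.commute)
  moreover have "dil.ev g' * f + dil.ev g * f' \<in> kS" "g * g' \<in> kS" "lookup (g * g') 0 \<noteq> 0"
    using * by (auto intro: supported_add kS_mult dil_kS simp: lookup_mult_0)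
  ultimately have "component u (x + y) = ev (part u (dil.ev g' * f + dil.ev g * f')) / ev (g * g')"
    by (metis component_fraction)
  also have "\<dots> = ev (part u f) / ev g + ev (part u f') / ev g'"
    using nz by (simp add: part_add part_dil_mult add_divide_distrib)
  also have "\<dots> = component u x + component u y"
    using * by (simp add: component_fraction)
  finally show ?thesis .
qed

lemma component_scale:
  assumes "r \<in> local_ring" "x \<in> root_ring"
  shows "component u (to_ac r * x) = r * component u x"
proof -
  obtain f g f' g' where *: "f \<in> kS" "g \<in> kS" "lookup g 0 \<noteq> 0" "r = ev f / ev g"
    "f' \<in> kS" "g' \<in> kS" "lookup g' 0 \<noteq> 0" "x = root.ev f' / to_ac (ev g')"
    using assms unfolding root_ring_iff local_ring_iff by blast
  have "to_ac r * x = root.ev (dil.ev f * f') / to_ac (ev (g * g'))" using * by (simp add: root_dil)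
  moreover have "dil.ev f * f' \<in> kS" "g * g' \<in> kS" "lookup (g * g') 0 \<noteq> 0"
    using * by (auto intro: kS_mult dil_kS simp: lookup_mult_0)
  ultimately have "component u (to_ac r * x) = ev (part u (dil.ev f * f')) / ev (g * g')"
    by (metis component_fraction)
  also have "\<dots> = r * component u x"
    using * by (simp add: component_fraction part_dil_mult)
  finally show ?thesis .
qed

lemma component_root_mon:
  assumes "u \<in> box q" "u' \<in> box q"
  shows "component u (root_mon u') = (if u = u' then 1 else 0)"
proof -
  have "u' = u + dilate q v \<longleftrightarrow> u = u' \<and> v = 0" for v
    using box_unique[OF assms(2,1), of v] by (cases "v = 0") auto
  then have "part u (single u' 1) = (if u = u' then 1 else 0)"
    by (intro poly_mapping_eqI) (auto simp: lookup_part lookup_single when_def lookup_one)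
  then show ?thesis
    using component_fraction[of "single u' 1" 1 u] ring_closedD(1)[OF ring_closed_kS]
      supported_single[of u' cone "1 :: 'k"] assms box_subset_cone
    by (auto simp: \<iota>_1)
qed

section \<open>The free rank as the number of lattice points of the box\<close>

lemma root_ring_0: "0 \<in> root_ring"
  using root_ev_mem[of 0] by simp

lemma root_mon_mem: "w \<in> cone \<Longrightarrow> root_mon w \<in> root_ring"
  using root_ev_mem[OF supported_single[of w cone 1]] by (simp add: \<iota>_1)

lemma additive_sum:
  fixes \<psi> :: "'l alg_closure \<Rightarrow> 'l"
  assumes "\<And>x y. x \<in> root_ring \<Longrightarrow> y \<in> root_ring \<Longrightarrow> \<psi> (x + y) = \<psi> x + \<psi> y"
    and "\<And>i. i \<in> I \<Longrightarrow> x i \<in> root_ring"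
  shows "\<psi> (sum x I) = (\<Sum>i\<in>I. \<psi> (x i)) \<and> sum x I \<in> root_ring"
proof -
  have "\<psi> 0 = 0" using assms(1)[OF root_ring_0 root_ring_0] by (metis add.right_neutral add_left_imp_eq)
  then show ?thesis
    using assms by (induction I rule: infinite_finite_induct) (auto simp: root_ring_0 root_ring_add)
qed

text \<open>Components at box points are dual to the box monomials, so a tuple y is attained at the
  sum of the products of \<open>y i\<close> with \<open>root_mon (h i)\<close>. The value
  \<open>undefined\<close> from N on makes the images extensional, as membership in
  \<open>{..<N} \<rightarrow>\<^sub>E local_ring\<close> demands.\<close>

lemma free_rank_lower:
  fixes N :: nat
  assumes h: "bij_betw h {..<N} (box q)"
  defines "\<phi> \<equiv> \<lambda>x i. if i < N then component (h i) x else undefined"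
  shows "\<phi> ` root_ring = ({..<N} \<rightarrow>\<^sub>E local_ring)"
proof (intro equalityI subsetI)
  have hb: "h i \<in> box q" if "i < N" for i using h that by (auto simp: bij_betw_def)
  fix y assume "y \<in> \<phi> ` root_ring"
  then show "y \<in> {..<N} \<rightarrow>\<^sub>E local_ring"
    using component_mem hb by (auto simp: \<phi>_def PiE_def extensional_def)
next
  have hb: "h i \<in> box q" if "i < N" for i using h that by (auto simp: bij_betw_def)
  fix y assume y: "y \<in> {..<N} \<rightarrow>\<^sub>E local_ring"
  define x where "x i = to_ac (y i) * root_mon (h i)" for i
  have x: "x i \<in> root_ring" if "i \<in> {..<N}" for i
    unfolding x_def using y that hb[of i] box_subset_cone by (auto intro!: root_ring_scale root_mon_mem)
  have "component (h j) (sum x {..<N}) = y j" if "j < N" for j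
  proof -
    have "component (h j) (sum x {..<N}) = (\<Sum>i<N. component (h j) (x i))"
      using additive_sum[of "component (h j)" "{..<N}" x] component_add x by blast
    also have "\<dots> = (\<Sum>i<N. if i = j then y j else 0)"
    proof (rule sum.cong[OF refl])
      fix i assume i: "i \<in> {..<N}"
      have "h j = h i \<longleftrightarrow> j = i" using h i that by (auto simp: bij_betw_def inj_on_def)
      then show "component (h j) (x i) = (if i = j then y j else 0)"
        unfolding x_def using component_scale[of "y i" "root_mon (h i)" "h j"] y i that hb box_subset_cone
        by (auto simp: component_root_mon root_mon_mem subset_iff PiE_def Pi_def)
    qed
    finally show ?thesis using that by simp
  qed
  then have "\<phi> (sum x {..<N}) = y"
    using y unfolding \<phi>_def by (auto simp: PiE_def extensional_def fun_eq_iff)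
  moreover have "sum x {..<N} \<in> root_ring"
    using additive_sum[of "component (h 0)" "{..<N}" x] component_add x by blast
  ultimately show "y \<in> \<phi> ` root_ring" by blast
qed

text \<open>Outside the box, some facet functional \<open>l\<close> is at least \<open>q\<close> at \<open>w\<close>, so \<open>w + q s\<close> stays in the cone for
  some \<open>s\<close> with \<open>l s = -1\<close>. If \<open>\<psi>\<close> had a unit value at \<open>w\<close>, then \<open>\<mu> s\<close> would lie in the local ring, whose
  elements have nonnegative \<open>l\<close>-valuation.\<close>

lemma residue_outside_box:
  assumes scale: "\<And>r x. r \<in> local_ring \<Longrightarrow> x \<in> root_ring \<Longrightarrow> \<psi> (to_ac r * x) = r * \<psi> x"
    and mem: "\<And>x. x \<in> root_ring \<Longrightarrow> \<psi> x \<in> local_ring"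
    and w: "w \<in> cone" "w \<notin> box q"
  shows "residue (\<psi> (root_mon w)) = 0"
proof (rule ccontr)
  assume nz: "residue (\<psi> (root_mon w)) \<noteq> 0"
  obtain l where l: "l \<in> \<Lambda>" "l w \<ge> int q" using w by (auto simp: box_def cone_def not_less)
  obtain s where s: "l s = -1" "\<And>l'. l' \<in> \<Lambda> \<Longrightarrow> l' \<noteq> l \<Longrightarrow> l' s \<ge> 0" using facet[OF l(1)] by blast
  obtain t where t: "\<And>l. l \<in> \<Lambda> \<Longrightarrow> l t \<ge> 1" using interior by blast
  have ws: "w + dilate q s \<in> cone"
    unfolding cone_def
  proof (intro CollectI ballI)
    fix l' assume l': "l' \<in> \<Lambda>"
    then have "0 \<le> l' w" using w by (simp add: cone_def)
    then show "0 \<le> l' (w + dilate q s)"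
      using s l l' by (cases "l' = l") (simp_all add: functional_add functional_dilate)
  qed
  have tc: "t \<in> cone" using t unfolding cone_def by force
  have st: "t + s \<in> cone"
    unfolding cone_def
  proof (intro CollectI ballI)
    fix l' assume l': "l' \<in> \<Lambda>"
    show "0 \<le> l' (t + s)"
      using s(1) s(2)[OF l'] t[OF l'] functional_add[OF l', of t s] by (cases "l' = l") simp_all
  qed
  have A: "\<mu> v \<in> local_ring" if "v \<in> cone" for v
    using ev_in_local_ring[OF supported_single[OF that, of 1]] by (simp add: \<iota>_1)
  \<comment> \<open>The exponent s lies outside the cone, so linearity of \<open>\<psi>\<close>
    applies only after the interior point t is added; the factor \<open>\<mu> t\<close> is cancelled
    afterwards.\<close>
  have "to_ac (\<mu> (t + s)) * root_mon w = to_ac (\<mu> t) * root_mon (w + dilate q s)"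
    by (simp add: \<mu>_add root.\<mu>_add root_mon_dilate)
  then have "\<mu> (t + s) * \<psi> (root_mon w) = \<mu> t * \<psi> (root_mon (w + dilate q s))"
    using scale[OF A[OF st] root_mon_mem[OF w(1)]] scale[OF A[OF tc] root_mon_mem[OF ws]] by simp
  then have eq: "\<mu> s * \<psi> (root_mon w) = \<psi> (root_mon (w + dilate q s))"
    using \<mu>_nonzero[of t] by (simp add: \<mu>_add mult.assoc)
  obtain f g f' g' where *: "f \<in> kS" "g \<in> kS" "lookup g 0 \<noteq> 0" "\<psi> (root_mon w) = ev f / ev g"
    "f' \<in> kS" "g' \<in> kS" "lookup g' 0 \<noteq> 0" "\<psi> (root_mon (w + dilate q s)) = ev f' / ev g'"
    using mem[OF root_mon_mem[OF w(1)]] mem[OF root_mon_mem[OF ws]] unfolding local_ring_iff by metis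
  have "ev (single s 1 * (f * g')) = ev (f' * g)"
    using eq * lookup_0_nonzero[OF *(3)] lookup_0_nonzero[OF *(7)]
    by (simp add: \<iota>_1 frac_eq_eq mult_ac)
  then have eq2: "single s 1 * (f * g') = f' * g" by (simp only: ev_inj)
  \<comment> \<open>The coefficient at s is a product of two nonzero constant terms. This puts s
    into the cone, against l s = -1.\<close>
  have "lookup (f' * g) s = lookup f 0 * lookup g' 0"
    unfolding eq2[symmetric] lookup_single_mult using * by (simp add: lookup_mult_0)
  moreover have "lookup f 0 \<noteq> 0"
    using nz * by (simp add: residue_fraction)
  ultimately have "s \<in> keys (f' * g)" using * by (simp add: in_keys_iff)
  then have "s \<in> cone" using kS_mult[OF *(5,2)] by (auto simp: supported_def)
  then show False using l s(1) by (auto simp: cone_def)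
qed

text \<open>Modulo the maximal ideal a homomorphism to the local ring sees only the finitely many
  monomials of the box: all others go to residue 0 by \<open>residue_outside_box\<close>, and
  coefficients pass through as elements of k.\<close>

lemma residue_hom_formula:
  assumes add: "\<And>x y. x \<in> root_ring \<Longrightarrow> y \<in> root_ring \<Longrightarrow> \<psi> (x + y) = \<psi> x + \<psi> y"
    and scale: "\<And>r x. r \<in> local_ring \<Longrightarrow> x \<in> root_ring \<Longrightarrow> \<psi> (to_ac r * x) = r * \<psi> x"
    and mem: "\<And>x. x \<in> root_ring \<Longrightarrow> \<psi> x \<in> local_ring"
    and fg: "f \<in> kS" "g \<in> kS" "lookup g 0 \<noteq> 0"
  shows "residue (\<psi> (root.ev f / to_ac (ev g)))
    = (\<Sum>w\<in>box q. lookup f w / lookup g 0 * residue (\<psi> (root_mon w)))"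
proof -
  let ?x = "root.ev f / to_ac (ev g)"
  have x: "?x \<in> root_ring" using fg root_ring_iff by blast
  have fin: "finite (box q)" unfolding box_def by (rule finite_box)
  let ?T = "keys f \<union> box q"
  have T: "?T \<subseteq> cone" using fg(1) box_subset_cone by (auto simp: supported_def)
  have c: "\<iota> c \<in> local_ring" for c
    using ev_in_local_ring[OF supported_single[OF cone_0, of c]] by (simp add: \<mu>_0)
  have rc: "residue (\<iota> c) = c" for c
    using residue_ev[OF supported_single[OF cone_0, of c]] by (simp add: \<mu>_0)
  have "ev g * \<psi> ?x = \<psi> (to_ac (ev g) * ?x)" using scale[OF ev_in_local_ring[OF fg(2)] x] ..
  also have "\<dots> = \<psi> (root.ev f)" using lookup_0_nonzero[OF fg(3)] by simp
  also have "\<dots> = \<psi> (\<Sum>w\<in>?T. to_ac (\<iota> (lookup f w)) * root_mon w)"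
    by (subst root.ev_superset[of ?T]) (use fin in auto)
  also have "\<dots> = (\<Sum>w\<in>?T. \<psi> (to_ac (\<iota> (lookup f w)) * root_mon w))"
    using additive_sum[of \<psi> ?T "\<lambda>w. to_ac (\<iota> (lookup f w)) * root_mon w"] add
      root_ring_scale[OF c root_mon_mem] T by blast
  also have "\<dots> = (\<Sum>w\<in>?T. \<iota> (lookup f w) * \<psi> (root_mon w))"
    by (rule sum.cong[OF refl], rule scale[OF c root_mon_mem]) (use T in auto)
  finally have eq: "ev g * \<psi> ?x = (\<Sum>w\<in>?T. \<iota> (lookup f w) * \<psi> (root_mon w))" .
  have res_sum: "residue (sum y I) = (\<Sum>i\<in>I. residue (y i)) \<and> sum y I \<in> local_ring"
    if "\<And>i. i \<in> I \<Longrightarrow> y i \<in> local_ring" for y :: "'g \<Rightarrow> 'l" and I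
  proof -
    have "residue 0 = 0" using rc[of 0] by (simp add: \<iota>_0)
    then show ?thesis using that
      by (induction I rule: infinite_finite_induct)
         (auto simp: residue_add ring_closedD[OF ring_closed_local_ring])
  qed
  have "lookup g 0 * residue (\<psi> ?x) = residue (ev g * \<psi> ?x)"
    using residue_mult[OF ev_in_local_ring[OF fg(2)] mem[OF x]] residue_ev[OF fg(2)] by simp
  also have "\<dots> = (\<Sum>w\<in>?T. residue (\<iota> (lookup f w) * \<psi> (root_mon w)))"
    unfolding eq
    using res_sum[of ?T "\<lambda>w. \<iota> (lookup f w) * \<psi> (root_mon w)"]
      ring_closedD(4)[OF ring_closed_local_ring c mem[OF root_mon_mem]] T by blast
  also have "\<dots> = (\<Sum>w\<in>?T. lookup f w * residue (\<psi> (root_mon w)))"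
  proof (rule sum.cong[OF refl])
    fix w assume "w \<in> ?T"
    then have "\<psi> (root_mon w) \<in> local_ring" using T mem root_mon_mem by blast
    then show "residue (\<iota> (lookup f w) * \<psi> (root_mon w))
        = lookup f w * residue (\<psi> (root_mon w))"
      using residue_mult[OF c] rc by simp
  qed
  also have "\<dots> = (\<Sum>w\<in>box q. lookup f w * residue (\<psi> (root_mon w)))"
  proof (rule sum.mono_neutral_right)
    show "\<forall>w\<in>?T - box q. lookup f w * residue (\<psi> (root_mon w)) = 0"
      using residue_outside_box[OF scale mem] T by auto
  qed (use fin in auto)
  finally show ?thesis
    using fg(3) by (simp add: sum_divide_distrib[symmetric] field_simps)
qed

text \<open>A surjection onto a free module of rank N stays surjective on residues. By
  \<open>residue_hom_formula\<close> the standard basis vectors \<open>u j\<close> of k^N then lie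
  in the span of the residue vectors \<open>v w\<close> with w in the box, which bounds N.\<close>

lemma free_rank_upper:
  assumes add: "\<And>x y i. x \<in> root_ring \<Longrightarrow> y \<in> root_ring \<Longrightarrow> i < N \<Longrightarrow> \<phi> (x + y) i = \<phi> x i + \<phi> y i"
    and scale: "\<And>r x i. r \<in> local_ring \<Longrightarrow> x \<in> root_ring \<Longrightarrow> i < N \<Longrightarrow> \<phi> (to_ac r * x) i = r * \<phi> x i"
    and image: "\<phi> ` root_ring = ({..<N} \<rightarrow>\<^sub>E local_ring)"
  shows "N \<le> card (box q)"
proof -
  let ?s = "\<lambda>(c :: 'k) (f :: nat \<Rightarrow>\<^sub>0 'k). single 0 c * f"
  interpret V: vector_space ?s by (rule vector_space_poly_mapping)
  have fin: "finite (box q)" unfolding box_def by (rule finite_box)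
  define v where "v w = (\<Sum>i<N. single i (residue (\<phi> (root_mon w) i)))" for w
  have v: "lookup (v w) i = (if i < N then residue (\<phi> (root_mon w) i) else 0)" for w i
    by (simp add: v_def lookup_sum lookup_single when_def cong: if_cong)
  define u where "u j = single j (1 :: 'k)" for j :: nat
  have u: "lookup (u j) i = (if i = j then 1 else 0)" for j i
    by (simp add: u_def lookup_single when_def)
  have mem: "\<phi> x i \<in> local_ring" if "x \<in> root_ring" "i < N" for x i
    using image that by (auto simp: PiE_def Pi_def)
  have "u j \<in> V.span (v ` box q)" if j: "j < N" for j
  proof -
    have "(\<lambda>i\<in>{..<N}. if i = j then 1 else 0) \<in> {..<N} \<rightarrow>\<^sub>E local_ring"
      using ring_closedD(1,2)[OF ring_closed_local_ring] by auto
    then obtain x where x: "x \<in> root_ring" "\<phi> x = (\<lambda>i\<in>{..<N}. if i = j then 1 else 0)"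
      using image by (metis (no_types, lifting) imageE)
    obtain f g where fg: "f \<in> kS" "g \<in> kS" "lookup g 0 \<noteq> 0" "x = root.ev f / to_ac (ev g)"
      using x(1) unfolding root_ring_iff by blast
    have r1: "residue 1 = 1" "residue 0 = 0"
      using residue_ev[of 1] residue_ev[of 0] ring_closedD(1)[OF ring_closed_kS] by simp_all
    have "lookup (u j) i
        = (\<Sum>w\<in>box q. lookup f w / lookup g 0 * lookup (v w) i)" for i
    proof (cases "i < N")
      case True
      have "lookup (u j) i = residue (\<phi> x i)" using x(2) True r1 by (simp add: u)
      also have "\<dots> = (\<Sum>w\<in>box q. lookup f w / lookup g 0 * residue (\<phi> (root_mon w) i))"
        unfolding fg(4) by (rule residue_hom_formula[where \<psi> = "\<lambda>x. \<phi> x i"]) (use add scale mem fg True in auto)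
      finally show ?thesis using True by (simp add: v)
    qed (use j in \<open>simp add: u v\<close>)
    then have "u j = (\<Sum>w\<in>box q. ?s (lookup f w / lookup g 0) (v w))"
      by (intro poly_mapping_eqI) (simp add: lookup_sum lookup_const_mult)
    also have "\<dots> \<in> V.span (v ` box q)"
      by (intro V.span_sum V.span_scale V.span_base) auto
    finally show ?thesis .
  qed
  then have sub: "u ` {..<N} \<subseteq> V.span (v ` box q)" by auto
  have inj: "inj u"
    by (rule injI) (metis u zero_neq_one)
  have "V.independent (u ` {..<N})"
  proof (rule V.independent_if_scalars_zero)
    fix c x assume eq: "(\<Sum>x\<in>u ` {..<N}. ?s (c x) x) = 0" and x: "x \<in> u ` {..<N}"
    obtain j where j: "j < N" "x = u j" using x by auto
    have "0 = lookup (\<Sum>x\<in>u ` {..<N}. ?s (c x) x) j" using eq by simp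
    also have "\<dots> = (\<Sum>m<N. c (u m) * lookup (u m) j)"
      using inj by (subst sum.reindex) (auto simp: inj_on_def inj_def lookup_sum lookup_const_mult)
    also have "\<dots> = (\<Sum>m<N. if m = j then c (u j) else 0)"
      by (rule sum.cong) (auto simp: u)
    finally show "c x = 0" using j by simp
  qed simp
  from V.independent_span_bound[OF _ this sub] have "card (u ` {..<N}) \<le> card (v ` box q)"
    using fin by auto
  also have "\<dots> \<le> card (box q)" using fin by (rule card_image_le)
  finally show ?thesis using inj by (simp add: card_image inj_on_subset)
qed

theorem free_rank_root_ring:
  "free_rank local_ring (\<lambda>r x. to_ac r * x) root_ring = card (box q)"
  unfolding free_rank_def
proof (rule Greatest_equality)
  obtain h where h: "bij_betw h {..<card (box q)} (box q)"
    using ex_bij_betw_nat_finite[OF finite_box[of q]] by (auto simp: box_def atLeast0LessThan)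
  show "\<exists>\<phi>. (\<forall>x\<in>root_ring. \<forall>y\<in>root_ring. \<forall>i<card (box q). \<phi> (x + y) i = \<phi> x i + \<phi> y i) \<and>
     (\<forall>r\<in>local_ring. \<forall>x\<in>root_ring. \<forall>i<card (box q). \<phi> (to_ac r * x) i = r * \<phi> x i) \<and>
     \<phi> ` root_ring = ({..<card (box q)} \<rightarrow>\<^sub>E local_ring)"
    by (rule exI[of _ "\<lambda>x i. if i < card (box q) then component (h i) x else undefined"])
       (use free_rank_lower[OF h] in \<open>simp add: component_add component_scale\<close>)
next
  fix N :: nat assume "\<exists>\<phi>. (\<forall>x\<in>root_ring. \<forall>y\<in>root_ring. \<forall>i<N. \<phi> (x + y) i = \<phi> x i + \<phi> y i) \<and>
     (\<forall>r\<in>local_ring. \<forall>x\<in>root_ring. \<forall>i<N. \<phi> (to_ac r * x) i = r * \<phi> x i) \<and>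
     \<phi> ` root_ring = ({..<N} \<rightarrow>\<^sub>E local_ring)"
  then obtain \<phi> where \<phi>: "\<forall>x\<in>root_ring. \<forall>y\<in>root_ring. \<forall>i<N. \<phi> (x + y) i = \<phi> x i + \<phi> y i"
    "\<forall>r\<in>local_ring. \<forall>x\<in>root_ring. \<forall>i<N. \<phi> (to_ac r * x) i = r * \<phi> x i"
    "\<phi> ` root_ring = ({..<N} \<rightarrow>\<^sub>E local_ring)" by (elim exE conjE)
  show "N \<le> card (box q)"
    by (rule free_rank_upper[of N \<phi>]) (simp_all add: \<phi>)
qed

end

section \<open>Krull dimension\<close>

text \<open>The easy half of Lombardi's characterization of the Krull dimension: a polynomial relation
  with unit coefficients between elements \<open>x i \<in> P (i + 1) - P i\<close> collapses, one variable at a time,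
  by dividing by the lowest power of \<open>x i\<close> and reducing modulo \<open>x i\<close>.\<close>

lemma prime_chain_no_relation:
  fixes A :: "'a::idom set" and x :: "nat \<Rightarrow> 'a"
  assumes A: "ring_closed A"
    and P: "\<And>i. i \<le> Suc n \<Longrightarrow> prime_ideal_of A (P i)" and PS: "\<And>i. i \<le> n \<Longrightarrow> P i \<subseteq> P (Suc i)"
    and x: "\<And>i. i \<le> n \<Longrightarrow> x i \<in> P (Suc i) - P i"
    and j: "j \<le> Suc n"
    and M: "finite M" "M \<noteq> {}" "\<And>I. I \<in> M \<Longrightarrow> c I \<in> A - P (Suc n)"
    and distinct: "\<And>I J. I \<in> M \<Longrightarrow> J \<in> M \<Longrightarrow> (\<And>i. j \<le> i \<Longrightarrow> i \<le> n \<Longrightarrow> I i = J i) \<Longrightarrow> I = (J :: nat \<Rightarrow> nat)"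
    and rel: "(\<Sum>I\<in>M. c I * (\<Prod>i\<in>{j..n}. x i ^ I i)) \<in> P j"
  shows False
  using j M distinct rel
proof (induction "Suc n - j" arbitrary: j M)
  case 0
  then have j: "j = Suc n" by simp
  obtain I where I: "I \<in> M" using "0.prems"(3) by auto
  \<comment> \<open>With no variable left, the distinctness condition allows only one tuple.\<close>
  have "J = I" if "J \<in> M" for J
    by (rule "0.prems"(5)[OF that I]) (use j in simp)
  then have "M = {I}" using I by blast
  then have "c I \<in> P (Suc n)" using "0.prems"(6) j by simp
  then show False using "0.prems"(4)[OF I] by simp
next
  case (Suc d)
  then have jn: "j \<le> n" by simp
  note cl = ring_closedD[OF A]
  have PA: "P i \<subseteq> A" if "i \<le> Suc n" for i using P[OF that] by (auto simp: prime_ideal_of_def)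
  have xA: "x i \<in> A" if "i \<le> n" for i using x[OF that] PA[of "Suc i"] that by auto
  have sumA: "sum f S \<in> A" if "\<And>i. i \<in> S \<Longrightarrow> f i \<in> A" for f :: "(nat \<Rightarrow> nat) \<Rightarrow> 'a" and S
    using that by (induction S rule: infinite_finite_induct) (auto intro: cl)
  have prodA: "prod f S \<in> A" if "\<And>i. i \<in> S \<Longrightarrow> f i \<in> A" for f :: "nat \<Rightarrow> 'a" and S
    using that by (induction S rule: infinite_finite_induct) (auto intro: cl)
  \<comment> \<open>After division by \<open>x j ^ m\<close>, only the tuples with least exponent at
    j survive modulo \<open>x j\<close>. They agree at j, so they remain distinct in the later
    coordinates.\<close>
  define m where "m = Min ((\<lambda>I. I j) ` M)"
  have m_le: "m \<le> I j" if "I \<in> M" for I unfolding m_def using that Suc.prems by auto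
  have "m \<in> (\<lambda>I. I j) ` M" unfolding m_def by (rule Min_in) (use Suc.prems(2,3) in auto)
  then obtain I0 where I0: "I0 \<in> M" "I0 j = m" by auto
  define M' where "M' = {I \<in> M. I j = m}"
  let ?p = "\<lambda>I. c I * (\<Prod>i\<in>{Suc j..n}. x i ^ I i)"
  have pA: "?p I \<in> A" if "I \<in> M" for I
    by (intro cl(4) prodA cl(7) xA) (use that Suc.prems in auto)
  have split: "{j..n} = insert j {Suc j..n}" using jn by auto
  have "(\<Sum>I\<in>M. c I * (\<Prod>i\<in>{j..n}. x i ^ I i)) = (\<Sum>I\<in>M. x j ^ m * (x j ^ (I j - m) * ?p I))"
  proof (rule sum.cong[OF refl])
    fix I assume "I \<in> M"
    then have "x j ^ I j = x j ^ m * x j ^ (I j - m)" using m_le by (simp flip: power_add)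
    then show "c I * (\<Prod>i\<in>{j..n}. x i ^ I i) = x j ^ m * (x j ^ (I j - m) * ?p I)"
      by (simp add: split mult_ac)
  qed
  also have "\<dots> = x j ^ m * (\<Sum>I\<in>M. x j ^ (I j - m) * ?p I)" by (simp add: sum_distrib_left)
  finally have in_Pj: "x j ^ m * (\<Sum>I\<in>M. x j ^ (I j - m) * ?p I) \<in> P j" using Suc.prems by simp
  have "x j ^ k \<notin> P j" for k
  proof (induction k)
    case 0 then show ?case using P[of j] jn by (simp add: prime_ideal_of_def)
  next
    case (Suc k) then show ?case
      using P[of j] jn x[OF jn] xA[OF jn] cl(7)[OF xA[OF jn], of k] unfolding prime_ideal_of_def by auto
  qed
  moreover have sA: "(\<Sum>I\<in>M. x j ^ (I j - m) * ?p I) \<in> A"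
    by (intro sumA cl(4)[OF cl(7)[OF xA[OF jn]] pA])
  ultimately have "(\<Sum>I\<in>M. x j ^ (I j - m) * ?p I) \<in> P j"
    using in_Pj P[of j] jn cl(7)[OF xA[OF jn], of m] unfolding prime_ideal_of_def by auto
  then have s1: "(\<Sum>I\<in>M. x j ^ (I j - m) * ?p I) \<in> P (Suc j)" using PS[OF jn] by auto
  have PSj: "prime_ideal_of A (P (Suc j))" using P jn by simp
  have sumP: "sum f S \<in> P (Suc j)" if "\<And>i. i \<in> S \<Longrightarrow> f i \<in> P (Suc j)" for f :: "(nat \<Rightarrow> nat) \<Rightarrow> 'a" and S
    using that PSj by (induction S rule: infinite_finite_induct) (auto simp: prime_ideal_of_def)
  have s2: "(\<Sum>I\<in>M - M'. x j ^ (I j - m) * ?p I) \<in> P (Suc j)"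
  proof (rule sumP)
    fix I assume I: "I \<in> M - M'"
    then have "I j - m = Suc (I j - m - 1)" using m_le[of I] by (auto simp: M'_def)
    then have "x j ^ (I j - m) * ?p I = (x j ^ (I j - m - 1) * ?p I) * x j"
      by (metis (no_types, lifting) mult.commute mult.left_commute power_Suc)
    moreover have "x j ^ (I j - m - 1) * ?p I \<in> A" by (rule cl(4)[OF cl(7)[OF xA[OF jn]] pA]) (use I in auto)
    then have "(x j ^ (I j - m - 1) * ?p I) * x j \<in> P (Suc j)"
      using PSj x[OF jn] unfolding prime_ideal_of_def by blast
    ultimately show "x j ^ (I j - m) * ?p I \<in> P (Suc j)" by (simp only:)
  qed
  have "(\<Sum>I\<in>M. x j ^ (I j - m) * ?p I) = (\<Sum>I\<in>M'. ?p I) + (\<Sum>I\<in>M - M'. x j ^ (I j - m) * ?p I)"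
  proof -
    have "(\<Sum>I\<in>M'. x j ^ (I j - m) * ?p I) = (\<Sum>I\<in>M'. ?p I)"
      by (rule sum.cong) (auto simp: M'_def)
    moreover have "M' \<subseteq> M" by (auto simp: M'_def)
    ultimately show ?thesis using sum.subset_diff[of M' M "\<lambda>I. x j ^ (I j - m) * ?p I"] Suc.prems(2)
      by (simp add: add.commute)
  qed
  then have "(\<Sum>I\<in>M'. ?p I) = (\<Sum>I\<in>M. x j ^ (I j - m) * ?p I) - (\<Sum>I\<in>M - M'. x j ^ (I j - m) * ?p I)"
    by simp
  then have rel': "(\<Sum>I\<in>M'. ?p I) \<in> P (Suc j)"
    using prime_ideal_of_diff[OF A PSj s1 s2] by simp
  show False
  proof (rule Suc.hyps(1)[of "Suc j" M'])
    show "d = Suc n - Suc j" using Suc.hyps(2) by simp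
    show "Suc j \<le> Suc n" using jn by simp
    show "finite M'" "M' \<noteq> {}" using Suc.prems(2) I0 by (auto simp: M'_def)
    show "c I \<in> A - P (Suc n)" if "I \<in> M'" for I using that Suc.prems(4)[of I] by (auto simp: M'_def)
    show "I = J" if "I \<in> M'" "J \<in> M'" "\<And>i. Suc j \<le> i \<Longrightarrow> i \<le> n \<Longrightarrow> I i = J i" for I J
    proof (rule Suc.prems(5))
      show "I \<in> M" "J \<in> M" using that by (auto simp: M'_def)
      show "I i = J i" if "j \<le> i" "i \<le> n" for i
        using that \<open>I \<in> M'\<close> \<open>J \<in> M'\<close> \<open>\<And>i. Suc j \<le> i \<Longrightarrow> i \<le> n \<Longrightarrow> I i = J i\<close>[of i]
        by (cases "i = j") (auto simp: M'_def)
    qed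
  qed (rule rel')
qed

section \<open>Lower bound on the dimension from faces of the cone\<close>

context toric_ring
begin

definition face_functional :: "('g \<Rightarrow> int) \<Rightarrow> bool" where
  "face_functional l \<longleftrightarrow> (\<forall>u v. l (u + v) = l u + l v) \<and> (\<forall>w\<in>cone. 0 \<le> l w)"

text \<open>The zero set of a functional that is nonnegative on the cone is a face, so the monomials
  where it is positive span a prime. A flag of faces gives a chain of primes, with monomials
  witnessing strictness also after localization.\<close>

lemma krull_dim_local_ring_ge:
  assumes l: "\<And>i. i < n \<Longrightarrow> face_functional (l i)"
    and mono: "\<And>i. Suc i < n \<Longrightarrow> {w \<in> cone. l i w > 0} \<subset> {w \<in> cone. l (Suc i) w > 0}"
    and ne: "n > 0 \<Longrightarrow> {w \<in> cone. l 0 w > 0} \<noteq> {}"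
  shows "enat n \<le> krull_dim local_ring"
proof -
  \<comment> \<open>The index is shifted by one: \<open>G 0\<close> is empty and gives the zero
    ideal, so n functionals yield n + 1 primes.\<close>
  define G where "G i = (case i of 0 \<Rightarrow> {} | Suc j \<Rightarrow> {w \<in> cone. l j w > 0})" for i
  have G0: "0 \<notin> G i" if "i \<le> n" for i
  proof (cases i)
    case (Suc j)
    then have "face_functional (l j)" using l[of j] that by simp
    then have "l j (0 + 0) = l j 0 + l j 0" unfolding face_functional_def by blast
    then show ?thesis by (simp add: G_def Suc)
  qed (simp add: G_def)
  have G_sub: "G i \<subseteq> cone" for i by (auto simp: G_def split: nat.splits)
  have prime: "prime_ideal_of kS (supported (G i))" if "i \<le> n" for i
  proof (rule prime_ideal_of_supported[OF _ G_sub G0[OF that]])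
    show "u + v \<in> G i" if "u \<in> cone" "v \<in> G i" for u v
      using that l[of "i - 1"] \<open>i \<le> n\<close> cone_add[of u v]
      by (cases i) (auto simp: G_def face_functional_def add_nonneg_pos)
    show "u + v \<in> cone - G i" if "u \<in> cone - G i" "v \<in> cone - G i" for u v
      using that l[of "i - 1"] \<open>i \<le> n\<close> cone_add[of u v]
      by (cases i) (auto simp: G_def face_functional_def not_less add_nonpos_nonpos)
  qed (use group_algebra_domain in auto)
  have mono': "G i \<subset> G (Suc i)" if "i < n" for i
    using mono[of "i - 1"] ne that by (cases i) (auto simp: G_def)
  note R = ring_closed_ev[OF ring_closed_kS] and m = prime_ideal_of_ev[OF prime_ideal_kS_max]
  let ?P = "\<lambda>i. {x / y | x y. x \<in> ev ` supported (G i) \<and> y \<in> ev ` kS - ev ` kS_max}"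
  have sub: "ev ` supported (G i) \<subseteq> ev ` kS_max" if "i \<le> n" for i
    using G_sub[of i] G0[OF that] by (intro image_mono) (auto simp: supported_def)
  have one: "1 \<in> ev ` kS - ev ` kS_max"
    using R m by (simp add: ring_closedD prime_ideal_of_def)
  show ?thesis
  proof (rule krull_dim_ge[OF ring_closed_local_ring, of n ?P])
    show "prime_ideal_of local_ring (?P i)" if "i \<le> n" for i
      unfolding local_ring_def
      by (rule prime_ideal_of_localization[OF R m prime_ideal_of_ev[OF prime[OF that]] sub[OF that]])
    show "?P i \<subset> ?P (Suc i)" if i: "i < n" for i
    proof
      show "?P i \<subseteq> ?P (Suc i)" using mono'[OF i] by (force simp: supported_def)
      obtain w where w: "w \<in> G (Suc i)" "w \<notin> G i" using mono'[OF i] by auto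
      have 1: "\<mu> w = ev (single w 1)" by (simp add: \<iota>_1)
      have "\<mu> w \<in> ev ` supported (G (Suc i))" using supported_single[OF w(1), of "1 :: 'k"] 1 by blast
      then have "\<mu> w / 1 \<in> ?P (Suc i)" using one by blast
      moreover have "\<mu> w / 1 \<notin> ?P i"
      proof
        assume "\<mu> w / 1 \<in> ?P i"
        moreover have "\<mu> w \<in> ev ` kS"
          using supported_single[of w cone "1 :: 'k"] w(1) G_sub[of "Suc i"] 1 by blast
        ultimately have "\<mu> w \<in> ev ` supported (G i)"
          using localization_numerator_mem[OF R m prime_ideal_of_ev[OF prime] sub, of i "\<mu> w" 1] i one by simp
        then have "single w (1 :: 'k) \<in> supported (G i)" unfolding 1 by (auto simp only: ev_inj)
        then show False using w(2) by (simp add: supported_def)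
      qed
      ultimately show "?P i \<noteq> ?P (Suc i)" by metis
    qed
  qed
qed

end

section \<open>Upper bound on the dimension by counting monomials\<close>

lemma (in vector_space) family_dependent:
  assumes "finite S" "finite T" "card T < card S" "v ` S \<subseteq> span T"
  shows "\<exists>c. (\<exists>i\<in>S. c i \<noteq> 0) \<and> (\<Sum>i\<in>S. scale (c i) (v i)) = 0"
proof (cases "inj_on v S")
  case True
  have "dependent (v ` S)"
  proof (rule ccontr)
    assume "\<not> dependent (v ` S)"
    from independent_span_bound[OF assms(2) this assms(4)] show False
      using assms(3) True by (simp add: card_image)
  qed
  then obtain u where u: "\<exists>x\<in>v ` S. u x \<noteq> 0" "(\<Sum>x\<in>v ` S. scale (u x) x) = 0"
    using assms(1) by (auto simp: dependent_finite)
  show ?thesis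
    by (rule exI[of _ "u \<circ> v"]) (use u True in \<open>auto simp: sum.reindex\<close>)
next
  case False
  then obtain i j where ij: "i \<in> S" "j \<in> S" "i \<noteq> j" "v i = v j" by (auto simp: inj_on_def)
  \<comment> \<open>A repeated vector gives the relation v i - v j = 0, invisible to dependence of
    the image set.\<close>
  let ?c = "\<lambda>k. if k = i then 1 else if k = j then - 1 else 0"
  have "(\<Sum>k\<in>S. scale (?c k) (v k)) = (\<Sum>k\<in>{i, j}. scale (?c k) (v k))"
    by (rule sum.mono_neutral_right) (use ij assms(1) in auto)
  also have "\<dots> = 0" using ij by simp
  finally show ?thesis by (intro exI[of _ ?c]) (use ij in auto)
qed

definition cube :: "nat \<Rightarrow> (int \<times> int \<times> int) set" where
  "cube B = {- int B..int B} \<times> {- int B..int B} \<times> {- int B..int B}"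

lemma finite_cube: "finite (cube B)"
  by (simp add: cube_def)

lemma card_cube: "card (cube B) = (2 * B + 1) ^ 3"
proof -
  have "card {- int B..int B} = 2 * B + 1" by simp
  then show ?thesis unfolding cube_def by (simp only: card_cartesian_product) (simp add: power3_eq_cube)
qed

lemma cube_add: "u \<in> cube B \<Longrightarrow> v \<in> cube C \<Longrightarrow> u + v \<in> cube (B + C)"
  by (auto simp: cube_def)

lemma cube_mono: "B \<le> C \<Longrightarrow> cube B \<subseteq> cube C"
  by (auto simp: cube_def)

lemma finite_subset_cube:
  assumes "finite T"
  shows "\<exists>B. T \<subseteq> cube B"
  using assms
proof (induction T)
  case (insert w T)
  then obtain B where B: "T \<subseteq> cube B" by blast
  obtain a b c where w: "w = (a, b, c)" by (cases w)
  have "w \<in> cube (nat \<bar>a\<bar> + nat \<bar>b\<bar> + nat \<bar>c\<bar>)" by (auto simp: w cube_def)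
  then show ?case
    using B cube_mono[of B "B + (nat \<bar>a\<bar> + nat \<bar>b\<bar> + nat \<bar>c\<bar>)"]
      cube_mono[of "nat \<bar>a\<bar> + nat \<bar>b\<bar> + nat \<bar>c\<bar>" "B + (nat \<bar>a\<bar> + nat \<bar>b\<bar> + nat \<bar>c\<bar>)"]
    by (intro exI[of _ "B + (nat \<bar>a\<bar> + nat \<bar>b\<bar> + nat \<bar>c\<bar>)"]) auto
qed simp

lemma supported_cube_mult:
  "f \<in> supported (cube B) \<Longrightarrow> g \<in> supported (cube C) \<Longrightarrow> f * g \<in> supported (cube (B + C))"
  by (erule (1) supported_mult) (rule cube_add)

lemma supported_cube_1: "1 \<in> supported (cube B)"
  by (auto simp: supported_def cube_def zero_prod_def)

lemma supported_cube_power: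
  "f \<in> supported (cube B) \<Longrightarrow> f ^ n \<in> supported (cube (n * B))" for f :: "_ \<Rightarrow>\<^sub>0 'k::comm_ring_1"
  by (induction n) (auto intro: supported_cube_mult simp: supported_cube_1)

lemma supported_cube_prod:
  fixes f :: "nat \<Rightarrow> _ \<Rightarrow>\<^sub>0 'k::comm_ring_1"
  shows "(\<And>i. i < n \<Longrightarrow> f i \<in> supported (cube B)) \<Longrightarrow> (\<Prod>i<n. f i) \<in> supported (cube (n * B))"
proof (induction n)
  case (Suc n)
  then have "(\<Prod>i<n. f i) * f n \<in> supported (cube (n * B + B))" by (intro supported_cube_mult) auto
  then show ?case by (simp add: add.commute)
qed (simp add: supported_cube_1)

locale toric_ring3 = toric_ring \<iota> \<mu> \<Lambda>
  for \<iota> :: "'k::alg_closed_field \<Rightarrow> 'l::field" and \<mu> :: "int \<times> int \<times> int \<Rightarrow> 'l" and \<Lambda>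
begin

text \<open>Brought over a common denominator, the N^4 products with exponents below N have
  numerators supported in a cube of side O(N), hence in a space of dimension O(N^3). For large N
  they are linearly dependent over k.\<close>

lemma algebraically_dependent:
  fixes x :: "nat \<Rightarrow> 'l"
  assumes "\<And>i. i < 4 \<Longrightarrow> x i \<in> local_ring"
  obtains M c where "finite M" "M \<noteq> {}" "\<And>I. I \<in> M \<Longrightarrow> c I \<noteq> (0 :: 'k)" "M \<subseteq> extensional {..<4}"
    "(\<Sum>I\<in>M. \<iota> (c I) * (\<Prod>i<4. x i ^ I i)) = 0"
proof -
  let ?s = "\<lambda>(c :: 'k) (f :: int \<times> int \<times> int \<Rightarrow>\<^sub>0 'k). single 0 c * f"
  interpret V: vector_space ?s by (rule vector_space_poly_mapping)
  have "\<exists>f g. ev g \<noteq> 0 \<and> x i = ev f / ev g" if "i < 4" for i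
    using assms[OF that] lookup_0_nonzero unfolding local_ring_iff by blast
  then obtain f g where fg: "\<And>i. i < 4 \<Longrightarrow> ev (g i) \<noteq> 0" "\<And>i. i < 4 \<Longrightarrow> x i = ev (f i) / ev (g i)"
    by metis
  have "finite (\<Union>i<4. keys (f i) \<union> keys (g i))" by simp
  then obtain B0 where "(\<Union>i<4. keys (f i) \<union> keys (g i)) \<subseteq> cube B0"
    using finite_subset_cube by blast
  \<comment> \<open>With B \<ge> 1 the side length 2 (4 N B) + 1 of the cube is at most 9 N
    B.\<close>
  moreover define B where "B = Suc B0"
  ultimately have B: "f i \<in> supported (cube B)" "g i \<in> supported (cube B)" if "i < 4" for i
    using cube_mono[of B0 B] that unfolding supported_def by fastforce+
  \<comment> \<open>729 is 9^3: the cube has at most (9 N B)^3 points, fewer than N^4 as soon as N >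
    729 B^3.\<close>
  define N where "N = 729 * B ^ 3 + 1"
  define S where "S = (\<Pi>\<^sub>E i\<in>{..<4::nat}. {..<N})"
  \<comment> \<open>Padding with powers of \<open>g i\<close> brings all products over the same
    denominator, the product of the \<open>g i ^ N\<close>.\<close>
  define v where "v I = (\<Prod>i<4. f i ^ I i * g i ^ (N - I i))" for I
  define T where "T = (\<lambda>w. single w (1 :: 'k)) ` cube (4 * (N * B))"
  have v: "v I \<in> supported (cube (4 * (N * B)))" if "I \<in> S" for I
    unfolding v_def
  proof (rule supported_cube_prod)
    fix i :: nat assume i: "i < 4"
    then have "I i < N" using that by (auto simp: S_def)
    then have "I i * B + (N - I i) * B = N * B" by (simp flip: add_mult_distrib)
    then show "f i ^ I i * g i ^ (N - I i) \<in> supported (cube (N * B))"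
      using supported_cube_mult[OF supported_cube_power supported_cube_power, of "f i" B "g i" B "I i" "N - I i"] B[OF i]
      by simp
  qed
  have span: "h \<in> V.span T" if "h \<in> supported (cube (4 * (N * B)))" for h
  proof -
    have "h = (\<Sum>w\<in>cube (4 * (N * B)). ?s (lookup h w) (single w 1))"
      using poly_mapping_sum_single[OF finite_cube, of h "4 * (N * B)"] that by (simp add: supported_def mult_single)
    also have "\<dots> \<in> V.span T"
      by (intro V.span_sum V.span_scale V.span_base) (auto simp: T_def)
    finally show ?thesis .
  qed
  have S: "finite S" "card S = N ^ 4" unfolding S_def by (auto intro: finite_PiE simp: card_PiE)
  have "card T \<le> (2 * (4 * (N * B)) + 1) ^ 3"
    unfolding T_def using card_image_le[OF finite_cube] card_cube by metis
  also have "\<dots> \<le> (9 * (N * B)) ^ 3"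
    by (rule power_mono) (simp_all add: N_def B_def)
  also have "\<dots> = 729 * B ^ 3 * N ^ 3" by (simp add: power_mult_distrib)
  also have "\<dots> < N * N ^ 3" by (simp add: N_def)
  also have "\<dots> = card S" by (simp add: S eval_nat_numeral)
  finally obtain c where c: "\<exists>I\<in>S. c I \<noteq> 0" "(\<Sum>I\<in>S. ?s (c I) (v I)) = 0"
    using V.family_dependent[of S T v] S finite_cube v span by (auto simp: T_def image_subset_iff)
  have "0 = ev (\<Sum>I\<in>S. ?s (c I) (v I))" using c by simp
  also have "\<dots> = (\<Sum>I\<in>S. \<iota> (c I) * ((\<Prod>i<4. x i ^ I i) * (\<Prod>i<4. ev (g i) ^ N)))"
    unfolding ev_sum
  proof (rule sum.cong[OF refl])
    fix I assume I: "I \<in> S"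
    have "ev (\<Prod>i\<in>J. f i ^ I i * g i ^ (N - I i)) = (\<Prod>i\<in>J. x i ^ I i * ev (g i) ^ N)" if "J \<subseteq> {..<4}" for J
      using finite_subset[OF that finite_lessThan] that
    proof (induction J)
      case (insert i J)
      have "ev (g i) ^ N = ev (g i) ^ I i * ev (g i) ^ (N - I i)"
      proof -
        have "I i < N" using I insert.prems by (auto simp: S_def PiE_iff)
        then show ?thesis by (simp flip: power_add)
      qed
      then have "ev (f i ^ I i * g i ^ (N - I i)) = x i ^ I i * ev (g i) ^ N"
        using fg[of i] insert by (simp add: power_divide)
      then show ?case using insert by simp
    qed simp
    from this[of "{..<4}"] show "ev (?s (c I) (v I)) = \<iota> (c I) * ((\<Prod>i<4. x i ^ I i) * (\<Prod>i<4. ev (g i) ^ N))"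
      by (simp add: v_def \<mu>_0 prod.distrib)
  qed
  also have "\<dots> = (\<Sum>I\<in>S. \<iota> (c I) * (\<Prod>i<4. x i ^ I i)) * (\<Prod>i<4. ev (g i) ^ N)"
    by (simp add: sum_distrib_right mult.assoc)
  finally have "(\<Sum>I\<in>S. \<iota> (c I) * (\<Prod>i<4. x i ^ I i)) = 0"
    using fg(1) by auto
  also have "(\<Sum>I\<in>S. \<iota> (c I) * (\<Prod>i<4. x i ^ I i)) = (\<Sum>I\<in>{I \<in> S. c I \<noteq> 0}. \<iota> (c I) * (\<Prod>i<4. x i ^ I i))"
    by (rule sum.mono_neutral_right) (use S in \<open>auto simp: \<iota>_0\<close>)
  finally have rel: "(\<Sum>I\<in>{I \<in> S. c I \<noteq> 0}. \<iota> (c I) * (\<Prod>i<4. x i ^ I i)) = 0" .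
  show ?thesis
  proof (rule that[of "{I \<in> S. c I \<noteq> 0}" c])
    show "{I \<in> S. c I \<noteq> 0} \<subseteq> extensional {..<4}" by (auto simp: S_def PiE_def)
    show "finite {I \<in> S. c I \<noteq> 0}" using S by simp
    show "{I \<in> S. c I \<noteq> 0} \<noteq> {}" using c by auto
    show "(\<Sum>I\<in>{I \<in> S. c I \<noteq> 0}. \<iota> (c I) * (\<Prod>i<4. x i ^ I i)) = 0" by (rule rel)
  qed simp
qed

text \<open>A chain of five primes provides four elements, and these satisfy a relation with nonzero
  coefficients in k. Such coefficients are units, so they avoid every prime and
  \<open>prime_chain_no_relation\<close> applies.\<close>

lemma krull_dim_local_ring_le: "krull_dim local_ring \<le> enat 3"
proof (rule krull_dim_le[OF ring_closed_local_ring])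
  fix P assume P: "\<And>i. i \<le> Suc 3 \<Longrightarrow> prime_ideal_of local_ring (P i)" "\<And>i. i \<le> 3 \<Longrightarrow> P i \<subset> P (Suc i)"
  have "\<exists>y. y \<in> P (Suc i) - P i" if "i \<le> 3" for i using P(2)[OF that] by auto
  then obtain x where x: "\<And>i. i \<le> 3 \<Longrightarrow> x i \<in> P (Suc i) - P i" by metis
  have "x i \<in> local_ring" if "i < 4" for i
    using x[of i] P(1)[of "Suc i"] that unfolding prime_ideal_of_def by auto
  then obtain M c where M: "finite M" "M \<noteq> {}" "\<And>I. I \<in> M \<Longrightarrow> c I \<noteq> (0 :: 'k)" "M \<subseteq> extensional {..<4}"
    "(\<Sum>I\<in>M. \<iota> (c I) * (\<Prod>i<4. x i ^ I i)) = 0" using algebraically_dependent by blast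
  have const: "\<iota> a \<in> local_ring" for a
    using ev_in_local_ring[OF supported_single[OF cone_0, of a]] by (simp add: \<mu>_0)
  have unit: "\<iota> a \<in> local_ring - P (Suc 3)" if "a \<noteq> 0" for a
  proof -
    have "\<iota> (inverse a) * \<iota> a = 1" using that by (simp add: \<iota>_1 flip: \<iota>_mult)
    then show ?thesis using const[of a] const[of "inverse a"] P(1)[of "Suc 3"] unfolding prime_ideal_of_def by force
  qed
  have lt4: "{0..3::nat} = {..<4}" by auto
  show False
  proof (rule prime_chain_no_relation[OF ring_closed_local_ring, of 3 P x 0 M "\<lambda>I. \<iota> (c I)"])
    show "I = J" if "I \<in> M" "J \<in> M" "\<And>i. 0 \<le> i \<Longrightarrow> i \<le> 3 \<Longrightarrow> I i = J i" for I J
      by (rule extensionalityI[of _ "{..<4}"]) (use that M(4) in auto)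
    show "(\<Sum>I\<in>M. \<iota> (c I) * (\<Prod>i = 0..3. x i ^ I i)) \<in> P 0"
      using M(5) P(1)[of 0] unfolding lt4 by (simp add: prime_ideal_of_def)
    show "P i \<subseteq> P (Suc i)" if "i \<le> 3" for i using P(2)[OF that] by auto
  qed (use P x M unit in auto)
qed

theorem has_F_signature_local_ring:
  assumes "krull_dim local_ring = enat 3"
    and "(\<lambda>e. real (card (box (CHAR('k) ^ e))) / real (CHAR('k) ^ e) ^ 3) \<longlonglongrightarrow> s"
  shows "has_F_signature local_ring s"
proof -
  have "free_rank local_ring (\<lambda>r x. to_ac r * x) (roots_ring local_ring (CHAR('l) ^ e))
      = card (box (CHAR('k) ^ e))" for e
  proof -
    interpret toric_ring_root \<iota> \<mu> \<Lambda> "CHAR('k) ^ e" e by standard simp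
    show ?thesis using free_rank_root_ring by (simp add: CHAR_target)
  qed
  then show ?thesis
    using assms unfolding has_F_signature_def by (simp add: CHAR_target power_mult)
qed

end

section \<open>Counting lattice points\<close>

text \<open>The volume is computed by two iterated Riemann sums. All integrands are combinations of
  truncated powers with knots 0, 1, 2, so their antiderivatives are explicit.\<close>

definition tent :: "real \<Rightarrow> real" where
  "tent x = max 0 x - 2 * max 0 (x - 1) + max 0 (x - 2)"

text \<open>\<open>tent\<close> is the indicator function of the unit interval convolved with
  itself, a triangle on [0, 2]. This function and \<open>tent_int2\<close> are its successive
  antiderivatives vanishing on the negative axis; the weights 1, -2, 1 are those of a second
  difference.\<close>

definition tent_int :: "real \<Rightarrow> real" where
  "tent_int x = ((max 0 x)\<^sup>2 - 2 * (max 0 (x - 1))\<^sup>2 + (max 0 (x - 2))\<^sup>2) / 2"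

definition tent_int2 :: "real \<Rightarrow> real" where
  "tent_int2 x = ((max 0 x) ^ 3 - 2 * (max 0 (x - 1)) ^ 3 + (max 0 (x - 2)) ^ 3) / 6"

section \<open>Increment estimates for truncated powers\<close>

lemma max_square_increment:
  fixes x h :: real
  assumes "h \<ge> 0"
  shows "\<bar>(max 0 (x + h))\<^sup>2 - (max 0 x)\<^sup>2 - 2 * h * max 0 x\<bar> \<le> h\<^sup>2"
proof -
  consider "x \<ge> 0" | "x < 0" "x + h \<le> 0" | "x < 0" "x + h > 0" by linarith
  then show ?thesis
  proof cases
    case 3
    then have "(x + h)\<^sup>2 \<le> h\<^sup>2" by (intro power_mono) auto
    then show ?thesis using 3 by simp
  qed (use assms in \<open>auto simp: max_def power2_eq_square algebra_simps\<close>)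
qed

lemma max_cube_increment:
  fixes x h :: real
  assumes "h \<ge> 0"
  shows "\<bar>(max 0 (x + h)) ^ 3 - (max 0 x) ^ 3 - 3 * h * (max 0 x)\<^sup>2\<bar> \<le> 3 * h\<^sup>2 * (\<bar>x\<bar> + h)"
proof -
  consider "x \<ge> 0" | "x < 0" "x + h \<le> 0" | "x < 0" "x + h > 0" by linarith
  then show ?thesis
  proof cases
    case 1
    have "h ^ 3 \<ge> 0" "3 * x * h\<^sup>2 \<ge> 0" using assms 1 by auto
    then show ?thesis
      using 1 assms by (simp add: max_def power2_eq_square power3_eq_cube algebra_simps)
  next
    case 2
    have "3 * h\<^sup>2 * (\<bar>x\<bar> + h) \<ge> 0" using assms by auto
    then show ?thesis using 2 by simp
  next
    case 3
    have "(x + h) ^ 3 \<le> h ^ 3" using 3 by (intro power_mono) auto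
    also have "\<dots> = h\<^sup>2 * h" by (simp add: power2_eq_square power3_eq_cube)
    also have "\<dots> \<le> 3 * h\<^sup>2 * (\<bar>x\<bar> + h)"
      using assms by (auto intro!: mult_mono)
    finally show ?thesis using 3 by simp
  qed
qed

text \<open>The constant 4 is the total weight 1 + 2 + 1 of a second difference.\<close>

lemma abs_second_difference_le:
  fixes A B C D E m :: real
  assumes "m * D = A - 2 * B + C" "m > 0" "\<bar>A\<bar> \<le> E" "\<bar>B\<bar> \<le> E" "\<bar>C\<bar> \<le> E"
  shows "\<bar>D\<bar> \<le> 4 * E / m"
proof -
  have "\<bar>m * D\<bar> \<le> 4 * E" using assms by linarith
  then show ?thesis using assms(2) by (simp add: abs_mult field_simps)
qed

lemma tent_int_increment:
  assumes "h \<ge> 0"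
  shows "\<bar>tent_int (x + h) - tent_int x - h * tent x\<bar> \<le> 2 * h\<^sup>2"
proof -
  let ?D = "\<lambda>x. (max 0 (x + h))\<^sup>2 - (max 0 x)\<^sup>2 - 2 * h * max 0 x"
  have "x - 1 + h = x + h - 1" "x - 2 + h = x + h - 2" by simp_all
  then have "2 * (tent_int (x + h) - tent_int x - h * tent x) = ?D x - 2 * ?D (x - 1) + ?D (x - 2)"
    unfolding tent_int_def tent_def by (simp only:) (simp add: field_simps)
  from abs_second_difference_le[OF this _ max_square_increment[OF assms] max_square_increment[OF assms]
      max_square_increment[OF assms]]
  show ?thesis by simp
qed

lemma tent_int2_increment:
  assumes "h \<ge> 0"
  shows "\<bar>tent_int2 (x + h) - tent_int2 x - h * tent_int x\<bar> \<le> 2 * h\<^sup>2 * (\<bar>x\<bar> + 2 + h)"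
proof -
  let ?D = "\<lambda>x. (max 0 (x + h)) ^ 3 - (max 0 x) ^ 3 - 3 * h * (max 0 x)\<^sup>2"
  \<comment> \<open>Stated for free variables, so that the squares and cubes stay atoms and the
    algebra is linear in them.\<close>
  have comb0: "6 * (u / 6 - v / 6 - h * (w / 2)) = u - v - 3 * h * w" for u v w :: real
    by (simp add: algebra_simps)
  have comb: "6 * ((P0 - 2 * P1 + P2) / 6 - (Q0 - 2 * Q1 + Q2) / 6 - h * ((R0 - 2 * R1 + R2) / 2))
      = P0 - Q0 - 3 * h * R0 - 2 * (P1 - Q1 - 3 * h * R1) + (P2 - Q2 - 3 * h * R2)"
    for P0 P1 P2 Q0 Q1 Q2 R0 R1 R2 :: real
    unfolding comb0 by (simp add: algebra_simps)
  have "x - 1 + h = x + h - 1" "x - 2 + h = x + h - 2" by simp_all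
  then have eq: "6 * (tent_int2 (x + h) - tent_int2 x - h * tent_int x) = ?D x - 2 * ?D (x - 1) + ?D (x - 2)"
    unfolding tent_int2_def tent_int_def by (simp only: comb)
  have "\<bar>?D y\<bar> \<le> 3 * h\<^sup>2 * (\<bar>x\<bar> + 2 + h)" if "\<bar>y\<bar> \<le> \<bar>x\<bar> + 2" for y
  proof -
    have "\<bar>?D y\<bar> \<le> 3 * h\<^sup>2 * (\<bar>y\<bar> + h)" using max_cube_increment[OF assms] .
    also have "\<dots> \<le> 3 * h\<^sup>2 * (\<bar>x\<bar> + 2 + h)" by (rule mult_left_mono) (use that in auto)
    finally show ?thesis .
  qed
  from this[of x] this[of "x - 1"] this[of "x - 2"]
  have "\<bar>?D x\<bar> \<le> 3 * h\<^sup>2 * (\<bar>x\<bar> + 2 + h)" "\<bar>?D (x - 1)\<bar> \<le> 3 * h\<^sup>2 * (\<bar>x\<bar> + 2 + h)"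
    "\<bar>?D (x - 2)\<bar> \<le> 3 * h\<^sup>2 * (\<bar>x\<bar> + 2 + h)" by auto
  from abs_second_difference_le[OF eq _ this] show ?thesis by simp
qed

lemma tent_bounds: "0 \<le> tent x" "tent x \<le> 1"
  by (auto simp: tent_def max_def)

lemma tent_int_shift:
  assumes "h \<ge> 0"
  shows "\<bar>tent_int (x + h) - tent_int x\<bar> \<le> h + 2 * h\<^sup>2"
proof -
  have "0 \<le> h * tent x" "h * tent x \<le> h"
    using assms tent_bounds[of x] by (auto intro: mult_left_le)
  then show ?thesis using tent_int_increment[OF assms, of x] by linarith
qed

text \<open>The argument will be c / d, so these three branches become the three cases of the
  theorem.\<close>

lemma tent_int2_small: "0 \<le> x \<Longrightarrow> x \<le> 1 \<Longrightarrow> tent_int2 x = x ^ 3 / 6"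
  and tent_int2_middle: "1 \<le> x \<Longrightarrow> x \<le> 2 \<Longrightarrow> tent_int2 x = x - 1 + (2 - x) ^ 3 / 6"
  and tent_int2_large: "2 \<le> x \<Longrightarrow> tent_int2 x = x - 1"
  by (simp_all add: tent_int2_def max_def power3_eq_cube field_simps)

text \<open>A Riemann sum along an arithmetic progression: the increments of the antiderivative F
  telescope, and the N local errors add up.\<close>

lemma progression_sum:
  fixes F f :: "real \<Rightarrow> real"
  assumes "\<And>j. j < N \<Longrightarrow> \<bar>F (x + h * real (Suc j)) - F (x + h * real j) - h * f (x + h * real j)\<bar> \<le> E"
  shows "\<bar>h * (\<Sum>j<N. f (x + h * real j)) - (F (x + h * real N) - F x)\<bar> \<le> real N * E"
  using assms
proof (induction N)
  case (Suc N)
  have "\<bar>h * (\<Sum>j<N. f (x + h * real j)) - (F (x + h * real N) - F x)\<bar> \<le> real N * E"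
    by (rule Suc.IH) (use Suc.prems in auto)
  moreover have "\<bar>F (x + h * real (Suc N)) - F (x + h * real N) - h * f (x + h * real N)\<bar> \<le> E"
    by (rule Suc.prems) simp
  ultimately have "\<bar>h * (\<Sum>j<N. f (x + h * real j)) - (F (x + h * real N) - F x)
      - (F (x + h * real (Suc N)) - F (x + h * real N) - h * f (x + h * real N))\<bar> \<le> real N * E + E"
    by linarith
  then show ?case by (simp add: algebra_simps)
qed simp


text \<open>The set lists the ways to write s as an ordered sum of two integers in [0, q), the
  discrete form of convolving an interval with itself. Rounding at the ends costs at most 1.\<close>

lemma card_overlap:
  fixes q s :: int
  assumes "q > 0" "s \<ge> 0"
  shows "\<bar>real (card {u. 0 \<le> u \<and> u < q \<and> 0 \<le> s - u \<and> s - u < q}) - real_of_int q * tent (real_of_int s / real_of_int q)\<bar> \<le> 1"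
proof -
  have "{u. 0 \<le> u \<and> u < q \<and> 0 \<le> s - u \<and> s - u < q} = {max 0 (s - q + 1)..min (q - 1) s}" by auto
  then have c: "card {u. 0 \<le> u \<and> u < q \<and> 0 \<le> s - u \<and> s - u < q} = nat (min (q - 1) s - max 0 (s - q + 1) + 1)"
    by simp
  have q: "real_of_int q > 0" using assms by simp
  have m: "real_of_int q * max 0 x = max 0 (real_of_int q * x)" for x
    using q by (auto simp: max_def zero_le_mult_iff mult_le_0_iff not_le)
  have "real_of_int q * tent (real_of_int s / real_of_int q)
      = real_of_int q * max 0 (real_of_int s / real_of_int q) - 2 * (real_of_int q * max 0 (real_of_int s / real_of_int q - 1))
        + real_of_int q * max 0 (real_of_int s / real_of_int q - 2)"
    by (simp add: tent_def algebra_simps)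
  also have "\<dots> = real_of_int (max 0 s - 2 * max 0 (s - q) + max 0 (s - 2 * q))"
    unfolding m using q by (simp add: right_diff_distrib of_int_max)
  finally have t: "real_of_int q * tent (real_of_int s / real_of_int q)
      = real_of_int (max 0 s - 2 * max 0 (s - q) + max 0 (s - 2 * q))" .
  let ?c = "max 0 (min (q - 1) s - max 0 (s - q + 1) + 1)"
  let ?t = "max 0 s - 2 * max 0 (s - q) + max 0 (s - 2 * q)"
  consider "s < q" | "q \<le> s" "s < 2 * q" | "2 * q \<le> s" by linarith
  then have "\<bar>?c - ?t\<bar> \<le> 1"
  proof cases
    case 1
    then have "min (q - 1) s = s" "max 0 (s - q + 1) = 0" "max 0 (s - q) = 0" "max 0 (s - 2 * q) = 0" "max 0 s = s"
      using assms by auto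
    then show ?thesis using assms by simp
  next
    case 2
    then have "min (q - 1) s = q - 1" "max 0 (s - q + 1) = s - q + 1" "max 0 (s - q) = s - q" "max 0 (s - 2 * q) = 0" "max 0 s = s"
      using assms by auto
    then show ?thesis using 2 by simp
  next
    case 3
    then have "min (q - 1) s = q - 1" "max 0 (s - q + 1) = s - q + 1" "max 0 (s - q) = s - q" "max 0 (s - 2 * q) = s - 2 * q" "max 0 s = s"
      using assms by auto
    then show ?thesis using 3 by simp
  qed
  then have "\<bar>real_of_int (?c - ?t)\<bar> \<le> 1" by (metis of_int_1_le_iff of_int_abs of_int_le_1_iff)
  moreover have "real (nat (min (q - 1) s - max 0 (s - q + 1) + 1)) = real_of_int ?c"
    by (cases "min (q - 1) s - max 0 (s - q + 1) + 1 \<ge> 0") (simp_all only: max.absorb1 max.absorb2 of_nat_nat nat_le_0 linorder_not_le less_imp_le of_nat_0 of_int_0)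
  ultimately show ?thesis unfolding c t by (simp only: of_int_diff)
qed

section \<open>Lattice points of the box, slice by slice\<close>

definition section_box :: "int \<Rightarrow> int \<Rightarrow> int \<Rightarrow> int \<Rightarrow> (int \<times> int \<times> int) set" where
  "section_box a c d q = {(m, y, n). 0 \<le> m + n * c \<and> m + n * c < q \<and> 0 \<le> y \<and> y < q \<and>
     0 \<le> a * y - m \<and> a * y - m < q \<and> 0 \<le> n * d - y \<and> n * d - y < q}"

text \<open>Replacing m by u = a y - m turns the conditions of the rays D_1 and D_3 into the
  statement that u and (a y + c n) - u both lie in [0, q). The ray D_4 fixes the range of y for
  given n.\<close>

lemma card_section_box:
  fixes a c d q :: int
  assumes "a \<ge> 2" "c \<ge> 1" "d \<ge> 1" "q \<ge> 1"
  shows "finite (section_box a c d q)"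
    "card (section_box a c d q) = (\<Sum>n\<in>{0..<2 * q}. \<Sum>y\<in>{max 0 (n * d - q + 1)..n * d}.
       card {u. 0 \<le> u \<and> u < q \<and> 0 \<le> (a * y + c * n) - u \<and> (a * y + c * n) - u < q})"
proof -
  let ?U = "\<lambda>n y. {u. 0 \<le> u \<and> u < q \<and> 0 \<le> (a * y + c * n) - u \<and> (a * y + c * n) - u < q}"
  let ?S = "SIGMA n:{0..<2 * q}. SIGMA y:{max 0 (n * d - q + 1)..n * d}. ?U n y"
  have fin: "finite (?U n y)" for n y by (rule finite_subset[of _ "{0..q}"]) auto
  have bij: "bij_betw (\<lambda>(n, y, u). (a * y - u, y, n)) ?S (section_box a c d q)"
  proof (rule bij_betw_byWitness[where f' = "\<lambda>(m, y, n). (n, y, a * y - m)"])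
    show "(\<lambda>(n, y, u). (a * y - u, y, n)) ` ?S \<subseteq> section_box a c d q"
    proof clarify
      fix n y u assume *: "n \<in> {0..<2 * q}" "y \<in> {max 0 (n * d - q + 1)..n * d}"
        "0 \<le> u" "u < q" "0 \<le> a * y + c * n - u" "a * y + c * n - u < q"
      \<comment> \<open>Here a \<ge> 2 enters: 2 y \<le> a y + c n < 2 q yields y < q, which the
        ranges of summation do not impose.\<close>
      have "2 * y \<le> a * y" using assms * by (intro mult_right_mono) auto
      moreover have "0 \<le> c * n" using assms * by auto
      ultimately have "y < q" using * by linarith
      then show "(a * y - u, y, n) \<in> section_box a c d q" using * by (auto simp: section_box_def algebra_simps)
    qed
    show "(\<lambda>(m, y, n). (n, y, a * y - m)) ` section_box a c d q \<subseteq> ?S"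
    proof clarify
      fix m y n assume *: "(m, y, n) \<in> section_box a c d q"
      \<comment> \<open>n d is the sum of y and n d - y, both in [0, q).\<close>
      then have "n * d \<ge> 0" "n * d < 2 * q" by (auto simp: section_box_def)
      moreover have "n \<ge> 0"
      proof (rule ccontr)
        assume "\<not> n \<ge> 0"
        then have "n * d < 0" using assms by (intro mult_neg_pos) auto
        then show False using \<open>n * d \<ge> 0\<close> by simp
      qed
      moreover have "n * 1 \<le> n * d" using assms \<open>n \<ge> 0\<close> by (intro mult_left_mono) auto
      ultimately have "n \<in> {0..<2 * q}" by auto
      then show "n \<in> {0..<2 * q} \<and> (y, a * y - m) \<in> (SIGMA y:{max 0 (n * d - q + 1)..n * d}. ?U n y)"
        using * by (auto simp: section_box_def algebra_simps)
    qed
  qed auto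
  have finS: "finite ?S" by (intro finite_SigmaI fin) auto
  then show "finite (section_box a c d q)" using bij_betw_finite[OF bij] by simp
  have "card (section_box a c d q) = card ?S" by (rule bij_betw_same_card[OF bij, symmetric])
  also have "\<dots> = (\<Sum>n\<in>{0..<2 * q}. \<Sum>y\<in>{max 0 (n * d - q + 1)..n * d}. card (?U n y))"
  proof (subst card_SigmaI)
    show "\<forall>n\<in>{0..<2 * q}. finite (SIGMA y:{max 0 (n * d - q + 1)..n * d}. ?U n y)"
      by (intro ballI finite_SigmaI fin) simp
    show "(\<Sum>n\<in>{0..<2 * q}. card (SIGMA y:{max 0 (n * d - q + 1)..n * d}. ?U n y))
        = (\<Sum>n\<in>{0..<2 * q}. \<Sum>y\<in>{max 0 (n * d - q + 1)..n * d}. card (?U n y))"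
      by (intro sum.cong refl card_SigmaI ballI fin) simp
  qed simp
  finally show "card (section_box a c d q) = (\<Sum>n\<in>{0..<2 * q}. \<Sum>y\<in>{max 0 (n * d - q + 1)..n * d}. card (?U n y))" .
qed

text \<open>In the variable (a y + c n) / q the sum over y is a Riemann sum of \<open>tent\<close>
  with step a / q. A slice is therefore q^2 / a times an increment of \<open>tent_int\<close>, up to
  O(q); the upper end y = n d gives (a d + c) n / q.\<close>

lemma section_box_slice:
  fixes a c d n :: int and q :: nat and Q :: real
  assumes "a \<ge> 2" "c \<ge> 1" "d \<ge> 1" "q \<ge> 1" "n \<ge> 0"
  defines "Q \<equiv> real q"
  shows "\<bar>(\<Sum>y\<in>{max 0 (n * d - int q + 1)..n * d}.
       real (card {u. 0 \<le> u \<and> u < int q \<and> 0 \<le> (a * y + c * n) - u \<and> (a * y + c * n) - u < int q}))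
     - Q\<^sup>2 / a * (tent_int ((a * d + c) * n / Q) - tent_int ((a * max 0 (n * d - int q) + c * n) / Q))\<bar>
     \<le> Q * (6 * a + 3)"
proof -
  define \<alpha> where "\<alpha> = max 0 (n * d - int q + 1)"
  define N where "N = nat (n * d - \<alpha> + 1)"
  define k where "k y = card {u. 0 \<le> u \<and> u < int q \<and> 0 \<le> (a * y + c * n) - u \<and> (a * y + c * n) - u < int q}" for y
  define h where "h = a / Q"
  define x0 where "x0 = (a * \<alpha> + c * n) / Q"
  define x1 where "x1 = (a * max 0 (n * d - int q) + c * n) / Q"
  have Q: "Q \<ge> 1" using assms by (simp add: Q_def)
  have a0: "real_of_int a > 0" using assms by simp
  have h: "h \<ge> 0" "h > 0" "h \<le> a" "Q * h = a"
    using Q a0 by (simp_all add: h_def divide_le_eq mult_left_le)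
  have nd: "n * d \<ge> 0" using assms by simp
  have \<alpha>: "0 \<le> \<alpha>" "\<alpha> \<le> n * d" using nd assms by (auto simp: \<alpha>_def)
  have N': "int N = n * d - \<alpha> + 1" using \<alpha> by (simp add: N_def)
  then have "int N \<le> int q" by (simp add: \<alpha>_def)
  then have N: "real N \<le> Q" by (simp add: Q_def)
  have sum_eq: "(\<Sum>y\<in>{\<alpha>..n * d}. f y) = (\<Sum>j<N. f (\<alpha> + int j))" for f :: "int \<Rightarrow> real"
    by (rule sum.reindex_bij_witness[of _ "\<lambda>j. \<alpha> + int j" "\<lambda>y. nat (y - \<alpha>)"]) (use N' in auto)
  have x0h: "x0 + h * real N = (a * d + c) * n / Q + h"
  proof -
    have e: "real N = real_of_int (n * d - \<alpha> + 1)" by (metis N' of_int_of_nat_eq)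
    show ?thesis unfolding x0_def h_def e using Q by (simp add: field_simps)
  qed
  have arg: "x0 + h * real j = real_of_int (a * (\<alpha> + int j) + c * n) / real_of_int (int q)" for j
    using Q by (simp add: x0_def h_def Q_def field_simps)
  have step1: "\<bar>(\<Sum>y\<in>{\<alpha>..n * d}. real (k y)) - Q * (\<Sum>j<N. tent (x0 + h * real j))\<bar> \<le> Q"
  proof -
    have "\<bar>real (k (\<alpha> + int j)) - Q * tent (x0 + h * real j)\<bar> \<le> 1" for j
      using card_overlap[of "int q" "a * (\<alpha> + int j) + c * n"] assms \<alpha>
      unfolding k_def arg by (simp add: Q_def)
    then have "\<bar>\<Sum>j<N. real (k (\<alpha> + int j)) - Q * tent (x0 + h * real j)\<bar> \<le> (\<Sum>j<N. 1)"
      by (intro order.trans[OF sum_abs] sum_mono)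
    then show ?thesis using N by (simp add: sum_eq sum_subtractf sum_distrib_left)
  qed
  have step2: "\<bar>h * (\<Sum>j<N. tent (x0 + h * real j)) - (tent_int (x0 + h * real N) - tent_int x0)\<bar> \<le> real N * (2 * h\<^sup>2)"
  proof (rule progression_sum)
    fix j
    show "\<bar>tent_int (x0 + h * real (Suc j)) - tent_int (x0 + h * real j) - h * tent (x0 + h * real j)\<bar> \<le> 2 * h\<^sup>2"
      using tent_int_increment[OF h(1), of "x0 + h * real j"] by (simp add: algebra_simps)
  qed
  \<comment> \<open>The last summand has y = n d, so the progression ends one step beyond the wanted
    endpoint.\<close>
  have step3: "\<bar>tent_int (x0 + h * real N) - tent_int ((a * d + c) * n / Q)\<bar> \<le> h + 2 * h\<^sup>2"
    unfolding x0h using tent_int_shift[OF h(1)] .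
  \<comment> \<open>If n d - q + 1 is positive, it is the first y, one step after n d - q; otherwise
    both starting points are 0.\<close>
  have step4: "\<bar>tent_int x0 - tent_int x1\<bar> \<le> h + 2 * h\<^sup>2"
  proof (cases "n * d - int q + 1 \<le> 0")
    case True
    then have "x0 = x1" by (simp add: x0_def x1_def \<alpha>_def)
    then show ?thesis using h by simp
  next
    case False
    then have "\<alpha> = max 0 (n * d - int q) + 1" by (simp add: \<alpha>_def)
    then have "x0 = x1 + h" using Q by (simp add: x0_def x1_def h_def field_simps)
    then show ?thesis using tent_int_shift[OF h(1)] by simp
  qed
  have "real N * (2 * h\<^sup>2) \<le> Q * (2 * h\<^sup>2)" using N by (intro mult_right_mono) auto
  also have "\<dots> = 2 * a * h" using h(4) by (simp add: power2_eq_square)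
  finally have "real N * (2 * h\<^sup>2) \<le> 2 * a * h" .
  moreover have "h\<^sup>2 \<le> a * h" using h by (simp add: power2_eq_square mult_right_mono)
  ultimately have "\<bar>h * (\<Sum>j<N. tent (x0 + h * real j)) - (tent_int ((a * d + c) * n / Q) - tent_int x1)\<bar>
      \<le> 6 * a * h + 2 * h"
    using step2 step3 step4 by linarith
  \<comment> \<open>The factor Q / h = Q^2 / a converts the normalized sum back into a
    count.\<close>
  then have "(Q / h) * \<bar>h * (\<Sum>j<N. tent (x0 + h * real j)) - (tent_int ((a * d + c) * n / Q) - tent_int x1)\<bar>
      \<le> (Q / h) * (6 * a * h + 2 * h)"
    using Q h by (intro mult_left_mono) auto
  also have "\<dots> = Q * (6 * a + 2)" using h(2) by (simp add: field_simps)
  also have "(Q / h) * \<bar>h * (\<Sum>j<N. tent (x0 + h * real j)) - (tent_int ((a * d + c) * n / Q) - tent_int x1)\<bar>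
      = \<bar>(Q / h) * (h * (\<Sum>j<N. tent (x0 + h * real j)) - (tent_int ((a * d + c) * n / Q) - tent_int x1))\<bar>"
    using Q h by (simp add: abs_mult)
  also have "(Q / h) * (h * (\<Sum>j<N. tent (x0 + h * real j)) - (tent_int ((a * d + c) * n / Q) - tent_int x1))
      = Q * (\<Sum>j<N. tent (x0 + h * real j)) - (Q / h) * (tent_int ((a * d + c) * n / Q) - tent_int x1)"
    using h(2) by (simp add: right_diff_distrib)
  also have "Q / h = Q\<^sup>2 / a" using Q by (simp add: h_def power2_eq_square)
  finally have "\<bar>Q * (\<Sum>j<N. tent (x0 + h * real j)) - Q\<^sup>2 / a * (tent_int ((a * d + c) * n / Q) - tent_int x1)\<bar>
      \<le> Q * (6 * a + 2)" .
  moreover have "Q * (6 * a + 3) = Q * (6 * a + 2) + Q" by (simp add: algebra_simps)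
  ultimately have "\<bar>(\<Sum>y\<in>{\<alpha>..n * d}. real (k y)) - Q\<^sup>2 / a * (tent_int ((a * d + c) * n / Q) - tent_int x1)\<bar>
      \<le> Q * (6 * a + 3)" using step1 by linarith
  then show ?thesis unfolding k_def \<alpha>_def x1_def .
qed

text \<open>The starting point may vary with q because one of the sums below begins at a rounded
  quotient, which only converges.\<close>

lemma tent_int_riemann_limit:
  fixes K x \<nu> :: real and N :: "nat \<Rightarrow> nat" and y :: "nat \<Rightarrow> real"
  assumes K: "K > 0" and N: "\<And>q. N q \<le> 2 * q" and lim_N: "(\<lambda>q. real (N q) / real q) \<longlonglongrightarrow> \<nu>"
    and y: "y \<longlonglongrightarrow> x"
  shows "(\<lambda>q. (\<Sum>j<N q. tent_int (y q + K * real j / real q)) / real q)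
    \<longlonglongrightarrow> (tent_int2 (x + K * \<nu>) - tent_int2 x) / K"
proof -
  \<comment> \<open>Convergent starting points are bounded; with N q \<le> 2 q all arguments stay
    bounded, and each step has error O(1 / q^2).\<close>
  obtain Y where Y: "\<And>q. \<bar>y q\<bar> \<le> Y"
    using convergent_imp_Bseq[OF convergentI[OF y]] unfolding Bseq_def by auto
  let ?S = "\<lambda>q. \<Sum>j<N q. tent_int (y q + K * real j / real q)"
  let ?L = "\<lambda>q. tent_int2 (y q + K * (real (N q) / real q)) - tent_int2 (y q)"
  let ?E = "\<lambda>q. 4 * K\<^sup>2 * (Y + 2 * K + 2 + K) / real q"
  have "isCont tent_int2 z" for z
    unfolding tent_int2_def by (intro continuous_intros) auto
  then have H: "(\<lambda>q. tent_int2 (f q)) \<longlonglongrightarrow> tent_int2 z" if "f \<longlonglongrightarrow> z" for f z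
    using that by (rule isCont_tendsto_compose)
  have "?L \<longlonglongrightarrow> tent_int2 (x + K * \<nu>) - tent_int2 x"
    by (intro tendsto_diff H tendsto_add y tendsto_mult tendsto_const lim_N)
  moreover have "(\<lambda>q. K * (?S q / real q) - ?L q) \<longlonglongrightarrow> 0"
  proof (rule Lim_null_comparison)
    show "?E \<longlonglongrightarrow> 0" by (rule lim_const_over_n)
    have "\<bar>K * (?S q / real q) - ?L q\<bar> \<le> ?E q" if q: "q \<ge> 1" for q
    proof -
      define h where "h = K / real q"
      have h: "h \<ge> 0" "h \<le> K" using K q by (auto simp: h_def divide_le_eq)
      have qh: "real q * h = K" using q by (simp add: h_def)
      have hN: "h * real j \<le> 2 * K" if "j \<le> N q" for j
      proof -
        have "h * real j \<le> h * (2 * real q)" using that N[of q] h by (intro mult_left_mono) auto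
        then show ?thesis using qh by (simp add: mult_ac)
      qed
      have "\<bar>h * (\<Sum>j<N q. tent_int (y q + h * real j)) - (tent_int2 (y q + h * real (N q)) - tent_int2 (y q))\<bar>
          \<le> real (N q) * (2 * h\<^sup>2 * (Y + 2 * K + 2 + K))"
      proof (rule progression_sum)
        fix j assume j: "j < N q"
        have "\<bar>tent_int2 (y q + h * real (Suc j)) - tent_int2 (y q + h * real j) - h * tent_int (y q + h * real j)\<bar>
            \<le> 2 * h\<^sup>2 * (\<bar>y q + h * real j\<bar> + 2 + h)"
          using tent_int2_increment[OF h(1), of "y q + h * real j"] by (simp add: algebra_simps)
        also have "\<dots> \<le> 2 * h\<^sup>2 * (Y + 2 * K + 2 + K)"
        proof -
          have "\<bar>y q + h * real j\<bar> \<le> Y + 2 * K"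
          using Y[of q] hN[of j] j mult_nonneg_nonneg[OF h(1), of "real j"] by linarith
          then show ?thesis using h by (intro mult_left_mono add_mono) auto
        qed
        finally show "\<bar>tent_int2 (y q + h * real (Suc j)) - tent_int2 (y q + h * real j) - h * tent_int (y q + h * real j)\<bar>
            \<le> 2 * h\<^sup>2 * (Y + 2 * K + 2 + K)" .
      qed
      also have "real (N q) * (2 * h\<^sup>2 * (Y + 2 * K + 2 + K)) \<le> (2 * real q) * (2 * h\<^sup>2 * (Y + 2 * K + 2 + K))"
        using N[of q] Y[of q] K by (intro mult_right_mono) auto
      also have "\<dots> = ?E q" using q by (simp add: h_def power2_eq_square)
      finally show ?thesis using q by (simp add: h_def mult_ac)
    qed
    then show "\<forall>\<^sub>F q in sequentially. norm (K * (?S q / real q) - ?L q) \<le> ?E q"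
      unfolding eventually_sequentially real_norm_def by blast
  qed
  ultimately have "(\<lambda>q. (K * (?S q / real q) - ?L q) + ?L q) \<longlonglongrightarrow> 0 + (tent_int2 (x + K * \<nu>) - tent_int2 x)"
    by (intro tendsto_add)
  then have "(\<lambda>q. K * (?S q / real q)) \<longlonglongrightarrow> tent_int2 (x + K * \<nu>) - tent_int2 x" by simp
  then have "(\<lambda>q. K * (?S q / real q) / K) \<longlonglongrightarrow> (tent_int2 (x + K * \<nu>) - tent_int2 x) / K"
    using K by (intro tendsto_divide tendsto_const) auto
  then show ?thesis using K by simp
qed

text \<open>Summing the slices over n gives three Riemann sums of \<open>tent_int\<close>: one for
  the upper limits of y, and two for the lower limits, whose form changes at n = q / d. All have
  step proportional to 1 / q, so their limits are increments of \<open>tent_int2\<close>.\<close>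

theorem section_box_density:
  fixes a c d :: int
  assumes "a \<ge> 2" "c \<ge> 1" "d \<ge> 1"
  shows "(\<lambda>q. real (card (section_box a c d (int q))) / real q ^ 3)
    \<longlonglongrightarrow> (1 - d / c * tent_int2 (c / d)) / (a * d + c)"
proof -
  define B where "B = real_of_int (a * d + c)"
  define A where "A = real_of_int a"
  have A: "A \<ge> 2" "A > 0" using assms by (auto simp: A_def)
  have c: "real_of_int c \<ge> 1" and d: "real_of_int d \<ge> 1" using assms by auto
  have Ad: "A * d \<ge> A" using A d by (simp add: mult_left_le)
  have BA: "B = A * d + c" by (simp add: B_def A_def)
  have B: "B > 0" "B \<ge> 2" using Ad A c unfolding BA by linarith+
  define r where "r = c / d"
  have r: "r > 0" using c d by (simp add: r_def)
  define g1 where "g1 q n = tent_int (B * real n / real q)" for q n :: nat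
  define g2 where "g2 q n = tent_int ((a * max 0 (int n * d - int q) + c * int n) / real q)" for q n :: nat
  \<comment> \<open>The ceiling of q / d, the first n with n d \<ge> q.\<close>
  define n0 where "n0 q = nat ((int q + d - 1) div d)" for q :: nat
  have n0: "int q \<le> d * int (n0 q)" "d * int (n0 q) < int q + d" for q
  proof -
    have nn: "0 \<le> (int q + d - 1) div d" using assms by (simp add: pos_imp_zdiv_nonneg_iff)
    have "(int q + d - 1) div d * d + (int q + d - 1) mod d = int q + d - 1" by (rule div_mult_mod_eq)
    moreover have "0 \<le> (int q + d - 1) mod d" "(int q + d - 1) mod d < d" using assms by auto
    ultimately have "int q \<le> (int q + d - 1) div d * d" "(int q + d - 1) div d * d < int q + d"
      by linarith+
    then show "int q \<le> d * int (n0 q)" "d * int (n0 q) < int q + d" using nn by (simp_all add: n0_def mult.commute)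
  qed
  have n0_le: "n0 q \<le> 2 * q" if "q \<ge> 1" for q
  proof (rule ccontr)
    assume "\<not> n0 q \<le> 2 * q"
    then have "d * (2 * int q + 1) \<le> d * int (n0 q)" using assms by (intro mult_left_mono) auto
    then have "d * (2 * int q) < int q" using n0(2)[of q] by (simp add: algebra_simps)
    moreover have "1 * (2 * int q) \<le> d * (2 * int q)" using assms by (intro mult_right_mono) auto
    ultimately show False by linarith
  qed
  have lim_n0: "(\<lambda>q. real (n0 q) / real q) \<longlonglongrightarrow> 1 / d"
  proof (rule real_tendsto_sandwich)
    show "(\<lambda>q. 1 / d) \<longlonglongrightarrow> 1 / d" by simp
    have "(\<lambda>q. 1 / d + 1 / real q) \<longlonglongrightarrow> 1 / d + 0" by (intro tendsto_add tendsto_const lim_1_over_n)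
    then show "(\<lambda>q. 1 / d + 1 / real q) \<longlonglongrightarrow> 1 / d" by simp
    have "1 / d \<le> real (n0 q) / real q \<and> real (n0 q) / real q \<le> 1 / d + 1 / real q" if "q \<ge> 1" for q
    proof -
      have "real_of_int (int q) \<le> real_of_int (d * int (n0 q))" "real_of_int (d * int (n0 q)) \<le> real_of_int (int q + d)"
        using n0[of q] by (simp_all only: of_int_le_iff)
      then show ?thesis using that d by (simp add: field_simps)
    qed
    then show "\<forall>\<^sub>F q in sequentially. 1 / d \<le> real (n0 q) / real q"
      "\<forall>\<^sub>F q in sequentially. real (n0 q) / real q \<le> 1 / d + 1 / real q"
      unfolding eventually_sequentially by blast+
  qed
  let ?J = "\<lambda>q. (\<Sum>n<2 * q. g1 q n - g2 q n) / real q"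
  \<comment> \<open>The maximum in \<open>g2\<close> switches at n0: before it the argument is c n /
    q, from it on (a (n d - q) + c n) / q = B n / q - A.\<close>
  have split: "(\<Sum>n<2 * q. g2 q n) = (\<Sum>j<n0 q. tent_int (0 + c * real j / real q))
      + (\<Sum>j<2 * q - n0 q. tent_int ((B * (real (n0 q) / real q) - A) + B * real j / real q))" if q: "q \<ge> 1" for q
  proof -
    have "{..<2 * q} = {..<n0 q} \<union> {n0 q..<2 * q}" using n0_le[OF q] by auto
    then have "(\<Sum>n<2 * q. g2 q n) = (\<Sum>n<n0 q. g2 q n) + (\<Sum>n=n0 q..<2 * q. g2 q n)"
      by (simp add: sum.union_disjoint ivl_disj_int)
    also have "(\<Sum>n<n0 q. g2 q n) = (\<Sum>j<n0 q. tent_int (0 + c * real j / real q))"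
    proof (rule sum.cong[OF refl])
      fix n assume "n \<in> {..<n0 q}"
      then have "d * (int n + 1) \<le> d * int (n0 q)" using assms by (intro mult_left_mono) auto
      then have "int n * d - int q \<le> 0" using n0(2)[of q] by (simp add: algebra_simps)
      then show "g2 q n = tent_int (0 + c * real n / real q)" by (simp add: g2_def)
    qed
    also have "(\<Sum>n=n0 q..<2 * q. g2 q n)
        = (\<Sum>j<2 * q - n0 q. tent_int ((B * (real (n0 q) / real q) - A) + B * real j / real q))"
    proof (rule sum.reindex_bij_witness[of _ "\<lambda>j. j + n0 q" "\<lambda>n. n - n0 q"])
      fix n assume n: "n \<in> {n0 q..<2 * q}"
      then have "d * int (n0 q) \<le> d * int n" using assms by (intro mult_left_mono) auto
      then have "max 0 (int n * d - int q) = int n * d - int q" using n0(1)[of q] by (simp add: mult.commute)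
      then have "(a * max 0 (int n * d - int q) + c * int n) / real q = (B * real n) / real q - A"
        using q by (simp add: BA A_def field_simps)
      moreover have "real (n - n0 q) = real n - real (n0 q)" using n by auto
      then have "(B * (real (n0 q) / real q) - A) + B * real (n - n0 q) / real q = (B * real n) / real q - A"
        using q by (simp add: field_simps)
      ultimately show "tent_int ((B * (real (n0 q) / real q) - A) + B * real (n - n0 q) / real q) = g2 q n"
        unfolding g2_def by (simp only:)
    qed auto
    finally show ?thesis .
  qed
  have lim1: "(\<lambda>q. (\<Sum>n<2 * q. g1 q n) / real q) \<longlonglongrightarrow> (tent_int2 (0 + B * 2) - tent_int2 0) / B"
  proof -
    have "(\<lambda>q. real (2 * q) / real q) \<longlonglongrightarrow> 2"
      by (rule tendsto_eventually) (auto simp: eventually_sequentially intro!: exI[of _ 1])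
    from tent_int_riemann_limit[OF B(1) _ this tendsto_const, of 0] show ?thesis by (simp add: g1_def)
  qed
  \<comment> \<open>The minimum makes the bound N q \<le> 2 q hold for every q; for q \<ge> 1 it
    equals \<open>n0 q\<close>.\<close>
  have lim2: "(\<lambda>q. (\<Sum>j<min (n0 q) (2 * q). tent_int (0 + c * real j / real q)) / real q)
      \<longlonglongrightarrow> (tent_int2 (0 + c * (1 / d)) - tent_int2 0) / c"
  proof (rule tent_int_riemann_limit)
    show "(\<lambda>q. real (min (n0 q) (2 * q)) / real q) \<longlonglongrightarrow> 1 / d"
      by (rule Lim_transform_eventually[OF lim_n0])
        (use n0_le in \<open>auto simp: eventually_sequentially intro!: exI[of _ 1]\<close>)
  qed (use c in auto)
  have lim3: "(\<lambda>q. (\<Sum>j<2 * q - n0 q. tent_int ((B * (real (n0 q) / real q) - A) + B * real j / real q)) / real q)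
      \<longlonglongrightarrow> (tent_int2 ((B * (1 / d) - A) + B * (2 - 1 / d)) - tent_int2 (B * (1 / d) - A)) / B"
  proof (rule tent_int_riemann_limit)
    have "(\<lambda>q. 2 - real (n0 q) / real q) \<longlonglongrightarrow> 2 - 1 / d" by (intro tendsto_diff tendsto_const lim_n0)
    then show "(\<lambda>q. real (2 * q - n0 q) / real q) \<longlonglongrightarrow> 2 - 1 / d"
    proof (rule Lim_transform_eventually)
      have "2 - real (n0 q) / real q = real (2 * q - n0 q) / real q" if "q \<ge> 1" for q
        using n0_le[OF that] that by (simp add: field_simps)
      then show "\<forall>\<^sub>F q in sequentially. 2 - real (n0 q) / real q = real (2 * q - n0 q) / real q"
        unfolding eventually_sequentially by blast
    qed
    show "(\<lambda>q. B * (real (n0 q) / real q) - A) \<longlonglongrightarrow> B * (1 / d) - A" by (intro tendsto_diff tendsto_mult tendsto_const lim_n0)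
  qed (use B in auto)
  let ?lim = "(tent_int2 (0 + B * 2) - tent_int2 0) / B - ((tent_int2 (0 + c * (1 / d)) - tent_int2 0) / c
      + (tent_int2 ((B * (1 / d) - A) + B * (2 - 1 / d)) - tent_int2 (B * (1 / d) - A)) / B)"
  have "?J \<longlonglongrightarrow> ?lim"
  proof (rule Lim_transform_eventually[OF tendsto_diff[OF lim1 tendsto_add[OF lim2 lim3]]])
    have "(\<Sum>n<2 * q. g1 q n) / real q - ((\<Sum>j<min (n0 q) (2 * q). tent_int (0 + c * real j / real q)) / real q
        + (\<Sum>j<2 * q - n0 q. tent_int ((B * (real (n0 q) / real q) - A) + B * real j / real q)) / real q) = ?J q"
      if q: "q \<ge> 1" for q
      unfolding sum_subtractf split[OF q] using n0_le[OF q] by (simp add: min_absorb1 diff_divide_distrib add_divide_distrib)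
    then show "\<forall>\<^sub>F q in sequentially. (\<Sum>n<2 * q. g1 q n) / real q
        - ((\<Sum>j<min (n0 q) (2 * q). tent_int (0 + c * real j / real q)) / real q
        + (\<Sum>j<2 * q - n0 q. tent_int ((B * (real (n0 q) / real q) - A) + B * real j / real q)) / real q) = ?J q"
      unfolding eventually_sequentially by blast
  qed
  \<comment> \<open>The far ends 2 B and 2 B - A lie beyond the knot 2, where
    \<open>tent_int2\<close> is linear. The only other value is at r = c / d, the end of the second
    sum and the start of the third.\<close>
  also have "?lim = A * ((1 - d / c * tent_int2 r) / B)"
  proof -
    have 1: "B * (1 / d) - A = r" using d by (simp add: BA r_def add_divide_distrib)
    have 2: "(B * (1 / d) - A) + B * (2 - 1 / d) = 2 * B - A" by (simp add: algebra_simps)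
    have "2 * B - A \<ge> 2" 
    proof -
      have "2 * B - A = A * d + (A * d - A) + 2 * c" by (simp add: BA)
      then show ?thesis using Ad A c by linarith
    qed
    then have 3: "tent_int2 (2 * B - A) = 2 * B - A - 1" by (rule tent_int2_large)
    have 4: "tent_int2 (0 + B * 2) = 2 * B - 1" using tent_int2_large[of "B * 2"] B by simp
    have 5: "tent_int2 0 = 0" by (simp add: tent_int2_def)
    have 6: "0 + c * (1 / d) = r" by (simp add: r_def)
    have "?lim = (2 * B - 1) / B - (tent_int2 r / c + (2 * B - A - 1 - tent_int2 r) / B)"
      unfolding 2 unfolding 1 3 4 5 6 by simp
    also have "\<dots> = (A - tent_int2 r * (B - c) / c) / B"
    proof -
      have "(2 * B - 1) / B - (H / x + (2 * B - A - 1 - H) / B) = (A - H * (B - x) / x) / B"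
        if "x > 0" for H x :: real using that B(1) by (simp add: field_simps)
      then show ?thesis using c by simp
    qed
    also have "B - c = A * d" by (simp add: BA)
    finally show ?thesis by (simp add: field_simps)
  qed
  finally have lim_J: "?J \<longlonglongrightarrow> A * ((1 - d / c * tent_int2 r) / B)" .
  \<comment> \<open>There are 2 q slices with error O(q) each, which is O(1 / q) relative to
    q^3.\<close>
  have bound: "\<bar>real (card (section_box a c d (int q))) / real q ^ 3 - ?J q / A\<bar> \<le> 2 * (6 * A + 3) / real q"
    if q: "q \<ge> 1" for q
  proof -
    define k where "k n = (\<Sum>y\<in>{max 0 (n * d - int q + 1)..n * d}.
       real (card {u. 0 \<le> u \<and> u < int q \<and> 0 \<le> (a * y + c * n) - u \<and> (a * y + c * n) - u < int q}))" for n
    have "real (card (section_box a c d (int q))) = (\<Sum>n\<in>{0..<2 * int q}. k n)"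
      using card_section_box(2)[of a c d "int q"] assms q by (simp add: k_def)
    also have "\<dots> = (\<Sum>n<2 * q. k (int n))"
      by (rule sum.reindex_bij_witness[of _ int nat]) auto
    finally have card: "real (card (section_box a c d (int q))) = (\<Sum>n<2 * q. k (int n))" .
    have "\<bar>k (int n) - (real q)\<^sup>2 / A * (g1 q n - g2 q n)\<bar> \<le> real q * (6 * A + 3)" for n
      using section_box_slice[OF assms q, of "int n"] unfolding k_def g1_def g2_def A_def B_def by simp
    then have "\<bar>\<Sum>n<2 * q. k (int n) - (real q)\<^sup>2 / A * (g1 q n - g2 q n)\<bar> \<le> (\<Sum>n<2 * q. real q * (6 * A + 3))"
      by (intro order.trans[OF sum_abs] sum_mono)
    then have "\<bar>real (card (section_box a c d (int q))) - (real q)\<^sup>2 / A * (\<Sum>n<2 * q. g1 q n - g2 q n)\<bar>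
        \<le> 2 * real q * (real q * (6 * A + 3))"
      by (simp add: card sum_subtractf[of "\<lambda>n. k (int n)"] sum_distrib_left)
    then have "\<bar>real (card (section_box a c d (int q))) - (real q)\<^sup>2 / A * (\<Sum>n<2 * q. g1 q n - g2 q n)\<bar> / real q ^ 3
        \<le> 2 * real q * (real q * (6 * A + 3)) / real q ^ 3"
      by (rule divide_right_mono) simp
    also have "\<dots> = 2 * (6 * A + 3) / real q" using q by (simp add: power3_eq_cube)
    also have "\<bar>real (card (section_box a c d (int q))) - (real q)\<^sup>2 / A * (\<Sum>n<2 * q. g1 q n - g2 q n)\<bar> / real q ^ 3
        = \<bar>(real (card (section_box a c d (int q))) - (real q)\<^sup>2 / A * (\<Sum>n<2 * q. g1 q n - g2 q n)) / real q ^ 3\<bar>"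
      by simp
    also have "(real (card (section_box a c d (int q))) - (real q)\<^sup>2 / A * (\<Sum>n<2 * q. g1 q n - g2 q n)) / real q ^ 3
        = real (card (section_box a c d (int q))) / real q ^ 3 - ?J q / A"
      using q A by (simp add: diff_divide_distrib power3_eq_cube power2_eq_square mult.commute)
    finally show ?thesis .
  qed
  have "(\<lambda>q. real (card (section_box a c d (int q))) / real q ^ 3 - ?J q / A) \<longlonglongrightarrow> 0"
  proof (rule Lim_null_comparison)
    show "(\<lambda>q. 2 * (6 * A + 3) / real q) \<longlonglongrightarrow> 0" by (rule lim_const_over_n)
    show "\<forall>\<^sub>F q in sequentially. norm (real (card (section_box a c d (int q))) / real q ^ 3 - ?J q / A)
        \<le> 2 * (6 * A + 3) / real q"
      unfolding eventually_sequentially real_norm_def using bound by blast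
  qed
  moreover have "(\<lambda>q. ?J q / A) \<longlonglongrightarrow> A * ((1 - d / c * tent_int2 r) / B) / A"
    using lim_J A by (intro tendsto_divide tendsto_const) auto
  ultimately have "(\<lambda>q. real (card (section_box a c d (int q))) / real q ^ 3 - ?J q / A + ?J q / A)
      \<longlonglongrightarrow> 0 + A * ((1 - d / c * tent_int2 r) / B) / A"
    by (rule tendsto_add)
  then show ?thesis using A by (simp add: B_def r_def)
qed

lemma section_box_density_cases:
  fixes a c d :: int
  assumes "a \<ge> 2" "c \<ge> 1" "d \<ge> 1"
  shows "c \<le> d \<Longrightarrow> (1 - d / c * tent_int2 (c / d)) / (a * d + c) = (6 * d^2 - c^2) / (6 * d^2 * (a * d + c))"
    and "d \<le> c \<Longrightarrow> c \<le> 2 * d \<Longrightarrow>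
      (1 - d / c * tent_int2 (c / d)) / (a * d + c) = (6 * d^3 - (2 * d - c)^3) / (6 * c * d^2 * (a * d + c))"
    and "2 * d \<le> c \<Longrightarrow> (1 - d / c * tent_int2 (c / d)) / (a * d + c) = d / (c * (a * d + c))"
proof -
  have c: "real_of_int c > 0" and d: "real_of_int d > 0" using assms by auto
  show "(1 - d / c * tent_int2 (c / d)) / (a * d + c) = (6 * d^2 - c^2) / (6 * d^2 * (a * d + c))" if "c \<le> d"
  proof -
    have "tent_int2 (c / d) = (c / d) ^ 3 / 6" by (rule tent_int2_small) (use c d that in auto)
    then have "1 - d / c * tent_int2 (c / d) = (6 * d^2 - c^2) / (6 * d^2)"
      using c d by (simp add: field_simps power2_eq_square power3_eq_cube)
    then show ?thesis by simp
  qed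
  show "(1 - d / c * tent_int2 (c / d)) / (a * d + c) = (6 * d^3 - (2 * d - c)^3) / (6 * c * d^2 * (a * d + c))"
    if "d \<le> c" "c \<le> 2 * d"
  proof -
    have "real_of_int c \<le> 2 * real_of_int d" using that(2) by (metis of_int_le_iff of_int_mult of_int_numeral)
    then have "tent_int2 (c / d) = c / d - 1 + (2 - c / d) ^ 3 / 6"
      by (intro tent_int2_middle) (use d that(1) in \<open>auto simp: field_simps\<close>)
    moreover have "2 - c / d = (2 * d - c) / d" using d by (simp add: field_simps)
    ultimately have "1 - d / c * tent_int2 (c / d) = (6 * d^3 - (2 * d - c)^3) / (6 * c * d^2)"
      using c d by (simp add: field_simps power2_eq_square power3_eq_cube)
    then show ?thesis by simp
  qed
  show "(1 - d / c * tent_int2 (c / d)) / (a * d + c) = d / (c * (a * d + c))" if "2 * d \<le> c"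
  proof -
    have "2 * real_of_int d \<le> real_of_int c" using that by (metis of_int_le_iff of_int_mult of_int_numeral)
    then have "tent_int2 (c / d) = c / d - 1" by (intro tent_int2_large) (use d in \<open>auto simp: field_simps\<close>)
    then have "1 - d / c * tent_int2 (c / d) = d / c" using c d by (simp add: field_simps)
    then show ?thesis by simp
  qed
qed

section \<open>Codimension one points of a factorial affine variety\<close>

declare prime_elem_iff_irreducible [iff del]

text \<open>A factorial ring with its fraction field, presented by an embedding instead of a subset
  so that divisibility can be taken in the ring itself.\<close>

locale ufd_embedding =
  fixes h :: "'r::ufd \<Rightarrow> 'K::field"
  assumes h_1: "h 1 = 1" and h_add: "h (x + y) = h x + h y" and h_mult: "h (x * y) = h x * h y"
    and h_inj: "h x = 0 \<Longrightarrow> x = 0" and fractions: "\<exists>a b. b \<noteq> 0 \<and> z = h a / h b"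
begin

lemma h_0: "h 0 = 0"
  using h_add[of 0 0] by (metis add.right_neutral add_left_imp_eq)

lemma h_eq_0_iff: "h x = 0 \<longleftrightarrow> x = 0"
  using h_inj h_0 by auto

lemma h_uminus: "h (- x) = - h x"
  using h_add[of x "- x"] by (simp add: h_0 add_eq_0_iff)

lemma h_eq_iff: "h x = h y \<longleftrightarrow> x = y"
proof
  assume "h x = h y"
  then have "h (x + - y) = 0" by (simp only: h_add h_uminus) simp
  then have "x + - y = 0" by (rule h_inj)
  then show "x = y" by simp
qed simp

lemma h_power: "h (x ^ n) = h x ^ n"
  by (induction n) (simp_all add: h_1 h_mult)

lemma ring_closed_range: "ring_closed (range h)"
  unfolding ring_closed_def
proof (intro conjI ballI)
  show "1 \<in> range h" using h_1 by (metis rangeI)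
  show "- x \<in> range h" if "x \<in> range h" for x using that by (auto simp flip: h_uminus)
  show "x + y \<in> range h" "x * y \<in> range h" if "x \<in> range h" "y \<in> range h" for x y
    using that by (auto simp flip: h_add h_mult)
qed

section \<open>Discrete valuation rings at prime elements\<close>

definition principal :: "'r \<Rightarrow> 'K set" where "principal p = h ` {r. p dvd r}"

definition stalk :: "'r \<Rightarrow> 'K set" where "stalk p = {h a / h b | a b. \<not> p dvd b}"

definition stalk_units :: "'r \<Rightarrow> 'K set" where
  "stalk_units p = {h a / h b | a b. \<not> p dvd a \<and> \<not> p dvd b}"

lemma h_in_principal: "h r \<in> principal p \<longleftrightarrow> p dvd r"
  by (auto simp: principal_def h_eq_iff)

lemma localization_principal: "localization (range h) (principal p) = stalk p"
proof -
  have "y \<in> range h - principal p \<longleftrightarrow> (\<exists>b. y = h b \<and> \<not> p dvd b)" for y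
    by (auto simp: h_in_principal)
  then have "localization (range h) (principal p) = {x / y | x y. x \<in> range h \<and> (\<exists>b. y = h b \<and> \<not> p dvd b)}"
    unfolding localization_def by presburger
  then show ?thesis unfolding stalk_def by blast
qed

lemma prime_ideal_principal:
  assumes p: "prime_elem p"
  shows "prime_ideal_of (range h) (principal p)"
  unfolding prime_ideal_of_def
proof (intro conjI ballI impI)
  show "principal p \<subseteq> range h" by (auto simp: principal_def)
  show "0 \<in> principal p" using h_in_principal[of 0 p] by (simp add: h_0)
  show "1 \<notin> principal p" using h_in_principal[of 1 p] p by (simp add: h_1 prime_elem_def)
next
  fix x y assume "x \<in> principal p" "y \<in> principal p"
  then show "x + y \<in> principal p" by (auto simp: principal_def simp flip: h_add)
next
  fix x y assume "x \<in> range h" "y \<in> principal p"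
  then show "x * y \<in> principal p" by (auto simp: principal_def simp flip: h_mult)
next
  fix x y assume "x \<in> range h" "y \<in> range h" and xy: "x * y \<in> principal p"
  then obtain a b where ab: "x = h a" "y = h b" by auto
  then have "p dvd a * b" using xy h_in_principal[of "a * b" p] by (simp add: h_mult)
  then have "p dvd a \<or> p dvd b" using p by (rule prime_elem_dvd_multD[rotated])
  then show "x \<in> principal p \<or> y \<in> principal p" by (simp add: ab h_in_principal)
qed

lemma ring_closed_stalk: "prime_elem p \<Longrightarrow> ring_closed (stalk p)"
  unfolding localization_principal[symmetric]
  by (rule ring_closed_localization[OF ring_closed_range prime_ideal_principal])

lemma not_dvd_nonzero: "\<not> p dvd b \<Longrightarrow> h b \<noteq> 0"
  by (auto simp: h_eq_0_iff)

lemma h_in_stalk: "prime_elem p \<Longrightarrow> h r \<in> stalk p"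
  unfolding stalk_def by (rule CollectI, rule exI[of _ r], rule exI[of _ 1]) (simp add: h_1 prime_elem_def)

lemma stalk_fraction_iff:
  assumes p: "prime_elem p" and b: "\<not> p dvd b" and d: "\<not> p dvd d"
    and eq: "h a / h b = h c / h d"
  shows "p dvd a \<longleftrightarrow> p dvd c"
proof -
  have "h (a * d) = h (c * b)"
    using eq not_dvd_nonzero[OF b] not_dvd_nonzero[OF d] by (simp add: h_mult frac_eq_eq)
  then have "a * d = c * b" by (simp add: h_eq_iff)
  then show ?thesis using prime_elem_dvd_mult_iff[OF p] b d by metis
qed

lemma stalk_fraction_mem_iff:
  assumes p: "prime_elem p" and a: "\<not> p dvd a"
  shows "h a / h b \<in> stalk p \<longleftrightarrow> \<not> p dvd b \<or> b = 0"
proof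
  assume "h a / h b \<in> stalk p"
  then obtain c d where cd: "h a / h b = h c / h d" "\<not> p dvd d" unfolding stalk_def by auto
  show "\<not> p dvd b \<or> b = 0"
  proof (cases "b = 0")
    case False
    have "h (a * d) = h (c * b)"
      using cd(1) not_dvd_nonzero[OF cd(2)] False by (simp add: h_mult frac_eq_eq h_eq_0_iff)
    then have "a * d = c * b" by (simp add: h_eq_iff)
    then show ?thesis using prime_elem_dvd_mult_iff[OF p] a cd(2) by (metis dvd_mult)
  qed simp
next
  assume "\<not> p dvd b \<or> b = 0"
  then show "h a / h b \<in> stalk p"
  proof
    \<comment> \<open>Division by 0 has the value 0, which lies in the ring.\<close>
    assume "b = 0"
    then show ?thesis using ring_closedD(2)[OF ring_closed_stalk[OF p]] by (simp add: h_0)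
  qed (auto simp: stalk_def)
qed

lemma stalk_units_eq:
  assumes p: "prime_elem p"
  shows "stalk_units p = stalk p - max_ideal (stalk p)"
proof (intro equalityI subsetI)
  fix x assume "x \<in> stalk_units p"
  then obtain a b where ab: "x = h a / h b" "\<not> p dvd a" "\<not> p dvd b" unfolding stalk_units_def by auto
  then have "inverse x = h b / h a" by simp
  then have "inverse x \<in> stalk p" "x \<in> stalk p" using ab unfolding stalk_def by auto
  moreover have "x \<noteq> 0" using ab not_dvd_nonzero by simp
  ultimately show "x \<in> stalk p - max_ideal (stalk p)" by (simp add: max_ideal_def)
next
  fix x assume x: "x \<in> stalk p - max_ideal (stalk p)"
  then obtain a b where ab: "x = h a / h b" "\<not> p dvd b" unfolding stalk_def by auto
  have nz: "x \<noteq> 0" "inverse x \<in> stalk p" using x by (auto simp: max_ideal_def)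
  then have "h b / h a \<in> stalk p" using ab by simp
  then have "\<not> p dvd a" using stalk_fraction_mem_iff[OF p ab(2), of a] nz(1) ab by (auto simp: h_0)
  then show "x \<in> stalk_units p" using ab unfolding stalk_units_def by auto
qed

lemma stalk_units_mult:
  assumes p: "prime_elem p" and "x \<in> stalk_units p" "y \<in> stalk_units p"
  shows "x * y \<in> stalk_units p"
proof -
  obtain a b c d where *: "x = h a / h b" "\<not> p dvd a" "\<not> p dvd b" "y = h c / h d" "\<not> p dvd c" "\<not> p dvd d"
    using assms(2,3) unfolding stalk_units_def by auto
  then have "x * y = h (a * c) / h (b * d)" by (simp add: h_mult)
  moreover have "\<not> p dvd a * c" "\<not> p dvd b * d" using * prime_elem_dvd_mult_iff[OF p] by auto
  ultimately show ?thesis unfolding stalk_units_def by blast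
qed

lemma stalk_units_inverse: "x \<in> stalk_units p \<Longrightarrow> inverse x \<in> stalk_units p"
  unfolding stalk_units_def by force

lemma stalk_units_1: "prime_elem p \<Longrightarrow> 1 \<in> stalk_units p"
  unfolding stalk_units_def by (rule CollectI, rule exI[of _ 1], rule exI[of _ 1]) (simp add: h_1 prime_elem_def)

lemma stalk_units_power_int:
  assumes p: "prime_elem p" and x: "x \<in> stalk_units p"
  shows "x powi n \<in> stalk_units p"
proof -
  have "y ^ m \<in> stalk_units p" if "y \<in> stalk_units p" for m y
    using that by (induction m) (auto intro: stalk_units_1[OF p] stalk_units_mult[OF p])
  then show ?thesis using x by (simp add: power_int_def stalk_units_inverse)
qed

lemma stalk_units_nonzero: "x \<in> stalk_units p \<Longrightarrow> x \<noteq> 0"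
  unfolding stalk_units_def using not_dvd_nonzero by auto

lemma stalk_units_uniformizer:
  assumes p: "prime_elem p" and u: "h p powi n \<in> stalk_units p"
  shows "n = 0"
proof -
  have *: False if m: "m > 0" and pm: "h p ^ m \<in> stalk_units p" for m
  proof -
    obtain a b where ab: "h p ^ m = h a / h b" "\<not> p dvd a" "\<not> p dvd b"
      using pm unfolding stalk_units_def by auto
    have "p dvd p ^ m" using m by (simp add: dvd_power)
    moreover have "h (p ^ m) / h 1 = h a / h b" using ab by (simp add: h_power h_1)
    ultimately show False
      using stalk_fraction_iff[OF p _ ab(3), of 1 "p ^ m" a] ab(2) p by (simp add: prime_elem_def)
  qed
  show ?thesis
  proof (rule ccontr)
    assume "n \<noteq> 0"
    then consider "n > 0" | "n < 0" by linarith
    then show False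
    proof cases
      case 1
      then have "h p ^ nat n \<in> stalk_units p" using u by (simp add: power_int_def)
      then show False using *[of "nat n"] 1 by simp
    next
      case 2
      then have "h p ^ nat (- n) \<in> stalk_units p"
        using stalk_units_inverse[OF u] by (simp add: power_int_def power_inverse)
      then show False using *[of "nat (- n)"] 2 by simp
    qed
  qed
qed

section \<open>Orders of vanishing\<close>

lemma prime_factorization_exists:
  assumes "a \<noteq> (0 :: 'r)"
  shows "\<exists>u F. u dvd 1 \<and> (\<forall>f\<in>#F. prime_elem f) \<and> a = u * prod_mset F"
proof (cases "a dvd 1")
  case True
  then show ?thesis by (intro exI[of _ a] exI[of _ "{#}"]) simp
next
  case False
  then obtain F where F: "mset_factors F a" using mset_factors_exist[OF assms] by blast
  have "prime_elem f" if "f \<in># F" for f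
  proof -
    have "Factorial_Ring.irreducible f" using F that unfolding mset_factors_def by blast
    then show ?thesis by (simp add: prime_elem_iff_irreducible)
  qed
  moreover have "a = prod_mset F" using F unfolding mset_factors_def by simp
  ultimately show ?thesis by (intro exI[of _ 1] exI[of _ F]) simp
qed

text \<open>A prime factor f divisible by p is associated to p but need not equal it; so p is
  extracted from f with a cofactor t, and primality of f shows that p does not divide t.\<close>

lemma prime_elem_power_decomp:
  fixes p a :: 'r
  assumes p: "prime_elem p" and "a \<noteq> 0"
  shows "\<exists>i a'. a = p ^ i * a' \<and> \<not> p dvd a'"
proof -
  obtain u F where uF: "u dvd 1" "\<forall>f\<in>#F. prime_elem f" "a = u * prod_mset F"
    using prime_factorization_exists[OF assms(2)] by blast
  have "\<exists>i a'. u * prod_mset F = p ^ i * a' \<and> \<not> p dvd a'" using uF(2)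
  proof (induction F)
    case empty
    have "\<not> p dvd u" using p uF(1) by (metis dvd_trans prime_elem_def)
    moreover have "u * prod_mset {#} = p ^ 0 * u" by simp
    ultimately show ?case by blast
  next
    case (add f F)
    then obtain i a' where i: "u * prod_mset F = p ^ i * a'" "\<not> p dvd a'" by auto
    have f: "prime_elem f" using add by simp
    show ?case
    proof (cases "p dvd f")
      case True
      then obtain t where t: "f = p * t" by auto
      have "f dvd p * t" using t by simp
      then have "f dvd p \<or> f dvd t" by (rule prime_elem_dvd_multD[OF f])
      moreover have "\<not> f dvd t"
      proof
        assume "f dvd t"
        then obtain s where "t = f * s" by auto
        then have "f * 1 = f * (p * s)" using t by (simp add: mult_ac)
        then have "p dvd 1" using f by (metis dvd_triv_left mult_left_cancel prime_elem_def)
        then show False using p by (simp add: prime_elem_def)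
      qed
      ultimately have "f dvd p" by simp
      have "\<not> p dvd t"
      proof
        assume "p dvd t"
        then have "f dvd t" using \<open>f dvd p\<close> by (rule dvd_trans[rotated])
        then show False using \<open>\<not> f dvd t\<close> by simp
      qed
      then have "\<not> p dvd t * a'" using i(2) prime_elem_dvd_mult_iff[OF p] by blast
      moreover have "u * prod_mset (add_mset f F) = f * (u * prod_mset F)" by (simp add: mult_ac)
      then have "u * prod_mset (add_mset f F) = p ^ Suc i * (t * a')" unfolding i(1) t by (simp add: mult_ac)
      ultimately show ?thesis by blast
    next
      case False
      then have "\<not> p dvd f * a'" using i(2) prime_elem_dvd_mult_iff[OF p] by blast
      moreover have "u * prod_mset (add_mset f F) = f * (u * prod_mset F)" by (simp add: mult_ac)
      then have "u * prod_mset (add_mset f F) = p ^ i * (f * a')" unfolding i(1) by (simp add: mult_ac)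
      ultimately show ?thesis by blast
    qed
  qed
  then show ?thesis using uF(3) by simp
qed

lemma uniformizer_decomp:
  assumes p: "prime_elem p" and z: "z \<noteq> 0"
  obtains n u where "u \<in> stalk_units p" "z = h p powi n * u"
proof -
  obtain a b where ab: "b \<noteq> 0" "z = h a / h b" using fractions by blast
  then have "a \<noteq> 0" using z by (auto simp: h_0)
  obtain i a' where a: "a = p ^ i * a'" "\<not> p dvd a'" using prime_elem_power_decomp[OF p \<open>a \<noteq> 0\<close>] by blast
  obtain j b' where b: "b = p ^ j * b'" "\<not> p dvd b'" using prime_elem_power_decomp[OF p ab(1)] by blast
  have "h p \<noteq> 0" using p by (simp add: h_eq_0_iff prime_elem_def)
  then have "z = h p powi (int i - int j) * (h a' / h b')"
    unfolding ab(2) a(1) b(1) by (simp add: h_mult h_power power_int_diff)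
  moreover have "h a' / h b' \<in> stalk_units p" using a(2) b(2) unfolding stalk_units_def by blast
  ultimately show ?thesis using that by blast
qed

lemma max_ideal_stalk:
  assumes p: "prime_elem p"
  shows "max_ideal (stalk p) = (\<lambda>x. h p * x) ` stalk p"
proof (intro equalityI subsetI)
  fix x assume x: "x \<in> max_ideal (stalk p)"
  then have xs: "x \<in> stalk p" by (simp add: max_ideal_def)
  then obtain a b where ab: "x = h a / h b" "\<not> p dvd b" unfolding stalk_def by auto
  have "p dvd a"
  proof (rule ccontr)
    assume "\<not> p dvd a"
    then have "x \<in> stalk_units p" using ab unfolding stalk_units_def by auto
    then show False using x stalk_units_eq[OF p] by auto
  qed
  then obtain t where "a = p * t" by auto
  then have "x = h p * (h t / h b)" using ab by (simp add: h_mult)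
  moreover have "h t / h b \<in> stalk p" using ab(2) unfolding stalk_def by blast
  ultimately show "x \<in> (\<lambda>x. h p * x) ` stalk p" by blast
next
  fix x assume "x \<in> (\<lambda>x. h p * x) ` stalk p"
  then obtain a b where ab: "x = h p * (h a / h b)" "\<not> p dvd b" unfolding stalk_def by auto
  then have x: "x = h (p * a) / h b" by (simp add: h_mult)
  then have xs: "x \<in> stalk p" using ab(2) unfolding stalk_def by blast
  have "x \<notin> stalk_units p"
  proof
    assume "x \<in> stalk_units p"
    then obtain c d where cd: "x = h c / h d" "\<not> p dvd c" "\<not> p dvd d" unfolding stalk_units_def by auto
    then show False using stalk_fraction_iff[OF p ab(2) cd(3), of "p * a" c] x by simp
  qed
  then show "x \<in> max_ideal (stalk p)" using xs stalk_units_eq[OF p] by auto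
qed

text \<open>\<open>vanishing_order\<close> admits any generator of the maximal ideal, so uniqueness
  means independence of that choice. Two generators differ by a unit v, and
  \<open>h p powi n\<close> is a unit only for n = 0.\<close>

lemma vanishing_order_stalk:
  assumes p: "prime_elem p" and u: "u \<in> stalk_units p"
  shows "vanishing_order (stalk p) (h p powi n * u) = n"
  unfolding vanishing_order_def
proof (rule the_equality)
  show "\<exists>\<pi> u'. max_ideal (stalk p) = (\<lambda>x. \<pi> * x) ` stalk p \<and> u' \<in> stalk p - max_ideal (stalk p) \<and>
      h p powi n * u = \<pi> powi n * u'"
    using max_ideal_stalk[OF p] u stalk_units_eq[OF p] by blast
next
  fix m assume "\<exists>\<pi> u'. max_ideal (stalk p) = (\<lambda>x. \<pi> * x) ` stalk p \<and> u' \<in> stalk p - max_ideal (stalk p) \<and>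
      h p powi n * u = \<pi> powi m * u'"
  then obtain \<pi> u' where \<pi>: "max_ideal (stalk p) = (\<lambda>x. \<pi> * x) ` stalk p" and u': "u' \<in> stalk_units p"
    and eq: "h p powi n * u = \<pi> powi m * u'" using stalk_units_eq[OF p] by blast
  note cl = ring_closedD[OF ring_closed_stalk[OF p]]
  have hp: "h p \<noteq> 0" using p by (simp add: h_eq_0_iff prime_elem_def)
  have "h p * 1 \<in> (\<lambda>x. h p * x) ` stalk p" using cl(1) by blast
  then have "h p * 1 \<in> (\<lambda>x. \<pi> * x) ` stalk p" using max_ideal_stalk[OF p] \<pi> by simp
  then obtain w where w: "w \<in> stalk p" "h p = \<pi> * w" by auto
  have "\<pi> * 1 \<in> (\<lambda>x. \<pi> * x) ` stalk p" using cl(1) by blast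
  then have "\<pi> * 1 \<in> (\<lambda>x. h p * x) ` stalk p" using max_ideal_stalk[OF p] \<pi> by simp
  then obtain v where v: "v \<in> stalk p" "\<pi> = h p * v" by auto
  have "h p * (v * w) = h p * 1" using w v by (simp add: mult_ac)
  then have vw: "v * w = 1" using hp by simp
  then have "inverse v = w" "v \<noteq> 0" by (auto intro: inverse_unique)
  then have vu: "v \<in> stalk_units p" using v w stalk_units_eq[OF p] by (auto simp: max_ideal_def)
  have vm: "v powi m * u' \<in> stalk_units p" by (intro stalk_units_mult[OF p] stalk_units_power_int[OF p] vu u')
  have "h p powi n * u = h p powi m * (v powi m * u')" unfolding eq v(2) by (simp add: power_int_mult_distrib)
  then have "h p powi (n - m) = (v powi m * u') * inverse u"
    using hp stalk_units_nonzero[OF u] by (simp add: power_int_diff field_simps)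
  also have "\<dots> \<in> stalk_units p" by (intro stalk_units_mult[OF p vm] stalk_units_inverse u)
  finally have "n - m = 0" by (rule stalk_units_uniformizer[OF p])
  then show "m = n" by simp
qed

lemma vanishing_order_mult:
  assumes p: "prime_elem p" and "x \<noteq> 0" "y \<noteq> 0"
  shows "vanishing_order (stalk p) (x * y) = vanishing_order (stalk p) x + vanishing_order (stalk p) y"
proof -
  obtain n u m v where *: "u \<in> stalk_units p" "x = h p powi n * u" "v \<in> stalk_units p" "y = h p powi m * v"
    using uniformizer_decomp[OF p] assms(2,3) by metis
  have "h p \<noteq> 0" using p by (simp add: h_eq_0_iff prime_elem_def)
  then have "x * y = h p powi (n + m) * (u * v)" using * by (simp add: power_int_add mult_ac)
  then show ?thesis
    using vanishing_order_stalk[OF p stalk_units_mult[OF p *(1,3)]] vanishing_order_stalk[OF p *(1)]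
      vanishing_order_stalk[OF p *(3)] * by metis
qed

lemma vanishing_order_unit: "prime_elem p \<Longrightarrow> u \<in> stalk_units p \<Longrightarrow> vanishing_order (stalk p) u = 0"
  using vanishing_order_stalk[of p u 0] by simp

lemma vanishing_order_uniformizer_power: "prime_elem p \<Longrightarrow> vanishing_order (stalk p) (h p powi n) = n"
  using vanishing_order_stalk[of p 1 n] stalk_units_1 by simp

lemma vanishing_order_power_int:
  assumes p: "prime_elem p" and "x \<noteq> 0"
  shows "vanishing_order (stalk p) (x powi n) = n * vanishing_order (stalk p) x"
proof -
  obtain m u where *: "u \<in> stalk_units p" "x = h p powi m * u" using uniformizer_decomp[OF p assms(2)] by metis
  have "x powi n = h p powi (m * n) * u powi n" unfolding *(2) by (simp add: power_int_mult_distrib power_int_mult)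
  then show ?thesis
    using vanishing_order_stalk[OF p stalk_units_power_int[OF p *(1)]] vanishing_order_stalk[OF p *(1)] *(2)
    by (simp add: mult.commute)
qed

lemma vanishing_order_nonneg_iff:
  assumes p: "prime_elem p" and x: "x \<noteq> 0"
  shows "vanishing_order (stalk p) x \<ge> 0 \<longleftrightarrow> x \<in> stalk p"
proof -
  obtain n u where *: "u \<in> stalk_units p" "x = h p powi n * u" using uniformizer_decomp[OF p x] by metis
  have ord: "vanishing_order (stalk p) x = n" using vanishing_order_stalk[OF p *(1)] * by metis
  have us: "u \<in> stalk p" "inverse u \<in> stalk p"
    using * stalk_units_inverse stalk_units_eq[OF p] by blast+
  note cl = ring_closedD[OF ring_closed_stalk[OF p]]
  show ?thesis
  proof
    assume "vanishing_order (stalk p) x \<ge> 0"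
    then have "h p powi n = h (p ^ nat n)" using ord by (simp add: power_int_def h_power)
    then show "x \<in> stalk p" using *(2) cl(4)[OF h_in_stalk[OF p] us(1)] by simp
  next
    assume xs: "x \<in> stalk p"
    show "vanishing_order (stalk p) x \<ge> 0"
    proof (rule ccontr)
      assume "\<not> vanishing_order (stalk p) x \<ge> 0"
      then have n: "n < 0" using ord by simp
      have hp: "h p \<noteq> 0" using p by (simp add: h_eq_0_iff prime_elem_def)
      have "x * inverse u = h p powi n" using * stalk_units_nonzero by simp
      then have "h p powi n \<in> stalk p" using cl(4)[OF xs us(2)] by simp
      moreover have "inverse (h p powi n) = h (p ^ nat (- n))" using n by (simp add: power_int_def h_power power_inverse)
      then have "inverse (h p powi n) \<in> stalk p" using h_in_stalk[OF p] by simp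
      ultimately have "h p powi n \<in> stalk_units p"
        using stalk_units_eq[OF p] hp by (auto simp: max_ideal_def)
      then show False using stalk_units_uniformizer[OF p] n by blast
    qed
  qed
qed

section \<open>Points of codimension one and prime elements\<close>

lemma nonzero_prime_ideal_stalk:
  assumes p: "prime_elem p" and Q: "prime_ideal_of (stalk p) Q" and "Q \<noteq> {0}"
  shows "Q = max_ideal (stalk p)"
proof
  have QD: "Q \<subseteq> stalk p" "0 \<in> Q" "1 \<notin> Q" "\<And>x y. x \<in> stalk p \<Longrightarrow> y \<in> Q \<Longrightarrow> x * y \<in> Q"
    "\<And>x y. x \<in> stalk p \<Longrightarrow> y \<in> stalk p \<Longrightarrow> x * y \<in> Q \<Longrightarrow> x \<in> Q \<or> y \<in> Q"
    using Q unfolding prime_ideal_of_def by auto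
  show "Q \<subseteq> max_ideal (stalk p)"
  proof
    fix x assume x: "x \<in> Q"
    show "x \<in> max_ideal (stalk p)"
    proof (rule ccontr)
      assume "x \<notin> max_ideal (stalk p)"
      then have "x \<noteq> 0" "inverse x \<in> stalk p" using x QD(1) by (auto simp: max_ideal_def)
      then show False using QD(3) QD(4)[of "inverse x" x] x by simp
    qed
  qed
  obtain x where x: "x \<in> Q" "x \<noteq> 0" using assms(3) QD(2) by blast
  obtain n u where *: "u \<in> stalk_units p" "x = h p powi n * u" using uniformizer_decomp[OF p x(2)] by metis
  have "n \<ge> 0"
    using vanishing_order_nonneg_iff[OF p x(2)] vanishing_order_stalk[OF p *(1)] * x(1) QD(1) by auto
  have "inverse u \<in> stalk p" using * stalk_units_inverse stalk_units_eq[OF p] by blast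
  then have "inverse u * x \<in> Q" using QD(4) x(1) by simp
  moreover have "inverse u * x = h p ^ nat n"
    using *(2) stalk_units_nonzero[OF *(1)] \<open>n \<ge> 0\<close> by (simp add: power_int_def)
  ultimately have pow: "h p ^ nat n \<in> Q" by simp
  have "h p ^ m \<in> Q \<Longrightarrow> h p \<in> Q" for m
  proof (induction m)
    case (Suc m)
    then show ?case using QD(5)[of "h p" "h p ^ m"] h_in_stalk[OF p]
      ring_closedD(7)[OF ring_closed_stalk[OF p] h_in_stalk[OF p]] by auto
  qed (use QD(3) in simp)
  then have "h p \<in> Q" using pow by blast
  then show "max_ideal (stalk p) \<subseteq> Q"
    unfolding max_ideal_stalk[OF p] using QD(4) by (auto simp: mult.commute)
qed

lemma krull_dim_stalk:
  assumes p: "prime_elem p"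
  shows "krull_dim (stalk p) = 1"
proof (rule antisym)
  note R = ring_closed_stalk[OF p]
  show "krull_dim (stalk p) \<le> 1"
    unfolding one_enat_def
  proof (rule krull_dim_le[OF R])
    fix P assume P: "\<And>i. i \<le> Suc 1 \<Longrightarrow> prime_ideal_of (stalk p) (P i)" "\<And>i. i \<le> 1 \<Longrightarrow> P i \<subset> P (Suc i)"
    have 0: "0 \<in> P i" if "i \<le> Suc 1" for i using P(1)[OF that] by (simp add: prime_ideal_of_def)
    have "P 1 \<noteq> {0}" "P 2 \<noteq> {0}" using P(2)[of 0] P(2)[of 1] 0[of 0] 0[of 1] by (auto simp: numeral_2_eq_2)
    then have "P 1 = P 2"
      using nonzero_prime_ideal_stalk[OF p P(1)[of 1]] nonzero_prime_ideal_stalk[OF p P(1)[of 2]] by simp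
    then show False using P(2)[of 1] by (simp add: numeral_2_eq_2)
  qed
  have "prime_ideal_of (stalk p) (max_ideal (stalk p))"
    unfolding prime_ideal_of_def
  proof (intro conjI ballI impI)
    note cl = ring_closedD[OF R]
    note M = max_ideal_stalk[OF p]
    show "max_ideal (stalk p) \<subseteq> stalk p" by (auto simp: max_ideal_def)
    show "0 \<in> max_ideal (stalk p)" "1 \<notin> max_ideal (stalk p)" using cl(1,2) by (auto simp: max_ideal_def)
    show "x + y \<in> max_ideal (stalk p)" if "x \<in> max_ideal (stalk p)" "y \<in> max_ideal (stalk p)" for x y
      using that cl(3) unfolding M by (auto simp flip: distrib_left)
    show "x * y \<in> max_ideal (stalk p)" if "x \<in> stalk p" "y \<in> max_ideal (stalk p)" for x y
      using that cl(4) unfolding M by (auto simp: mult.left_commute)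
    show "x \<in> max_ideal (stalk p) \<or> y \<in> max_ideal (stalk p)"
      if "x \<in> stalk p" "y \<in> stalk p" "x * y \<in> max_ideal (stalk p)" for x y
      using that stalk_units_mult[OF p, of x y] stalk_units_eq[OF p] by blast
  qed
  moreover have "{0} \<subset> max_ideal (stalk p)"
  proof -
    have "h p * 1 \<in> max_ideal (stalk p)" unfolding max_ideal_stalk[OF p] using ring_closedD(1)[OF R] by blast
    moreover have "h p \<noteq> 0" using p by (simp add: h_eq_0_iff prime_elem_def)
    moreover have "0 \<in> max_ideal (stalk p)" using ring_closedD(2)[OF R] by (simp add: max_ideal_def)
    ultimately show ?thesis by auto
  qed
  ultimately have "enat 1 \<le> krull_dim (stalk p)"
    by (intro krull_dim_ge[OF R, of 1 "\<lambda>i. if i = 0 then {0} else max_ideal (stalk p)"])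
       (auto intro: prime_ideal_of_zero[OF R])
  then show "1 \<le> krull_dim (stalk p)" by (simp add: one_enat_def)
qed

text \<open>The classical fact that height one primes of a factorial ring are principal. A nonzero
  element of P has a prime factor in P, and that factor generates P. The second conclusion
  identifies the generator from any prime element known to lie in P.\<close>

lemma codim_one_prime_ideal:
  assumes P: "prime_ideal_of (range h) P" and dim: "krull_dim (localization (range h) P) = 1"
  shows "\<exists>p. prime_elem p \<and> P = principal p"
    and "prime_elem p \<Longrightarrow> h p \<in> P \<Longrightarrow> P = principal p"
proof -
  note R = ring_closed_range
  have PD: "P \<subseteq> range h" "0 \<in> P" "1 \<notin> P" "\<And>x y. x \<in> range h \<Longrightarrow> y \<in> P \<Longrightarrow> x * y \<in> P"
    "\<And>x y. x \<in> range h \<Longrightarrow> y \<in> range h \<Longrightarrow> x * y \<in> P \<Longrightarrow> x \<in> P \<or> y \<in> P"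
    using P unfolding prime_ideal_of_def by auto
  have unique: "P = principal p" if p: "prime_elem p" and hp: "h p \<in> P" for p
  proof (rule ccontr)
    assume ne: "P \<noteq> principal p"
    have sub: "principal p \<subseteq> P"
    proof
      fix x assume "x \<in> principal p"
      then obtain t where "x = h (p * t)" by (auto simp: principal_def)
      then show "x \<in> P" using PD(4)[of "h t" "h p"] hp by (simp add: h_mult mult.commute)
    qed
    \<comment> \<open>If P were larger than (p), the chain 0, (p), P would survive localization at P
      and give dimension at least 2.\<close>
    let ?Q = "\<lambda>i. if i = 0 then {0} else if i = 1 then principal p else P"
    let ?E = "\<lambda>Q. {x / y | x y. x \<in> Q \<and> y \<in> range h - P}"
    have Q: "prime_ideal_of (range h) (?Q i)" "?Q i \<subseteq> P" for i :: nat
      using prime_ideal_of_zero[OF R] prime_ideal_principal[OF p] P sub PD(2) by auto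
    have one: "1 \<in> range h - P" using PD(3) ring_closedD(1)[OF R] by simp
    have strict: "?Q i \<subset> ?Q (Suc i)" if "i < 2" for i :: nat
    proof -
      have "h p \<in> principal p" "h p \<noteq> 0" "0 \<in> principal p"
        using p h_in_principal[of p p] h_in_principal[of 0 p] by (auto simp: h_eq_0_iff prime_elem_def h_0)
      then show ?thesis using that ne sub by (cases i) auto
    qed
    have "enat 2 \<le> krull_dim (localization (range h) P)"
    proof (rule krull_dim_ge[OF ring_closed_localization[OF R P], of 2 "\<lambda>i. ?E (?Q i)"])
      show "prime_ideal_of (localization (range h) P) (?E (?Q i))" for i :: nat
        by (rule prime_ideal_of_localization[OF R P Q(1)[of i] Q(2)[of i]])
      show "?E (?Q i) \<subset> ?E (?Q (Suc i))" if i: "i < 2" for i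
      proof
        show "?E (?Q i) \<subseteq> ?E (?Q (Suc i))" using strict[OF i] by blast
        obtain w where w: "w \<in> ?Q (Suc i)" "w \<notin> ?Q i" using strict[OF i] by blast
        have "w / 1 \<in> ?E (?Q (Suc i))" using w(1) one by blast
        moreover have "w / 1 \<notin> ?E (?Q i)"
          using localization_numerator_mem[OF R P Q, of w 1 i] w one Q(2)[of "Suc i"] PD(1) by blast
        ultimately show "?E (?Q i) \<noteq> ?E (?Q (Suc i))" by metis
      qed
    qed
    then show False using dim by (simp add: one_enat_def)
  qed
  show "P = principal p" if "prime_elem p" "h p \<in> P" using that by (rule unique)
  \<comment> \<open>At the zero ideal the localization is the whole field, which has dimension
    0.\<close>
  have "P \<noteq> {0}"
  proof
    assume P0: "P = {0}"
    have loc: "localization (range h) P = UNIV"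
    proof -
      have "z \<in> localization (range h) P" for z
      proof -
        obtain a b where "b \<noteq> 0" "z = h a / h b" using fractions by blast
        moreover have "h b \<in> range h - {0}" using \<open>b \<noteq> 0\<close> h_eq_0_iff by blast
        ultimately show ?thesis unfolding localization_def P0 by blast
      qed
      then show ?thesis by auto
    qed
    have "krull_dim (localization (range h) P) \<le> enat 0"
      unfolding loc
    proof (rule krull_dim_le)
      show "ring_closed (UNIV :: 'K set)" by (simp add: ring_closed_def)
      fix Q :: "nat \<Rightarrow> 'K set"
      assume Q: "\<And>i. i \<le> Suc 0 \<Longrightarrow> prime_ideal_of UNIV (Q i)" "\<And>i. i \<le> 0 \<Longrightarrow> Q i \<subset> Q (Suc i)"
      obtain x where x: "x \<in> Q 1" "x \<notin> Q 0" using Q(2)[of 0] by auto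
      then have "x \<noteq> 0" using Q(1)[of 0] by (auto simp: prime_ideal_of_def)
      moreover have "inverse x * x \<in> Q 1" using Q(1)[of 1] x(1) unfolding prime_ideal_of_def by simp
      ultimately show False using Q(1)[of 1] unfolding prime_ideal_of_def by simp
    qed
    then show False using dim by (simp add: one_enat_def)
  qed
  then obtain x where x: "x \<in> P" "x \<noteq> 0" using PD(2) by blast
  then obtain r where r: "h r \<in> P" "r \<noteq> 0" using PD(1) h_0 by blast
  obtain u F where uF: "u dvd 1" "\<forall>f\<in>#F. prime_elem f" "r = u * prod_mset F"
    using prime_factorization_exists[OF r(2)] by blast
  have "\<exists>f\<in>#F. h f \<in> P" if "h (u * prod_mset F) \<in> P"
    using that
  proof (induction F)
    case empty
    obtain v where "u * v = 1" using uF(1) by (metis dvdE)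
    then have "h v * h u = 1" by (metis h_1 h_mult mult.commute)
    then show ?case using PD(3) PD(4)[of "h v" "h u"] empty by simp
  next
    case (add f F)
    have "h (u * prod_mset (add_mset f F)) = h f * h (u * prod_mset F)" by (simp add: h_mult mult_ac)
    then show ?case using PD(5)[of "h f" "h (u * prod_mset F)"] add by auto
  qed
  then obtain p where pF: "p \<in># F" and hp: "h p \<in> P" using r(1) unfolding uF(3) by blast
  have p: "prime_elem p" using uF(2) pF by simp
  show "\<exists>p. prime_elem p \<and> P = principal p" using p unique[OF p hp] by (intro exI conjI)
qed

text \<open>Regularity in codimension one off the divisor of m implies a denominator that is a power
  of m. The prime factors of the denominator are removed one by one: those dividing m by multiplying
  with m, the others because regularity there forces them to divide the numerator.\<close>

lemma regular_outside_divisor: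
  assumes m: "m \<noteq> 0" and z: "\<And>p. prime_elem p \<Longrightarrow> \<not> p dvd m \<Longrightarrow> z \<in> stalk p"
  obtains N a where "z * h m ^ N = h a"
proof -
  obtain a b where ab: "b \<noteq> 0" "z = h a / h b" using fractions by blast
  obtain u F where uF: "u dvd 1" "\<forall>f\<in>#F. prime_elem f" "b = u * prod_mset F"
    using prime_factorization_exists[OF ab(1)] by blast
  have "\<exists>N c. z * h m ^ N = h c" if "z = h a / h (u * prod_mset F)" "\<And>p. prime_elem p \<Longrightarrow> \<not> p dvd m \<Longrightarrow> z \<in> stalk p"
    for z a using uF(2) that
  proof (induction F arbitrary: z a)
    case empty
    obtain v where "u * v = 1" using uF(1) by (metis dvdE)
    then have v: "h u * h v = 1" by (metis h_1 h_mult)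
    then have "h u \<noteq> 0" by auto
    then have "z = h (a * v)" using v empty by (simp add: h_mult divide_eq_eq mult_ac)
    then have "z * h m ^ 0 = h (a * v)" by simp
    then show ?case by blast
  next
    case (add f F)
    have f: "prime_elem f" using add by simp
    have hf: "h f \<noteq> 0" using f by (simp add: h_eq_0_iff prime_elem_def)
    have z: "z = h a / (h f * h (u * prod_mset F))" using add(3) by (simp add: h_mult mult_ac)
    show ?case
    proof (cases "f dvd m")
      case True
      then obtain t where t: "m = f * t" by auto
      have "z * h m = h (a * t) / h (u * prod_mset F)" unfolding z t using hf by (simp add: h_mult)
      moreover have "z * h m \<in> stalk p" if "prime_elem p" "\<not> p dvd m" for p
        using add(4)[OF that] h_in_stalk[OF that(1)] ring_closedD(4)[OF ring_closed_stalk[OF that(1)]] by blast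
      ultimately obtain N c where "z * h m * h m ^ N = h c" using add(1)[of "z * h m" "a * t"] add(2) by auto
      then have "z * h m ^ Suc N = h c" by (simp add: mult_ac)
      then show ?thesis by blast
    next
      case False
      then obtain x y where xy: "z = h x / h y" "\<not> f dvd y" using add(4)[OF f] unfolding stalk_def by auto
      have "f dvd a"
      proof (cases "u * prod_mset F = 0")
        case True
        then show ?thesis using uF(1) add(2) by auto
      next
        case False
        then have "h (a * y) = h (x * (f * (u * prod_mset F)))"
          using xy(1) not_dvd_nonzero[OF xy(2)] hf unfolding z by (simp add: h_mult frac_eq_eq h_eq_0_iff)
        then have "a * y = f * (x * (u * prod_mset F))" unfolding h_eq_iff by (simp add: mult_ac)
        then have "f dvd a * y" by simp
        then show ?thesis using prime_elem_dvd_mult_iff[OF f] xy(2) by blast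
      qed
      then obtain a' where "a = f * a'" by auto
      then have "z = h a' / h (u * prod_mset F)" unfolding z using hf by (simp add: h_mult)
      then show ?thesis using add(1)[of z a'] add(2,4) by auto
    qed
  qed
  from this[of z a] obtain N c where "z * h m ^ N = h c" using ab(2) uF(3) z by auto
  then show ?thesis by (rule that)
qed

end

section \<open>Characters and charts of a toric surface\<close>

definition pairing :: "int \<times> int \<Rightarrow> int \<times> int \<Rightarrow> int" where
  "pairing m v = fst m * fst v + snd m * snd v"

definition zscale :: "int \<Rightarrow> int \<times> int \<Rightarrow> int \<times> int" where
  "zscale n m = (n * fst m, n * snd m)"

lemma pairing_add: "pairing (m + n) v = pairing m v + pairing n v"
  by (simp add: pairing_def algebra_simps)

lemma pairing_zscale: "pairing (zscale n m) v = n * pairing m v"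
  by (simp add: pairing_def zscale_def algebra_simps)

lemma pairing_0 [simp]: "pairing 0 v = 0"
  by (simp add: pairing_def)

lemma pairing_uminus: "pairing (- m) v = - pairing m v"
  by (simp add: pairing_def)

lemma pairing_diff: "pairing (m - n) v = pairing m v - pairing n v"
  by (simp add: pairing_def algebra_simps)

lemma inner_real_vec: "real_vec m \<bullet> real_vec v = real_of_int (pairing m v)"
  by (simp add: real_vec_def pairing_def)

lemma character_0: "character 0 = 1"
  by (simp add: character_def)

lemma character_add: "character (m + n) = character m * character n"
  by (simp add: character_def power_int_add mult_ac)

lemma character_nonzero [simp]: "character m \<noteq> 0"
  by (simp add: character_def)

lemma character_inverse: "character (- m) * character m = 1"
  by (simp add: character_0 flip: character_add)

lemma character_zscale: "character (zscale n m) = character m powi n"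
  by (simp add: character_def zscale_def power_int_mult_distrib mult.commute[of n] flip: power_int_mult)

interpretation chars: monomial_eval "scalar :: 'k::field \<Rightarrow> 'k ratfun" character
proof
  have *: "to_fract [:[:1:]:] = (1 :: 'k ratfun)" by (metis one_pCons to_fract_1)
  show "scalar 1 = (1 :: 'k ratfun)" by (simp add: scalar_def * del: to_fract_eq_iff)
  show "scalar (x + y) = scalar x + scalar y" "scalar (x * y) = scalar x * scalar y" for x y :: 'k
    by (simp_all add: scalar_def flip: to_fract_add to_fract_mult)
qed (simp_all add: character_0 character_add)

abbreviation chars_eval :: "(int \<times> int \<Rightarrow>\<^sub>0 'k::field) \<Rightarrow> 'k ratfun" where
  "chars_eval \<equiv> mon_eval scalar character"

lemma character_span_eq: "character_span S = chars_eval ` supported S"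
proof (intro equalityI subsetI)
  fix x :: "'a ratfun" assume "x \<in> character_span S"
  then obtain T c where T: "x = (\<Sum>m\<in>T. scalar (c m) * character m)" "finite T" "T \<subseteq> S"
    unfolding character_span_def by auto
  have "x = chars_eval (\<Sum>m\<in>T. single m (c m))"
    unfolding chars.ev_sum T(1) by simp
  moreover have "(\<Sum>m\<in>T. single m (c m)) \<in> supported S"
    by (intro supported_sum supported_single) (use T in auto)
  ultimately show "x \<in> chars_eval ` supported S" by blast
next
  fix x :: "'a ratfun" assume "x \<in> chars_eval ` supported S"
  then obtain f where "x = chars_eval f" "f \<in> supported S" by auto
  then show "x \<in> character_span S"
    unfolding character_span_def mon_eval_def supported_def
    by (intro CollectI exI[of _ "keys f"] exI[of _ "lookup f"]) auto
qed

lemma scalar_monomial: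
  "scalar c * character (int i, int j) = to_fract (monom (monom c i) j :: 'k::field poly poly)"
proof -
  have pw: "to_fract P ^ n = to_fract (P ^ n)" for P :: "'k poly poly" and n
    by (induction n) simp_all
  have const: "[:q:] ^ n = [:q ^ n:]" for q :: "'k poly" and n
    by (induction n) simp_all
  have var: "[:0, 1:] ^ n = monom (1 :: 'r::comm_ring_1) n" for n
    using monom_altdef[of "1 :: 'r" n] unfolding smult_1_left by (rule sym)
  have "scalar c * character (int i, int j) = to_fract ([:[:c:]:] * ([:[:0, 1:]:] ^ i * [:0, 1:] ^ j))"
    by (simp only: scalar_def character_def power_int_of_nat fst_conv snd_conv to_fract_mult pw)
  also have "[:[:c:]:] * ([:[:0, 1:]:] ^ i * [:0, 1:] ^ j) = (monom (monom c i) j :: 'k poly poly)"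
    unfolding const var by (simp add: smult_monom)
  finally show ?thesis .
qed

text \<open>Shifting all exponents by (N, N) turns the Laurent polynomial into a polynomial in x and
  y, whose coefficients can be compared.\<close>

lemma chars_independent:
  assumes "chars_eval f = (0 :: 'k::field ratfun)"
  shows "f = 0"
proof -
  define N where "N = (\<Sum>m\<in>keys f. \<bar>fst m\<bar> + \<bar>snd m\<bar>)"
  have N: "0 \<le> fst m + N" "0 \<le> snd m + N" if "m \<in> keys f" for m
    using member_le_sum[of m "keys f" "\<lambda>m. \<bar>fst m\<bar> + \<bar>snd m\<bar>"] that
    unfolding N_def by auto
  let ?i = "\<lambda>m. nat (fst m + N)" and ?j = "\<lambda>m. nat (snd m + N)"
  let ?P = "\<Sum>m\<in>keys f. monom (monom (lookup f m) (?i m)) (?j m)"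
  have "to_fract ?P = (\<Sum>m\<in>keys f. scalar (lookup f m) * character (m + (N, N)))"
    unfolding to_fract_sum
  proof (rule sum.cong[OF refl])
    fix m assume m: "m \<in> keys f"
    have "m + (N, N) = (int (?i m), int (?j m))" using N[OF m] by (simp add: prod_eq_iff)
    then show "to_fract (monom (monom (lookup f m) (?i m)) (?j m))
        = scalar (lookup f m) * character (m + (N, N))"
      by (simp only: scalar_monomial)
  qed
  also have "\<dots> = chars_eval f * character (N, N)"
    by (simp add: mon_eval_def character_add sum_distrib_right mult.assoc)
  finally have "to_fract ?P = 0" by (simp only: assms mult_zero_left)
  then have P: "?P = 0" by (simp only: to_fract_eq_0_iff)
  have "lookup f m = 0" for m
  proof (rule ccontr)
    assume "lookup f m \<noteq> 0"
    then have m: "m \<in> keys f" by (simp add: in_keys_iff)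
    have eq: "?j m' = ?j m \<and> ?i m' = ?i m \<longleftrightarrow> m' = m" if "m' \<in> keys f" for m'
      using N[OF that] N[OF m] by (auto simp: prod_eq_iff)
    have "0 = coeff (coeff ?P (?j m)) (?i m)" unfolding P by simp
    also have "\<dots> = (\<Sum>m'\<in>keys f. if ?j m' = ?j m \<and> ?i m' = ?i m then lookup f m' else 0)"
      unfolding coeff_sum by (rule sum.cong) auto
    also have "\<dots> = (\<Sum>m'\<in>keys f. if m' = m then lookup f m else 0)"
      by (rule sum.cong) (use eq in auto)
    also have "\<dots> = lookup f m" using m by simp
    finally show False using \<open>lookup f m \<noteq> 0\<close> by simp
  qed
  then show ?thesis by (intro poly_mapping_eqI) simp
qed

lemma chars_eval_inj: "chars_eval f = chars_eval g \<longleftrightarrow> f = g"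
  using chars_independent[of "f - g"] by auto

lemma group_algebra_2_domain: "f * g = 0 \<Longrightarrow> f = 0 \<or> g = (0 :: int \<times> int \<Rightarrow>\<^sub>0 'k::field)"
  using chars.ev_mult[of f g] chars_independent[of f] chars_independent[of g] by auto

lemma chars_eval_mem: "chars_eval f \<in> chars_eval ` supported S \<longleftrightarrow> f \<in> supported S"
  by (auto simp: chars_eval_inj)

lemma ring_closed_chars_eval:
  assumes "0 \<in> S" "\<And>u v. u \<in> S \<Longrightarrow> v \<in> S \<Longrightarrow> u + v \<in> S"
  shows "ring_closed (chars_eval ` (supported S :: (int \<times> int \<Rightarrow>\<^sub>0 'k::field) set))"
proof -
  have mem: "chars_eval f \<in> chars_eval ` T \<longleftrightarrow> f \<in> T" for f :: "int \<times> int \<Rightarrow>\<^sub>0 'k" and T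
    by (auto simp: chars_eval_inj)
  show ?thesis using ring_closed_supported[of S, OF assms, where 'k = 'k] mem[of 1 "supported S"]
    unfolding ring_closed_def by (simp add: mem flip: chars.ev_mult chars.ev_add chars.ev_uminus)
qed

lemma prime_ideal_of_chars_eval:
  fixes B Q :: "(int \<times> int \<Rightarrow>\<^sub>0 'k::field) set"
  assumes "prime_ideal_of B Q"
  shows "prime_ideal_of (chars_eval ` B) (chars_eval ` Q)"
proof -
  have mem: "chars_eval f \<in> chars_eval ` T \<longleftrightarrow> f \<in> T" for f :: "int \<times> int \<Rightarrow>\<^sub>0 'k" and T
    by (auto simp: chars_eval_inj)
  have *: "1 \<in> chars_eval ` T \<longleftrightarrow> 1 \<in> T" "0 \<in> chars_eval ` T \<longleftrightarrow> 0 \<in> T" for T :: "(int \<times> int \<Rightarrow>\<^sub>0 'k) set"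
    using mem[of 1 T] mem[of 0 T] by simp_all
  show ?thesis using assms unfolding prime_ideal_of_def
    by (simp add: * mem image_mono flip: chars.ev_mult chars.ev_add)
qed

section \<open>Affine charts of cones spanned by rays\<close>

definition ray_monoid :: "(int \<times> int) set \<Rightarrow> (int \<times> int) set" where
  "ray_monoid V = {m. \<forall>v\<in>V. 0 \<le> pairing m v}"

text \<open>A half-space bounded by a hyperplane through the origin is a convex cone, so
  nonnegativity on the generators passes to their hull.\<close>

lemma dual_monoid_hull: "dual_monoid (convex_cone hull (real_vec ` V)) = ray_monoid V"
proof (intro equalityI subsetI)
  fix m assume "m \<in> dual_monoid (convex_cone hull (real_vec ` V))"
  then have "0 \<le> real_vec m \<bullet> real_vec v" if "v \<in> V" for v
    using that hull_inc[of "real_vec v" "real_vec ` V" convex_cone] unfolding dual_monoid_def by blast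
  then show "m \<in> ray_monoid V" by (simp add: ray_monoid_def inner_real_vec)
next
  fix m assume m: "m \<in> ray_monoid V"
  have "convex_cone hull (real_vec ` V) \<subseteq> {u. real_vec m \<bullet> u \<ge> 0}"
  proof (rule hull_minimal)
    show "convex_cone {u. real_vec m \<bullet> u \<ge> 0}" by (rule convex_cone_halfspace_ge)
  qed (use m in \<open>auto simp: ray_monoid_def inner_real_vec\<close>)
  then show "m \<in> dual_monoid (convex_cone hull (real_vec ` V))" unfolding dual_monoid_def by blast
qed

definition ray_chart :: "(int \<times> int) set \<Rightarrow> 'k::field ratfun set" where
  "ray_chart V = chars_eval ` supported (ray_monoid V)"

lemma chart_ring_hull: "chart_ring (convex_cone hull (real_vec ` V)) = ray_chart V"
  by (simp add: chart_ring_def dual_monoid_hull character_span_eq ray_chart_def)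

lemma ring_closed_ray_chart: "ring_closed (ray_chart V :: 'k::field ratfun set)"
  unfolding ray_chart_def
  by (rule ring_closed_chars_eval) (auto simp: ray_monoid_def pairing_add)

lemma character_in_chars_eval: "m \<in> S \<Longrightarrow> character m \<in> chars_eval ` supported S"
  using supported_single[of m S 1] chars.ev_single[of m 1] by (metis chars.\<iota>_1 imageI mult_1)

lemma character_mult_chars_eval:
  assumes "x \<in> chars_eval ` supported S" "\<And>k. k \<in> S \<Longrightarrow> m + k \<in> T"
  shows "character m * x \<in> chars_eval ` supported T"
proof -
  obtain f where f: "x = chars_eval f" "f \<in> supported S" using assms(1) by auto
  have "character m * x = chars_eval (single m 1 * f)" by (simp add: f chars.\<iota>_1)
  moreover have "single m 1 * f \<in> supported T"
    by (rule supported_mult[of _ "{m}" _ S]) (use f assms(2) in \<open>auto intro: supported_single\<close>)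
  ultimately show ?thesis by blast
qed

definition ray_ideal :: "int \<times> int \<Rightarrow> 'k::field ratfun set" where
  "ray_ideal v = chars_eval ` supported {m. 0 < pairing m v}"

lemma prime_ideal_ray_ideal: "prime_ideal_of (ray_chart {v}) (ray_ideal v :: 'k::field ratfun set)"
  unfolding ray_chart_def ray_ideal_def
proof (rule prime_ideal_of_chars_eval, rule prime_ideal_of_supported)
  fix f g :: "int \<times> int \<Rightarrow>\<^sub>0 'k" assume "f * g = 0"
  then show "f = 0 \<or> g = 0" by (rule group_algebra_2_domain)
qed (auto simp: ray_monoid_def pairing_add)

lemma ray_divisor_eq: "ray_divisor v = localization (ray_chart {v}) (ray_ideal v)"
proof -
  have hull: "convex_cone hull {real_vec v} = convex_cone hull (real_vec ` {v})" by simp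
  have "{m \<in> ray_monoid {v}. real_vec m \<bullet> real_vec v > 0} = {m. 0 < pairing m v}"
    by (auto simp: ray_monoid_def inner_real_vec)
  then show ?thesis
    unfolding ray_divisor_def Let_def hull chart_ring_hull dual_monoid_hull character_span_eq ray_ideal_def
    by simp
qed

section \<open>Maximal charts as polynomial rings in two variables\<close>

lemma poly_map_poly_pCons:
  fixes f :: "'a::comm_ring_1 \<Rightarrow> 'b::comm_ring_1"
  assumes "f 0 = 0"
  shows "poly (map_poly f (pCons a p)) x = f a + x * poly (map_poly f p) x"
  by (subst Polynomial.map_poly_pCons, rule assms, simp)

lemma poly_map_poly_hom:
  fixes f :: "'a::comm_ring_1 \<Rightarrow> 'b::comm_ring_1"
  assumes "f 1 = 1" "\<And>x y. f (x + y) = f x + f y" "\<And>x y. f (x * y) = f x * f y"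
  shows "poly (map_poly f 1) x = 1"
    "poly (map_poly f (p + q)) x = poly (map_poly f p) x + poly (map_poly f q) x"
    "poly (map_poly f (p * q)) x = poly (map_poly f p) x * poly (map_poly f q) x"
proof -
  have 0: "f 0 = 0" using assms(2)[of 0 0] by simp
  have pC: "poly (map_poly f (pCons a p)) x = f a + x * poly (map_poly f p) x" for a p
    using 0 by (rule poly_map_poly_pCons)
  show "poly (map_poly f 1) x = 1" using pC[of 1 0] assms(1) by simp
  show add: "poly (map_poly f (p + q)) x = poly (map_poly f p) x + poly (map_poly f q) x" for p q
    by (induction p q rule: poly_induct2) (simp_all add: pC assms(2) algebra_simps)
  have smult: "poly (map_poly f (smult a q)) x = f a * poly (map_poly f q) x" for a q
    by (induction q) (simp_all add: pC assms(3) 0 algebra_simps)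
  show "poly (map_poly f (p * q)) x = poly (map_poly f p) x * poly (map_poly f q) x" for p q
    by (induction p) (simp_all add: add smult pC 0 algebra_simps)
qed

lemma poly_map_poly_sum:
  fixes f :: "'a::comm_ring_1 \<Rightarrow> 'b::comm_ring_1"
  assumes "f 0 = 0" "Polynomial.degree p \<le> n"
  shows "poly (map_poly f p) x = (\<Sum>i\<le>n. f (coeff p i) * x ^ i)"
proof -
  have c: "coeff (map_poly f p) i = f (coeff p i)" for i
    by (rule coeff_map_poly) (rule assms(1))
  have d: "Polynomial.degree (map_poly f p) \<le> n"
    by (rule degree_le) (use assms in \<open>auto simp: c coeff_eq_0\<close>)
  have "poly (map_poly f p) x = (\<Sum>i\<le>Polynomial.degree (map_poly f p). coeff (map_poly f p) i * x ^ i)"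
    by (rule Polynomial.poly_altdef)
  also have "\<dots> = (\<Sum>i\<le>n. coeff (map_poly f p) i * x ^ i)"
    by (rule sum.mono_neutral_left) (use d in \<open>auto simp: coeff_eq_0\<close>)
  finally show ?thesis by (simp add: c)
qed

lemma prime_elem_poly_var: "prime_elem ([:0, 1:] :: 'a::idom poly)"
proof -
  have dvd: "[:0, 1:] dvd p \<longleftrightarrow> poly p 0 = 0" for p :: "'a poly"
    using poly_eq_0_iff_dvd[of p 0] by simp
  show ?thesis by (simp only: prime_elem_def dvd) auto
qed

definition chart_inner :: "int \<times> int \<Rightarrow> 'k::field poly \<Rightarrow> 'k ratfun" where
  "chart_inner w' q = poly (map_poly scalar q) (character w')"

text \<open>The outer variable goes to the character of v' and the inner one to that of w'. For a
  dual basis v', w' this identifies the chart with a polynomial ring over a field, and unique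
  factorization becomes available.\<close>

definition chart_hom :: "int \<times> int \<Rightarrow> int \<times> int \<Rightarrow> 'k::field poly poly \<Rightarrow> 'k ratfun" where
  "chart_hom v' w' P = poly (map_poly (chart_inner w') P) (character v')"

lemma chart_inner_hom:
  "chart_inner w' 1 = 1" "chart_inner w' (p + q) = chart_inner w' p + chart_inner w' q"
  "chart_inner w' (p * q) = chart_inner w' p * chart_inner w' q"
  unfolding chart_inner_def
  by (rule poly_map_poly_hom; rule chars.\<iota>_1 chars.\<iota>_add chars.\<iota>_mult)+

lemma chart_hom_hom:
  "chart_hom v' w' 1 = 1" "chart_hom v' w' (P + Q) = chart_hom v' w' P + chart_hom v' w' Q"
  "chart_hom v' w' (P * Q) = chart_hom v' w' P * chart_hom v' w' Q"
  unfolding chart_hom_def by (rule poly_map_poly_hom; rule chart_inner_hom)+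

lemma chart_inner_pCons:
  "chart_inner w' 0 = 0" "chart_inner w' (pCons c q) = scalar c + character w' * chart_inner w' q"
  unfolding chart_inner_def by simp (rule poly_map_poly_pCons, rule chars.\<iota>_0)

lemma chart_hom_pCons:
  "chart_hom v' w' 0 = 0" "chart_hom v' w' (pCons q P) = chart_inner w' q + character v' * chart_hom v' w' P"
  unfolding chart_hom_def by simp (rule poly_map_poly_pCons, rule chart_inner_pCons)

lemma chart_hom_sum:
  fixes P :: "'k::field poly poly"
  assumes "\<And>j. Polynomial.degree (coeff P j) \<le> N"
  shows "chart_hom v' w' P = chars_eval (\<Sum>j\<le>Polynomial.degree P. \<Sum>i\<le>N.
    single (zscale (int j) v' + zscale (int i) w') (coeff (coeff P j) i))"
proof -
  have inner: "chart_inner w' (coeff P j) = (\<Sum>i\<le>N. scalar (coeff (coeff P j) i) * character w' ^ i)" for j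
    unfolding chart_inner_def by (rule poly_map_poly_sum) (rule chars.\<iota>_0, rule assms)
  have "chart_hom v' w' P = (\<Sum>j\<le>Polynomial.degree P. chart_inner w' (coeff P j) * character v' ^ j)"
    unfolding chart_hom_def by (rule poly_map_poly_sum) (rule chart_inner_pCons, rule order.refl)
  also have "\<dots> = chars_eval (\<Sum>j\<le>Polynomial.degree P. \<Sum>i\<le>N.
    single (zscale (int j) v' + zscale (int i) w') (coeff (coeff P j) i))"
    unfolding chars.ev_sum inner
    by (simp add: character_add character_zscale sum_distrib_right sum_distrib_left mult_ac)
  finally show ?thesis .
qed

lemma coeff_degree_bound: "\<exists>N. \<forall>j. Polynomial.degree (coeff P j) \<le> N" for P :: "'k::field poly poly"
proof -
  have "Polynomial.degree (coeff P j) \<le> (\<Sum>j\<le>Polynomial.degree P. Polynomial.degree (coeff P j))" for j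
  proof (cases "j \<le> Polynomial.degree P")
    case True
    then show ?thesis by (intro member_le_sum) auto
  qed (simp add: coeff_eq_0)
  then show ?thesis by blast
qed

lemma chart_hom_scalar: "chart_hom v' w' [:[:c:]:] = scalar c"
  by (simp add: chart_hom_pCons chart_inner_pCons)

lemma chart_hom_vars: "chart_hom v' w' [:0, 1:] = character v'" "chart_hom v' w' [:[:0, 1:]:] = character w'"
  by (simp_all add: chart_hom_pCons chart_inner_pCons chart_inner_hom chart_hom_hom chars.\<iota>_0 chars.\<iota>_1)

lemma ring_closed_chars_eval_UNIV: "ring_closed (range (chars_eval :: _ \<Rightarrow> 'k::field ratfun))"
  using ring_closed_chars_eval[of UNIV, where 'k = 'k] by (simp add: supported_def)

lemma to_fract_chars_eval: "to_fract A \<in> range (chars_eval :: _ \<Rightarrow> 'k::field ratfun)"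
proof (induction A)
  case 0
  then show ?case using ring_closedD(2)[OF ring_closed_chars_eval_UNIV] by simp
next
  case (pCons a A)
  note cl = ring_closedD[OF ring_closed_chars_eval_UNIV]
  have ch: "character m \<in> range (chars_eval :: _ \<Rightarrow> 'k ratfun)" for m
    using character_in_chars_eval[of m UNIV, where 'a = 'k] by (simp add: supported_def)
  have sc: "scalar c \<in> range (chars_eval :: _ \<Rightarrow> 'k ratfun)" for c
    using chars.ev_single[of 0 c] by (metis character_0 mult.right_neutral rangeI)
  have x: "to_fract [:[:0, 1:]:] = (character (1, 0) :: 'k ratfun)" "to_fract [:0, 1:] = (character (0, 1) :: 'k ratfun)"
    by (simp_all add: character_def)
  have inner: "to_fract [:q:] \<in> range (chars_eval :: _ \<Rightarrow> 'k ratfun)" for q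
  proof (induction q)
    case 0
    then show ?case using cl(2) by simp
  next
    case (pCons c q)
    have "[:pCons c q:] = [:[:c:]:] + [:[:0, 1:]:] * [:q:]" by simp
    then have "to_fract [:pCons c q:] = scalar c + character (1, 0) * to_fract [:q:]"
      by (simp only: to_fract_add to_fract_mult x scalar_def)
    then show ?case using cl(3)[OF sc cl(4)[OF ch pCons.IH]] by simp
  qed
  have "pCons a A = [:a:] + [:0, 1:] * A" by simp
  then have "to_fract (pCons a A) = to_fract [:a:] + character (0, 1) * to_fract A"
    by (simp only: to_fract_add to_fract_mult x)
  then show ?case using cl(3)[OF inner cl(4)[OF ch pCons.IH]] by simp
qed

text \<open>A smooth maximal cone: v, w are a lattice basis and v', w' the dual basis. The parameter
  K fixes the coefficient field.\<close>

locale toric_chart =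
  fixes v w v' w' :: "int \<times> int" and K :: "'k::field itself"
  assumes dual: "pairing v' v = 1" "pairing v' w = 0" "pairing w' v = 0" "pairing w' w = 1"
    and basis: "m = zscale (pairing m v) v' + zscale (pairing m w) w'"
begin

abbreviation hom :: "'k poly poly \<Rightarrow> 'k ratfun" where "hom \<equiv> chart_hom v' w'"

lemma pairing_combination:
  "pairing (zscale j v' + zscale i w') v = j" "pairing (zscale j v' + zscale i w') w = i"
  by (simp_all add: pairing_add pairing_zscale dual)

lemma hom_inj:
  assumes "hom P = 0"
  shows "P = 0"
proof -
  obtain N where N: "\<And>j. Polynomial.degree (coeff P j) \<le> N" using coeff_degree_bound by blast
  let ?g = "\<Sum>j\<le>Polynomial.degree P. \<Sum>i\<le>N.
    single (zscale (int j) v' + zscale (int i) w') (coeff (coeff P j) i)"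
  have "chars_eval ?g = 0" using assms chart_hom_sum[OF N, of v' w'] by simp
  then have g: "?g = 0" by (rule chars_independent)
  have eq: "zscale (int j) v' + zscale (int i) w' = zscale (int j0) v' + zscale (int i0) w' \<longleftrightarrow> j = j0 \<and> i = i0"
    for i j i0 j0
    using pairing_combination by (metis int_int_eq)
  have "coeff (coeff P j0) i0 = 0" for i0 j0
  proof (cases "j0 \<le> Polynomial.degree P \<and> i0 \<le> N")
    case True
    have "0 = lookup ?g (zscale (int j0) v' + zscale (int i0) w')" unfolding g by simp
    also have "\<dots> = (\<Sum>j\<le>Polynomial.degree P. \<Sum>i\<le>N. if j = j0 \<and> i = i0 then coeff (coeff P j) i else 0)"
      by (simp add: lookup_sum lookup_single when_def eq cong: if_cong)
    also have "\<dots> = (\<Sum>j\<le>Polynomial.degree P. if j = j0 then coeff (coeff P j) i0 else 0)"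
      by (rule sum.cong) (use True in auto)
    also have "\<dots> = coeff (coeff P j0) i0" using True by simp
    finally show ?thesis by simp
  next
    case False
    then consider "j0 > Polynomial.degree P" | "i0 > N" by linarith
    then show ?thesis
    proof cases
      case 2
      then show ?thesis using N[of j0] by (intro coeff_eq_0) simp
    qed (simp add: coeff_eq_0)
  qed
  then show "P = 0" by (intro poly_eqI) simp
qed

lemma range_hom: "range hom = ray_chart {v, w}"
proof (intro equalityI subsetI)
  fix x assume "x \<in> range hom"
  then obtain P where P: "x = hom P" by auto
  obtain N where N: "\<And>j. Polynomial.degree (coeff P j) \<le> N" using coeff_degree_bound by blast
  show "x \<in> ray_chart {v, w}"
    unfolding P chart_hom_sum[OF N] ray_chart_def
    by (intro imageI supported_sum supported_single) (simp add: ray_monoid_def pairing_combination)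
next
  fix x :: "'k ratfun" assume "x \<in> ray_chart {v, w}"
  then obtain f where f: "x = chars_eval f" "f \<in> supported (ray_monoid {v, w})" unfolding ray_chart_def by auto
  have hp: "hom (P ^ n) = hom P ^ n" for P n by (induction n) (simp_all add: chart_hom_hom)
  have add: "x + y \<in> range hom" if "x \<in> range hom" "y \<in> range hom" for x y
    using that by (auto simp flip: chart_hom_hom(2))
  have zero: "0 \<in> range hom" by (metis chart_hom_pCons(1) rangeI)
  have monomial: "scalar c * character m \<in> range hom" if "m \<in> ray_monoid {v, w}" for c m
  proof -
    have nn: "pairing m v \<ge> 0" "pairing m w \<ge> 0" using that by (auto simp: ray_monoid_def)
    have "(character m :: 'k ratfun) = character v' powi pairing m v * character w' powi pairing m w"
      using basis[of m] character_add character_zscale by metis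
    also have "\<dots> = character v' ^ nat (pairing m v) * character w' ^ nat (pairing m w)"
      using nn by (simp add: power_int_def)
    finally have "scalar c * character m
        = hom ([:[:c:]:] * ([:0, 1:] ^ nat (pairing m v) * [:[:0, 1:]:] ^ nat (pairing m w)))"
      by (simp only: chart_hom_hom hp chart_hom_vars chart_hom_scalar)
    then show ?thesis by blast
  qed
  have "(\<Sum>m\<in>T. scalar (lookup f m) * character m) \<in> range hom" if "T \<subseteq> ray_monoid {v, w}" for T
    using that by (induction T rule: infinite_finite_induct) (auto intro: zero add monomial)
  then show "x \<in> range hom" using f unfolding mon_eval_def supported_def by blast
qed

text \<open>The shifts along v' and w' are separate, so that a direction in which all exponents are
  already nonnegative can be left alone.\<close>

lemma shift_into_cone:
  assumes "finite T"
  obtains N where "N \<ge> 0"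
    "\<And>k N1 N2. k \<in> T \<Longrightarrow> (0 \<le> pairing k v \<or> N1 \<ge> N) \<Longrightarrow> (0 \<le> pairing k w \<or> N2 \<ge> N) \<Longrightarrow> N1 \<ge> 0 \<Longrightarrow> N2 \<ge> 0 \<Longrightarrow>
      zscale N1 v' + zscale N2 w' + k \<in> ray_monoid {v, w}"
proof -
  define N where "N = (\<Sum>k\<in>T. \<bar>pairing k v\<bar> + \<bar>pairing k w\<bar>)"
  have "\<bar>pairing k v\<bar> + \<bar>pairing k w\<bar> \<le> N" if "k \<in> T" for k
    unfolding N_def by (rule member_le_sum) (use that assms in auto)
  moreover have "N \<ge> 0" unfolding N_def by (rule sum_nonneg) simp
  moreover have "zscale N1 v' + zscale N2 w' + k \<in> ray_monoid {v, w}"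
    if "k \<in> T" "0 \<le> pairing k v \<or> N1 \<ge> N" "0 \<le> pairing k w \<or> N2 \<ge> N" "N1 \<ge> 0" "N2 \<ge> 0" for k N1 N2
  proof -
    have "\<bar>pairing k v\<bar> + \<bar>pairing k w\<bar> \<le> N" using \<open>\<And>k. k \<in> T \<Longrightarrow> \<bar>pairing k v\<bar> + \<bar>pairing k w\<bar> \<le> N\<close> that(1) .
    then have "0 \<le> N1 + pairing k v" "0 \<le> N2 + pairing k w" using that by linarith+
    then show ?thesis by (simp add: ray_monoid_def pairing_add pairing_zscale dual)
  qed
  ultimately show ?thesis using that[of N] by blast
qed

lemma hom_fractions: "\<exists>a b. b \<noteq> 0 \<and> z = hom a / hom b"
proof -
  obtain A B where AB: "z = to_fract A / to_fract B" "B \<noteq> 0"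
    by (cases z) (auto simp: Fract_conv_to_fract)
  obtain f g where fg: "to_fract A = chars_eval f" "to_fract B = chars_eval g"
    using to_fract_chars_eval by (metis imageE)
  obtain N where N: "N \<ge> 0" "\<And>k N1 N2. k \<in> keys f \<union> keys g \<Longrightarrow>
      (0 \<le> pairing k v \<or> N1 \<ge> N) \<Longrightarrow> (0 \<le> pairing k w \<or> N2 \<ge> N) \<Longrightarrow> N1 \<ge> 0 \<Longrightarrow> N2 \<ge> 0 \<Longrightarrow>
      zscale N1 v' + zscale N2 w' + k \<in> ray_monoid {v, w}"
    by (rule shift_into_cone[of "keys f \<union> keys g"]) auto
  let ?m = "zscale N v' + zscale N w'"
  have mem: "character ?m * chars_eval e \<in> range hom"
    if "keys e \<subseteq> keys f \<union> keys g" for e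
    unfolding range_hom ray_chart_def
    by (rule character_mult_chars_eval[of _ "keys e"]) (use that N in \<open>auto simp: supported_def\<close>)
  obtain a b where ab: "character ?m * chars_eval f = hom a" "character ?m * chars_eval g = hom b"
    using mem[of f] mem[of g] by auto
  have "hom b \<noteq> 0" using AB(2) unfolding ab(2)[symmetric] fg(2)[symmetric] by simp
  then have "b \<noteq> 0" using chart_hom_pCons(1) by metis
  moreover have "z = hom a / hom b"
    unfolding AB(1) fg ab[symmetric] by simp
  ultimately show ?thesis by blast
qed

sublocale ufd_embedding hom
proof
  show "hom 1 = 1" "hom (x + y) = hom x + hom y" "hom (x * y) = hom x * hom y" for x y
    by (rule chart_hom_hom)+
  show "x = 0" if "hom x = 0" for x using that by (rule hom_inj)
  show "\<exists>a b. b \<noteq> 0 \<and> z = hom a / hom b" for z by (rule hom_fractions)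
qed

lemma swap: "toric_chart w v w' v'"
  using dual basis by unfold_locales (metis add.commute)+

lemma character_in_ray_chart: "m \<in> ray_monoid I \<Longrightarrow> character m \<in> ray_chart I"
  unfolding ray_chart_def by (rule character_in_chars_eval)

text \<open>The chart of a face is the maximal chart with some characters inverted: multiplying by
  the character of m clears the negative exponents, and this character is a unit on the
  face.\<close>

lemma chart_shift:
  assumes "x \<in> (ray_chart I :: 'k ratfun set)" "I \<subseteq> {v, w}"
  obtains m where "m \<in> ray_monoid {v, w}" "- m \<in> ray_monoid I" "character m * x \<in> range hom"
proof -
  obtain f where f: "x = chars_eval f" "f \<in> supported (ray_monoid I)" using assms(1) unfolding ray_chart_def by auto
  obtain N where N: "N \<ge> 0" "\<And>k N1 N2. k \<in> keys f \<Longrightarrow>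
      (0 \<le> pairing k v \<or> N1 \<ge> N) \<Longrightarrow> (0 \<le> pairing k w \<or> N2 \<ge> N) \<Longrightarrow> N1 \<ge> 0 \<Longrightarrow> N2 \<ge> 0 \<Longrightarrow>
      zscale N1 v' + zscale N2 w' + k \<in> ray_monoid {v, w}"
    by (rule shift_into_cone[of "keys f"]) auto
  \<comment> \<open>Only rays outside I are shifted, so \<open>?m\<close> pairs to 0 with the rays
    in I.\<close>
  let ?N1 = "if v \<in> I then 0 else N" and ?N2 = "if w \<in> I then 0 else N"
  let ?m = "zscale ?N1 v' + zscale ?N2 w'"
  have "v \<noteq> w" using dual by auto
  show ?thesis
  proof (rule that[of ?m])
    show "?m \<in> ray_monoid {v, w}" using N(1) by (simp add: ray_monoid_def pairing_combination)
    show "- ?m \<in> ray_monoid I"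
      unfolding ray_monoid_def
    proof (intro CollectI ballI)
      fix u assume "u \<in> I"
      then consider "u = v" "v \<in> I" | "u = w" "w \<in> I" using assms(2) by auto
      then show "0 \<le> pairing (- ?m) u"
        by cases (simp_all only: pairing_uminus pairing_combination if_True minus_zero order.refl)
    qed
    show "character ?m * x \<in> range hom"
      unfolding range_hom ray_chart_def
    proof (rule character_mult_chars_eval[of _ "keys f"])
      show "x \<in> chars_eval ` supported (keys f)" using f(1) by (auto simp: supported_def)
      fix k assume k: "k \<in> keys f"
      then have "k \<in> ray_monoid I" using f(2) by (auto simp: supported_def)
      then show "?m + k \<in> ray_monoid {v, w}" by (intro N(2)[OF k]) (use N(1) in \<open>auto simp: ray_monoid_def\<close>)
    qed
  qed
qed

lemma range_hom_subset: "I \<subseteq> {v, w} \<Longrightarrow> range hom \<subseteq> ray_chart I"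
  unfolding range_hom ray_chart_def by (intro image_mono) (auto simp: supported_def ray_monoid_def)

text \<open>Every point of the chart of a face is a point of the maximal chart. Characters that are
  units on the face avoid P, so multiplying numerator and denominator by them moves both into the
  factorial chart without changing the local ring.\<close>

lemma localization_ray_chart:
  assumes I: "I \<subseteq> {v, w}" and P: "prime_ideal_of (ray_chart I :: 'k ratfun set) P"
  shows "prime_ideal_of (range hom) (P \<inter> range hom)"
    and "localization (ray_chart I) P = localization (range hom) (P \<inter> range hom)"
proof -
  note sub = range_hom_subset[OF I]
  note clB = ring_closedD[OF ring_closed_range]
  note clA = ring_closedD[OF ring_closed_ray_chart[of I, where 'k = 'k]]
  have PD: "P \<subseteq> ray_chart I" "0 \<in> P" "1 \<notin> P" "\<And>x y. x \<in> P \<Longrightarrow> y \<in> P \<Longrightarrow> x + y \<in> P"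
    "\<And>x y. x \<in> ray_chart I \<Longrightarrow> y \<in> P \<Longrightarrow> x * y \<in> P"
    "\<And>x y. x \<in> ray_chart I \<Longrightarrow> y \<in> ray_chart I \<Longrightarrow> x * y \<in> P \<Longrightarrow> x \<in> P \<or> y \<in> P"
    using P unfolding prime_ideal_of_def by auto
  show "prime_ideal_of (range hom) (P \<inter> range hom)"
    unfolding prime_ideal_of_def
  proof (intro conjI ballI impI)
    fix x y assume "x \<in> range hom" "y \<in> range hom" "x * y \<in> P \<inter> range hom"
    then show "x \<in> P \<inter> range hom \<or> y \<in> P \<inter> range hom" using PD(6) sub by blast
  next
    fix x y assume "x \<in> range hom" "y \<in> P \<inter> range hom"
    then show "x * y \<in> P \<inter> range hom" using PD(5)[of x y] sub clB(4)[of x y] by blast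
  qed (use PD(2,3,4) clB(2,3) in auto)
  show "localization (ray_chart I) P = localization (range hom) (P \<inter> range hom)"
  proof (intro equalityI subsetI)
    fix z assume "z \<in> localization (ray_chart I) P"
    then obtain x y where xy: "z = x / y" "x \<in> ray_chart I" "y \<in> ray_chart I" "y \<notin> P"
      unfolding localization_def by auto
    obtain m where m: "m \<in> ray_monoid {v, w}" "- m \<in> ray_monoid I" "character m * x \<in> range hom"
      using chart_shift[OF xy(2) I] by blast
    obtain n where n: "n \<in> ray_monoid {v, w}" "- n \<in> ray_monoid I" "character n * y \<in> range hom"
      using chart_shift[OF xy(3) I] by blast
    have ch: "character k \<in> range hom" if "k \<in> ray_monoid {v, w}" for k
      unfolding range_hom using that by (rule character_in_ray_chart)
    have unit: "character k \<notin> P" if "- k \<in> ray_monoid I" for k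
    proof
      assume "character k \<in> P"
      then have "character (- k) * character k \<in> P" using PD(5) character_in_ray_chart[OF that] by blast
      then show False using PD(3) by (simp add: character_inverse)
    qed
    let ?x = "character n * (character m * x)" and ?y = "character m * (character n * y)"
    have "?x \<in> range hom" "?y \<in> range hom" using clB(4) ch m n by blast+
    moreover have "?y \<notin> P"
    proof
      assume "?y \<in> P"
      then have "character m \<in> P \<or> character n \<in> P \<or> y \<in> P"
        using PD(6)[of "character m" "character n * y"] PD(6)[of "character n" y] ch m n xy(3) sub by blast
      then show False using unit m n xy(4) by blast
    qed
    moreover have "z = ?x / ?y" unfolding xy(1) by simp
    ultimately show "z \<in> localization (range hom) (P \<inter> range hom)" unfolding localization_def by blast
  next
    fix z assume "z \<in> localization (range hom) (P \<inter> range hom)"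
    then show "z \<in> localization (ray_chart I) P" unfolding localization_def using sub by blast
  qed
qed

lemma prime_elem_v: "prime_elem ([:0, 1:] :: 'k poly poly)"
  by (rule prime_elem_poly_var)

lemma hom_character_power: "hom ([:0, 1:] ^ n) = character (zscale (int n) v')"
  by (simp only: h_power chart_hom_vars character_zscale power_int_of_nat)

text \<open>Since v' pairs to 1 with v and to 0 with w, dividing by its character takes exponents
  with positive pairing with v back into the chart.\<close>

lemma ray_ideal_principal: "ray_ideal v \<inter> range hom = principal [:0, 1:]"
proof (intro equalityI subsetI)
  fix x assume "x \<in> ray_ideal v \<inter> range hom"
  then have "x \<in> chars_eval ` supported {m. 0 < pairing m v}" "x \<in> chars_eval ` supported (ray_monoid {v, w})"
    unfolding ray_ideal_def range_hom ray_chart_def by auto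
  then obtain f g where fg: "x = chars_eval f" "f \<in> supported {m. 0 < pairing m v}"
    "x = chars_eval g" "g \<in> supported (ray_monoid {v, w})" by blast
  then have "g = f" by (simp add: chars_eval_inj)
  then have f: "x \<in> chars_eval ` supported {m. 0 < pairing m v \<and> 0 \<le> pairing m w}"
    using fg by (auto simp: supported_def ray_monoid_def)
  have "character (- v') * x \<in> range hom"
    unfolding range_hom ray_chart_def
    by (rule character_mult_chars_eval[OF f]) (use dual in \<open>auto simp: ray_monoid_def pairing_diff\<close>)
  then obtain t where t: "character (- v') * x = hom t" by auto
  have "x = (character v' * character (- v')) * x" by (simp add: character_inverse mult.commute[of "character v'"])
  also have "\<dots> = hom ([:0, 1:] * t)" by (simp only: mult.assoc t h_mult chart_hom_vars)
  finally show "x \<in> principal [:0, 1:]" unfolding principal_def using dvd_triv_left by blast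
next
  fix x assume "x \<in> principal [:0, 1:]"
  then obtain t where t: "x = hom ([:0, 1:] * t)" by (auto simp: principal_def)
  have "hom t \<in> chars_eval ` supported (ray_monoid {v, w})" using range_hom unfolding ray_chart_def by blast
  then have "character v' * hom t \<in> ray_ideal v"
    unfolding ray_ideal_def
    by (rule character_mult_chars_eval) (auto simp: ray_monoid_def pairing_add dual)
  moreover have "x = character v' * hom t" unfolding t by (simp only: h_mult chart_hom_vars)
  ultimately show "x \<in> ray_ideal v \<inter> range hom" using t by blast
qed

lemma ray_divisor_stalk: "ray_divisor v = stalk [:0, 1:]"
  unfolding ray_divisor_eq
  using localization_ray_chart(2)[OF _ prime_ideal_ray_ideal] ray_ideal_principal localization_principal by simp

text \<open>The order along a ray divisor is the least pairing of an exponent with v. If all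
  pairings are at least k, a shift by k makes the element regular. Conversely, in the polynomial
  chart the order is the exact power of the outer variable, and splitting off that power bounds
  every exponent from below.\<close>

lemma vanishing_order_ray:
  assumes "chars_eval f \<noteq> (0 :: 'k ratfun)"
  shows "k \<le> vanishing_order (ray_divisor v) (chars_eval f) \<longleftrightarrow> (\<forall>m\<in>keys f. k \<le> pairing m v)"
proof -
  note p = prime_elem_v
  have ord_v': "vanishing_order (ray_divisor v) (character (zscale n v') :: 'k ratfun) = n" for n
    unfolding ray_divisor_stalk character_zscale using vanishing_order_uniformizer_power[OF p]
    by (simp only: chart_hom_vars)
  have ord_shift: "vanishing_order (ray_divisor v) (character (zscale n v') * x) = n + vanishing_order (ray_divisor v) x"
    if "x \<noteq> 0" for n and x :: "'k ratfun"
    using vanishing_order_mult[OF p character_nonzero that] ord_v' unfolding ray_divisor_stalk by simp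
  show ?thesis
  proof
    assume *: "\<forall>m\<in>keys f. k \<le> pairing m v"
    have "character (zscale (- k) v') * chars_eval f \<in> ray_chart {v}"
      unfolding ray_chart_def
      by (rule character_mult_chars_eval[of _ "keys f"])
         (use * in \<open>auto simp: supported_def ray_monoid_def pairing_add pairing_zscale dual\<close>)
    moreover have "1 \<in> ray_chart {v} - (ray_ideal v :: 'k ratfun set)"
      using ring_closedD(1)[OF ring_closed_ray_chart[of "{v}", where 'k = 'k]]
        prime_ideal_ray_ideal[of v, where 'k = 'k] unfolding prime_ideal_of_def by blast
    ultimately have "character (zscale (- k) v') * chars_eval f / 1 \<in> ray_divisor v"
      unfolding ray_divisor_eq localization_def by blast
    then have "0 \<le> vanishing_order (ray_divisor v) (character (zscale (- k) v') * chars_eval f)"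
      using vanishing_order_nonneg_iff[OF p] character_nonzero assms unfolding ray_divisor_stalk by simp
    then show "k \<le> vanishing_order (ray_divisor v) (chars_eval f)" using ord_shift[OF assms, of "- k"] by simp
  next
    assume k: "k \<le> vanishing_order (ray_divisor v) (chars_eval f)"
    obtain N where N: "N \<ge> 0" "\<And>j N1 N2. j \<in> keys f \<Longrightarrow>
      (0 \<le> pairing j v \<or> N1 \<ge> N) \<Longrightarrow> (0 \<le> pairing j w \<or> N2 \<ge> N) \<Longrightarrow> N1 \<ge> 0 \<Longrightarrow> N2 \<ge> 0 \<Longrightarrow>
      zscale N1 v' + zscale N2 w' + j \<in> ray_monoid {v, w}"
      by (rule shift_into_cone[of "keys f"]) auto
    define N1 where "N1 = N + \<bar>k\<bar>"
    let ?m = "zscale N1 v' + zscale N w'"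
    have "character ?m * chars_eval f \<in> range hom"
      unfolding range_hom ray_chart_def
      by (rule character_mult_chars_eval[of _ "keys f"])
         (use N in \<open>auto simp: supported_def N1_def\<close>)
    then obtain G where G: "character ?m * chars_eval f = hom G" by auto
    then have G0: "hom G \<noteq> 0" using assms character_nonzero[of ?m] by (metis mult_eq_0_iff)
    then obtain i G' where G': "G = [:0, 1:] ^ i * G'" "\<not> [:0, 1:] dvd G'"
      using prime_elem_power_decomp[OF p, of G] h_0 by metis
    \<comment> \<open>The inner variable is not divisible by the outer one, so shifts along w' leave
      the order along v unchanged.\<close>
    have w_unit: "character (zscale n w') \<in> stalk_units [:0, 1:]" for n
    proof -
      have "\<not> [:0, 1:] dvd [:[:0, 1 :: 'k:]:]" using poly_eq_0_iff_dvd[of "[:[:0, 1 :: 'k:]:]" 0] by simp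
      moreover have "\<not> [:0, 1:] dvd (1 :: 'k poly poly)" using p by (simp add: prime_elem_def)
      ultimately have "hom [:[:0, 1:]:] / hom 1 \<in> stalk_units [:0, 1:]" unfolding stalk_units_def by blast
      then have "character w' \<in> stalk_units [:0, 1:]" by (simp only: chart_hom_vars h_1 div_by_1)
      then show ?thesis unfolding character_zscale by (rule stalk_units_power_int[OF p])
    qed
    have u: "hom G' \<in> stalk_units [:0, 1:]"
    proof -
      have "hom G' / hom 1 \<in> stalk_units [:0, 1:]"
        unfolding stalk_units_def using G'(2) p by (auto simp: prime_elem_def)
      then show ?thesis by (simp only: h_1 div_by_1)
    qed
    have "hom G = hom [:0, 1:] powi int i * hom G'" unfolding G'(1) by (simp only: h_mult h_power power_int_of_nat)
    then have "vanishing_order (stalk [:0, 1:]) (hom G) = int i"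
      by (simp only: vanishing_order_stalk[OF p u])
    moreover have "character ?m * chars_eval f = character (zscale N1 v') * (character (zscale N w') * chars_eval f)"
      by (simp add: character_add mult.assoc)
    then have "vanishing_order (ray_divisor v) (hom G)
        = N1 + (vanishing_order (ray_divisor v) (character (zscale N w') :: 'k ratfun) + vanishing_order (ray_divisor v) (chars_eval f))"
      using ord_shift[of "character (zscale N w') * chars_eval f" N1] G assms character_nonzero
        vanishing_order_mult[OF p character_nonzero assms] unfolding ray_divisor_stalk by simp
    moreover have "vanishing_order (ray_divisor v) (character (zscale N w') :: 'k ratfun) = 0"
      unfolding ray_divisor_stalk by (rule vanishing_order_unit[OF p w_unit])
    ultimately have i: "int i \<ge> N1 + k" using k unfolding ray_divisor_stalk by simp
    have "hom G' \<in> chars_eval ` supported (ray_monoid {v, w})" using range_hom unfolding ray_chart_def by blast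
    then have "character (zscale (int i - N1) v' + zscale (- N) w') * hom G' \<in> chars_eval ` supported {m. k \<le> pairing m v}"
      by (rule character_mult_chars_eval) (use i in \<open>auto simp: ray_monoid_def pairing_add[of "zscale _ _ + zscale _ _"] pairing_combination\<close>)
    moreover have "character (zscale (int i - N1) v' + zscale (- N) w') * hom G' = chars_eval f"
    proof -
      have "character (- ?m) * (character ?m * chars_eval f) = chars_eval f"
        by (simp only: mult.assoc[symmetric] character_inverse mult_1)
      then have "chars_eval f = character (- ?m) * (character (zscale (int i) v') * hom G')"
        unfolding G G'(1) by (simp only: h_mult hom_character_power)
      moreover have "- ?m + zscale (int i) v' = zscale (int i - N1) v' + zscale (- N) w'"
        by (simp add: zscale_def prod_eq_iff algebra_simps)
      ultimately show ?thesis by (metis character_add mult.assoc)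
    qed
    ultimately have "f \<in> supported {m. k \<le> pairing m v}" using chars_eval_mem by metis
    then show "\<forall>m\<in>keys f. k \<le> pairing m v" by (auto simp: supported_def)
  qed
qed

end

section \<open>Codimension one points of a chart\<close>

context toric_chart
begin

lemma character_stalk_units:
  assumes p: "prime_elem p" and "character v' \<in> stalk_units p" "character w' \<in> stalk_units p"
  shows "character m \<in> stalk_units p"
proof -
  have "(character m :: 'k ratfun) = character v' powi pairing m v * character w' powi pairing m w"
    using basis[of m] character_add character_zscale by metis
  then show ?thesis
    using stalk_units_mult[OF p stalk_units_power_int[OF p assms(2)] stalk_units_power_int[OF p assms(3)]] by simp
qed

lemma hom_unit:
  assumes p: "prime_elem p" and "\<not> p dvd r"
  shows "hom r \<in> stalk_units p"
proof -
  have "hom r / hom 1 \<in> stalk_units p"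
    unfolding stalk_units_def using assms by (auto simp: prime_elem_def)
  then show ?thesis by (simp only: h_1 div_by_1)
qed

text \<open>The three alternatives are that p divides the outer variable, the inner variable or
  neither. In the last case every character is a unit at the point, which therefore lies in the
  torus.\<close>

lemma codim_one_localization:
  assumes I: "I \<subseteq> {v, w}" and P: "prime_ideal_of (ray_chart I :: 'k ratfun set) P"
    and dim: "krull_dim (localization (ray_chart I) P) = 1"
  obtains p where "prime_elem p" "localization (ray_chart I) P = stalk p"
    "stalk p = ray_divisor v \<or> stalk p = ray_divisor w \<or> (\<forall>m. character m \<in> stalk_units p)"
proof -
  interpret swap: toric_chart w v w' v' K by (rule swap)
  note loc = localization_ray_chart[OF I P]
  have rng: "range swap.hom = range hom" unfolding swap.range_hom range_hom by (simp add: insert_commute)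
  have dim': "krull_dim (localization (range hom) (P \<inter> range hom)) = 1" using dim loc(2) by simp
  note unique = codim_one_prime_ideal(2)[OF loc(1) dim']
  obtain p where p: "prime_elem p" "P \<inter> range hom = principal p"
    using codim_one_prime_ideal(1)[OF loc(1) dim'] by (elim exE conjE)
  have E: "localization (ray_chart I) P = stalk p" using loc(2) p(2) localization_principal by simp
  have "stalk p = ray_divisor v \<or> stalk p = ray_divisor w \<or> (\<forall>m. character m \<in> stalk_units p)"
  proof (cases "p dvd [:0, 1:]")
    case True
    then have "hom [:0, 1:] \<in> P \<inter> range hom" unfolding p(2) h_in_principal .
    then have "P \<inter> range hom = principal [:0, 1:]" by (rule unique[OF prime_elem_v])
    then have "stalk p = stalk [:0, 1:]" using p(2) localization_principal by metis
    then show ?thesis unfolding ray_divisor_stalk by simp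
  next
    case False
    show ?thesis
    proof (cases "p dvd [:[:0, 1:]:]")
      case True
      then have "hom [:[:0, 1:]:] \<in> P \<inter> range hom" unfolding p(2) h_in_principal .
      \<comment> \<open>The inner variable of this chart is the outer variable of the swapped chart,
        which has the same range.\<close>
      then have "swap.hom [:0, 1:] \<in> P \<inter> range swap.hom" by (simp only: chart_hom_vars rng)
      then have "P \<inter> range swap.hom = swap.principal [:0, 1:]"
      proof (rule swap.codim_one_prime_ideal(2)[rotated 3])
        show "prime_ideal_of (range swap.hom) (P \<inter> range swap.hom)" using loc(1) unfolding rng .
        show "krull_dim (localization (range swap.hom) (P \<inter> range swap.hom)) = 1" using dim' unfolding rng .
      qed (rule swap.prime_elem_v)
      then have "stalk p = swap.stalk [:0, 1:]"
        using p(2) localization_principal swap.localization_principal rng by metis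
      then show ?thesis unfolding swap.ray_divisor_stalk by simp
    next
      case False': False
      have "character v' \<in> stalk_units p" "character w' \<in> stalk_units p"
        using hom_unit[OF p(1) False] hom_unit[OF p(1) False'] by (simp_all only: chart_hom_vars)
      then show ?thesis using character_stalk_units[OF p(1)] by blast
    qed
  qed
  then show ?thesis by (rule that[OF p(1) E])
qed

lemma krull_dim_ray_divisor: "krull_dim (ray_divisor v :: 'k ratfun set) = 1"
  unfolding ray_divisor_stalk by (rule krull_dim_stalk[OF prime_elem_v])

lemma vanishing_order_ray_character: "vanishing_order (ray_divisor v) (character m :: 'k ratfun) = pairing m v"
proof -
  have ev: "(character m :: 'k ratfun) = chars_eval (single m 1)" by (simp add: chars.\<iota>_1)
  have "k \<le> vanishing_order (ray_divisor v) (character m :: 'k ratfun) \<longleftrightarrow> k \<le> pairing m v" for k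
    using vanishing_order_ray[of "single m 1" k] unfolding ev[symmetric] by simp
  then show ?thesis by (metis order.antisym order.refl)
qed

lemma stalk_not_ray_divisor:
  assumes "prime_elem p" "\<And>m. character m \<in> stalk_units p" "stalk p = ray_divisor u"
    and "\<And>m. vanishing_order (ray_divisor u) (character m :: 'k ratfun) = pairing m u"
  shows "u = 0"
proof -
  have "pairing m u = 0" for m using vanishing_order_unit[OF assms(1,2)] assms(3,4) by metis
  from this[of "(1, 0)"] this[of "(0, 1)"] show "u = 0" by (simp add: pairing_def prod_eq_iff)
qed

lemma chars_eval_in_stalk:
  assumes p: "prime_elem p" and "\<And>m. character m \<in> stalk_units p"
  shows "chars_eval f \<in> (stalk p :: 'k ratfun set)"
proof -
  note cl = ring_closedD[OF ring_closed_stalk[OF p]]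
  have "scalar c * character m \<in> stalk p" for c m
  proof (rule cl(4))
    show "scalar c \<in> stalk p" using h_in_stalk[OF p, of "[:[:c:]:]"] by (simp only: chart_hom_scalar)
    show "character m \<in> stalk p" using assms(2)[of m] stalk_units_eq[OF p] by auto
  qed
  then show ?thesis unfolding mon_eval_def
  proof -
    have "(\<Sum>m\<in>T. scalar (lookup f m) * character m) \<in> stalk p" for T
      by (induction T rule: infinite_finite_induct) (use cl \<open>\<And>c m. scalar c * character m \<in> stalk p\<close> in auto)
    then show "(\<Sum>m\<in>keys f. scalar (lookup f m) * character m) \<in> stalk p" .
  qed
qed

end

section \<open>Divisors on the Hirzebruch surface\<close>

text \<open>Each entry lists two consecutive rays and their dual basis. Every ray comes first
  exactly once, so facts about the divisor of v in \<open>toric_chart\<close> cover all four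
  rays.\<close>

definition hirzebruch_chart :: "int \<Rightarrow> (int \<times> int) \<Rightarrow> (int \<times> int) \<Rightarrow> (int \<times> int) \<Rightarrow> (int \<times> int) \<Rightarrow> bool" where
  "hirzebruch_chart a v w v' w' \<longleftrightarrow> (v, w, v', w') \<in>
     {((1, 0), (0, 1), (1, 0), (0, 1)), ((0, 1), (-1, a), (a, 1), (-1, 0)),
      ((-1, a), (0, -1), (-1, 0), (-a, -1)), ((0, -1), (1, 0), (0, -1), (1, 0))}"

definition hirzebruch_rays :: "int \<Rightarrow> (int \<times> int) set" where
  "hirzebruch_rays a = {(1, 0), (0, 1), (-1, a), (0, -1)}"

lemma toric_chart_hirzebruch: "hirzebruch_chart a v w v' w' \<Longrightarrow> toric_chart v w v' w'"
  unfolding hirzebruch_chart_def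
  by (auto simp: toric_chart_def pairing_def zscale_def prod_eq_iff algebra_simps)

lemma hirzebruch_chart_ray:
  assumes "v \<in> hirzebruch_rays a"
  obtains w v' w' where "hirzebruch_chart a v w v' w'"
  using assms that unfolding hirzebruch_rays_def hirzebruch_chart_def by auto

lemma hirzebruch_chart_rays: "hirzebruch_chart a v w v' w' \<Longrightarrow> v \<in> hirzebruch_rays a \<and> w \<in> hirzebruch_rays a"
  unfolding hirzebruch_rays_def hirzebruch_chart_def by auto

lemma hirzebruch_charts:
  "hirzebruch_chart a (1, 0) (0, 1) (1, 0) (0, 1)" "hirzebruch_chart a (0, 1) (-1, a) (a, 1) (-1, 0)"
  "hirzebruch_chart a (-1, a) (0, -1) (-1, 0) (-a, -1)" "hirzebruch_chart a (0, -1) (1, 0) (0, -1) (1, 0)"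
  by (simp_all add: hirzebruch_chart_def)

lemma hirzebruch_faces:
  "I \<in> {{}, {(1, 0)}, {(0, 1)}, {(-1, a)}, {(0, -1)}, {(1, 0), (0, 1)}, {(0, 1), (-1, a)}, {(-1, a), (0, -1)},
     {(0, -1), (1, 0)}} \<longleftrightarrow> (\<exists>v w v' w'. hirzebruch_chart a v w v' w' \<and> I \<subseteq> {v, w})"
  (is "I \<in> ?S \<longleftrightarrow> ?R")
proof
  assume "I \<in> ?S"
  then have "I \<subseteq> {(1, 0), (0, 1)} \<or> I \<subseteq> {(0, 1), (-1, a)} \<or> I \<subseteq> {(-1, a), (0, -1)} \<or> I \<subseteq> {(0, -1), (1, 0)}"
    by auto
  moreover have ?R if "hirzebruch_chart a v w v' w'" "I \<subseteq> {v, w}" for v w v' w'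
    using that by (intro exI conjI)
  note chart = this
  ultimately show ?R
    using chart[OF hirzebruch_charts(1)] chart[OF hirzebruch_charts(2)] chart[OF hirzebruch_charts(3)]
      chart[OF hirzebruch_charts(4)] by (elim disjE)
next
  assume ?R
  then obtain v w v' w' where *: "hirzebruch_chart a v w v' w'" "I \<subseteq> {v, w}" by (elim exE conjE)
  from *(2) have I: "I = {} \<or> I = {v} \<or> I = {w} \<or> I = {v, w}" by blast
  from *(1) have "v = (1, 0) \<and> w = (0, 1) \<or> v = (0, 1) \<and> w = (-1, a) \<or> v = (-1, a) \<and> w = (0, -1) \<or> v = (0, -1) \<and> w = (1, 0)"
    unfolding hirzebruch_chart_def by auto
  then show "I \<in> ?S" using I by (elim disjE conjE) simp_all
qed

lemma setcompr_image:
  "{f s P | s P. s \<in> g ` S \<and> Q s P} = {f (g J) P | J P. J \<in> S \<and> Q (g J) P}"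
  by blast

lemma hirzebruch_eq:
  "hirzebruch a = {localization (ray_chart I) P | I P.
     (\<exists>v w v' w'. hirzebruch_chart a v w v' w' \<and> I \<subseteq> {v, w}) \<and> prime_ideal_of (ray_chart I) P}"
proof -
  have "hirzebruch_fan a = (\<lambda>I. convex_cone hull (real_vec ` I)) `
      {{}, {(1, 0)}, {(0, 1)}, {(-1, a)}, {(0, -1)}, {(1, 0), (0, 1)}, {(0, 1), (-1, a)}, {(-1, a), (0, -1)},
        {(0, -1), (1, 0)}}"
    unfolding hirzebruch_fan_def by (simp add: hirzebruch_ray_def)
  then show ?thesis
    unfolding hirzebruch_def toric_variety_def
    by (simp only: setcompr_image chart_ring_hull primeideal_subring_record[OF ring_closed_ray_chart] hirzebruch_faces)
qed

text \<open>Moves a prime divisor into a factorial chart, where orders can be computed, and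
  separates the ray divisors from those meeting the torus.\<close>

lemma prime_divisor_cases:
  fixes E :: "'k::field ratfun set"
  assumes "E \<in> prime_divisors (hirzebruch a)"
  obtains v w v' w' p where "toric_chart v w v' w'" "prime_elem p"
    "E = ufd_embedding.stalk (chart_hom v' w') p"
    "E \<in> ray_divisor ` hirzebruch_rays a \<or> (\<forall>m. character m \<in> ufd_embedding.stalk_units (chart_hom v' w') p)"
proof -
  obtain I P v w v' w' where *: "E = localization (ray_chart I) P" "hirzebruch_chart a v w v' w'" "I \<subseteq> {v, w}"
    "prime_ideal_of (ray_chart I) P" and dim: "krull_dim E = 1"
    using assms unfolding prime_divisors_def hirzebruch_eq by blast
  interpret toric_chart v w v' w' "TYPE('k)" by (rule toric_chart_hirzebruch[OF *(2)])
  have dim': "krull_dim (localization (ray_chart I) P) = 1" using dim *(1) by simp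
  obtain p where p: "prime_elem p" "localization (ray_chart I) P = stalk p"
    "stalk p = ray_divisor v \<or> stalk p = ray_divisor w \<or> (\<forall>m. character m \<in> stalk_units p)"
    by (rule codim_one_localization[OF *(3,4) dim'])
  have E: "E = stalk p" using *(1) p(2) by simp
  have rays: "v \<in> hirzebruch_rays a" "w \<in> hirzebruch_rays a" using hirzebruch_chart_rays[OF *(2)] by simp_all
  have "E \<in> ray_divisor ` hirzebruch_rays a \<or> (\<forall>m. character m \<in> stalk_units p)"
    using p(3) imageI[OF rays(1), of ray_divisor] imageI[OF rays(2), of ray_divisor] unfolding E by metis
  then show ?thesis by (rule that[OF toric_chart_axioms p(1) E])
qed

lemma vanishing_order_mult_prime_divisor:
  fixes x y :: "'k::field ratfun"
  assumes "E \<in> prime_divisors (hirzebruch a)" "x \<noteq> 0" "y \<noteq> 0"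
  shows "vanishing_order E (x * y) = vanishing_order E x + vanishing_order E y"
    and "vanishing_order E (x powi n) = n * vanishing_order E x"
proof -
  obtain v w v' w' p where *: "toric_chart v w v' w'" "prime_elem p" "E = ufd_embedding.stalk (chart_hom v' w') p"
    using prime_divisor_cases[OF assms(1)] by metis
  interpret toric_chart v w v' w' "TYPE('k)" by (rule *(1))
  show "vanishing_order E (x * y) = vanishing_order E x + vanishing_order E y"
    unfolding *(3) by (rule vanishing_order_mult[OF *(2) assms(2,3)])
  show "vanishing_order E (x powi n) = n * vanishing_order E x"
    unfolding *(3) by (rule vanishing_order_power_int[OF *(2) assms(2)])
qed

lemma ray_divisor_prime_divisor:
  assumes "v \<in> hirzebruch_rays a"
  shows "ray_divisor v \<in> prime_divisors (hirzebruch a :: 'k::field ratfun set set)"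
proof -
  obtain w v' w' where *: "hirzebruch_chart a v w v' w'" using hirzebruch_chart_ray[OF assms] .
  interpret toric_chart v w v' w' "TYPE('k)" by (rule toric_chart_hirzebruch[OF *])
  have "(ray_divisor v :: 'k ratfun set) \<in> hirzebruch a"
    unfolding hirzebruch_eq ray_divisor_eq using * prime_ideal_ray_ideal by blast
  then show ?thesis unfolding prime_divisors_def using krull_dim_ray_divisor by simp
qed

lemma vanishing_order_hirzebruch_ray:
  assumes "v \<in> hirzebruch_rays a"
  shows "vanishing_order (ray_divisor v) (character m :: 'k::field ratfun) = pairing m v"
    and "chars_eval f \<noteq> (0 :: 'k ratfun) \<Longrightarrow>
      k \<le> vanishing_order (ray_divisor v) (chars_eval f) \<longleftrightarrow> (\<forall>m\<in>keys f. k \<le> pairing m v)"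
proof -
  obtain w v' w' where *: "hirzebruch_chart a v w v' w'" using hirzebruch_chart_ray[OF assms] .
  interpret toric_chart v w v' w' "TYPE('k)" by (rule toric_chart_hirzebruch[OF *])
  show "vanishing_order (ray_divisor v) (character m :: 'k ratfun) = pairing m v"
    by (rule vanishing_order_ray_character)
  show "chars_eval f \<noteq> (0 :: 'k ratfun) \<Longrightarrow>
      k \<le> vanishing_order (ray_divisor v) (chars_eval f) \<longleftrightarrow> (\<forall>m\<in>keys f. k \<le> pairing m v)"
    by (rule vanishing_order_ray)
qed

lemma ray_divisor_inj:
  assumes "u \<in> hirzebruch_rays a" "v \<in> hirzebruch_rays a" "ray_divisor u = (ray_divisor v :: 'k::field ratfun set)"
  shows "u = v"
proof -
  have "pairing m u = pairing m v" for m
    using vanishing_order_hirzebruch_ray(1)[OF assms(1), of m, where 'k = 'k]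
      vanishing_order_hirzebruch_ray(1)[OF assms(2), of m, where 'k = 'k] assms(3) by simp
  from this[of "(1, 0)"] this[of "(0, 1)"] show ?thesis by (simp add: pairing_def prod_eq_iff)
qed

text \<open>Here \<open>\<delta>\<close> plays the role of a torus-invariant divisor. The conditions
  at prime divisors meeting the torus make F a Laurent polynomial; the conditions at the rays then
  bound each exponent separately by \<open>vanishing_order_ray\<close>.\<close>

lemma hirzebruch_regular_sections:
  fixes F :: "'k::field ratfun" and \<delta> :: "'k ratfun set \<Rightarrow> int"
  assumes F: "F \<noteq> 0" and \<delta>: "\<And>E. E \<notin> ray_divisor ` hirzebruch_rays a \<Longrightarrow> \<delta> E = 0"
  shows "(\<forall>E\<in>prime_divisors (hirzebruch a). vanishing_order E F + \<delta> E \<ge> 0) \<longleftrightarrow>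
    F \<in> chars_eval ` supported {m. \<forall>v\<in>hirzebruch_rays a. pairing m v + \<delta> (ray_divisor v) \<ge> 0}"
    (is "?L \<longleftrightarrow> F \<in> chars_eval ` supported ?S")
proof
  assume "F \<in> chars_eval ` supported ?S"
  then obtain f where f: "F = chars_eval f" "keys f \<subseteq> ?S" by (auto simp: supported_def)
  show ?L
  proof
    fix E :: "'k ratfun set" assume E: "E \<in> prime_divisors (hirzebruch a)"
    show "vanishing_order E F + \<delta> E \<ge> 0"
    proof (cases "E \<in> ray_divisor ` hirzebruch_rays a")
      case True
      then obtain v where v: "v \<in> hirzebruch_rays a" "E = ray_divisor v" by auto
      have "- \<delta> E \<le> pairing m v" if "m \<in> keys f" for m using f(2) that v by force
      then have "- \<delta> E \<le> vanishing_order E F"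
        using vanishing_order_hirzebruch_ray(2)[OF v(1), of f] F unfolding f(1) v(2) by simp
      then show ?thesis by simp
    next
      case False
      obtain v w v' w' p where *: "toric_chart v w v' w'" "prime_elem p" "E = ufd_embedding.stalk (chart_hom v' w') p"
        "\<forall>m. character m \<in> ufd_embedding.stalk_units (chart_hom v' w') p"
        using prime_divisor_cases[OF E] False by metis
      interpret toric_chart v w v' w' "TYPE('k)" by (rule *(1))
      have "F \<in> stalk p" unfolding f(1) by (rule chars_eval_in_stalk[OF *(2)]) (use *(4) in blast)
      then have "vanishing_order E F \<ge> 0" using vanishing_order_nonneg_iff[OF *(2) F] *(3) by simp
      then show ?thesis using \<delta>[OF False] by simp
    qed
  qed
next
  assume L: ?L
  have chart: "hirzebruch_chart a (1, 0) (0, 1) (1, 0) (0, 1)" by (simp add: hirzebruch_chart_def)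
  interpret toric_chart "(1, 0)" "(0, 1)" "(1, 0)" "(0, 1)" "TYPE('k)"
    by (rule toric_chart_hirzebruch[OF chart])
  \<comment> \<open>The product of the two variables vanishes exactly on the boundary of the torus
    in this chart. One chart is enough here because it contains the whole torus.\<close>
  let ?m = "[:0, 1:] * [:[:0, 1:]:] :: 'k poly poly"
  have stalk: "F \<in> stalk p" if p: "prime_elem p" and pm: "\<not> p dvd ?m" for p
  proof -
    have "\<not> p dvd [:0, 1:]" "\<not> p dvd [:[:0, 1:]:]" using pm dvd_mult dvd_mult2 by blast+
    then have "hom [:0, 1:] \<in> stalk_units p" "hom [:[:0, 1:]:] \<in> stalk_units p"
      using hom_unit[OF p] by blast+
    then have "character (1, 0) \<in> stalk_units p" "character (0, 1) \<in> stalk_units p"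
      unfolding chart_hom_vars .
    then have units: "character m \<in> stalk_units p" for m by (rule character_stalk_units[OF p])
    have "stalk p = localization (ray_chart {(1, 0), (0, 1)}) (principal p)"
      using localization_principal[of p] unfolding range_hom by simp
    moreover have "prime_ideal_of (ray_chart {(1, 0), (0, 1)}) (principal p)"
      using prime_ideal_principal[OF p] unfolding range_hom .
    ultimately have "stalk p \<in> hirzebruch a" unfolding hirzebruch_eq using chart by blast
    then have E: "stalk p \<in> prime_divisors (hirzebruch a)"
      unfolding prime_divisors_def using krull_dim_stalk[OF p] by simp
    \<comment> \<open>All characters are units at p, while along a ray divisor some character has
      nonzero order.\<close>
    have "stalk p \<notin> ray_divisor ` hirzebruch_rays a"
    proof
      assume "stalk p \<in> ray_divisor ` hirzebruch_rays a"
      then obtain u where u: "u \<in> hirzebruch_rays a" "stalk p = ray_divisor u" by auto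
      have "u = 0"
        by (rule stalk_not_ray_divisor[OF p units u(2)]) (rule vanishing_order_hirzebruch_ray(1)[OF u(1)])
      then show False using u(1) by (auto simp: hirzebruch_rays_def zero_prod_def)
    qed
    then have "vanishing_order (stalk p) F \<ge> 0" using L E \<delta>[of "stalk p"] by fastforce
    then show ?thesis using vanishing_order_nonneg_iff[OF p F] by simp
  qed
  have "[:0, 1:] \<noteq> (0 :: 'k poly poly)" "[:[:0, 1:]:] \<noteq> (0 :: 'k poly poly)" by simp_all
  then have "?m \<noteq> 0" by (rule no_zero_divisors)
  then obtain N b where N: "F * hom ?m ^ N = hom b" using regular_outside_divisor[OF _ stalk] by blast
  have hm: "hom ?m = character (1, 1)"
  proof -
    have "(character (1, 1) :: 'k ratfun) = character ((1, 0) + (0, 1))" by simp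
    also have "\<dots> = character (1, 0) * character (0, 1)" by (rule character_add)
    finally show ?thesis by (simp only: h_mult chart_hom_vars)
  qed
  have "F = character (- zscale (int N) (1, 1)) * hom b"
  proof -
    have "hom b = F * character (zscale (int N) (1, 1))"
      using N unfolding hm character_zscale by (simp only: power_int_of_nat)
    then have "character (- zscale (int N) (1, 1)) * hom b
        = (character (- zscale (int N) (1, 1)) * character (zscale (int N) (1, 1))) * F"
      by (simp only: mult_ac)
    then show ?thesis by (simp only: character_inverse mult_1)
  qed
  moreover have "hom b \<in> chars_eval ` supported (ray_monoid {(1, 0), (0, 1)})"
    using range_hom unfolding ray_chart_def by blast
  then have "hom b \<in> chars_eval ` supported UNIV" by (auto simp: supported_def)
  ultimately have "F \<in> chars_eval ` supported UNIV" using character_mult_chars_eval[of "hom b" UNIV _ UNIV] by simp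
  then obtain f where f: "F = chars_eval f" by auto
  have "m \<in> ?S" if m: "m \<in> keys f" for m
  proof (intro CollectI ballI)
    fix v assume v: "v \<in> hirzebruch_rays a"
    have "- \<delta> (ray_divisor v) \<le> vanishing_order (ray_divisor v) F"
      using L ray_divisor_prime_divisor[OF v, where 'k = 'k] by force
    then have "\<forall>m\<in>keys f. - \<delta> (ray_divisor v) \<le> pairing m v"
      using vanishing_order_hirzebruch_ray(2)[OF v, of f] F unfolding f by blast
    then show "pairing m v + \<delta> (ray_divisor v) \<ge> 0" using m by force
  qed
  then show "F \<in> chars_eval ` supported ?S" using f by (auto simp: supported_def)
qed

definition section_polytope :: "int \<Rightarrow> int \<Rightarrow> int \<Rightarrow> int \<Rightarrow> (int \<times> int) set" where
  "section_polytope a c d n = {m. 0 \<le> fst m + n * c \<and> 0 \<le> snd m \<and> 0 \<le> a * snd m - fst m \<and> 0 \<le> n * d - snd m}"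

text \<open>Multiplication by \<open>z powi n\<close> carries sections for n D to sections for the
  torus-invariant divisor n (c D_1 + d D_4), whose order conditions are those of the
  polygon.\<close>

lemma global_sections_hirzebruch:
  fixes D :: "'k::field ratfun set \<Rightarrow>\<^sub>0 int"
  assumes z: "z \<noteq> 0" and eq: "\<And>E. E \<in> prime_divisors (hirzebruch a) \<Longrightarrow> lookup D E =
      lookup (frag_cmul c (frag_of (hirzebruch_divisor a 1)) + frag_cmul d (frag_of (hirzebruch_divisor a 4))) E
        + vanishing_order E z"
  shows "g \<in> global_sections (hirzebruch a) (frag_cmul n D) \<longleftrightarrow>
    g * z powi n \<in> chars_eval ` supported (section_polytope a c d n)"
proof (cases "g = 0")
  case True
  then show ?thesis by (auto simp: global_sections_def intro: image_eqI[of _ _ 0])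
next
  case False
  define \<delta> where "\<delta> E = n * ((if E = ray_divisor (1, 0) then c else 0) + (if E = ray_divisor (0, -1) then d else 0))"
    for E :: "'k ratfun set"
  have F: "g * z powi n \<noteq> 0" using False z by simp
  have D: "n * lookup D E = \<delta> E + n * vanishing_order E z" if "E \<in> prime_divisors (hirzebruch a)" for E
    unfolding eq[OF that] \<delta>_def hirzebruch_divisor_def hirzebruch_ray_def
    by (simp add: lookup_add lookup_single when_def frag_cmul_def distrib_left)
  have "g \<in> global_sections (hirzebruch a) (frag_cmul n D) \<longleftrightarrow>
      (\<forall>E\<in>prime_divisors (hirzebruch a). vanishing_order E g + n * lookup D E \<ge> 0)"
    using False by (simp add: global_sections_def)
  also have "\<dots> \<longleftrightarrow> (\<forall>E\<in>prime_divisors (hirzebruch a). vanishing_order E (g * z powi n) + \<delta> E \<ge> 0)"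
  proof (rule ball_cong[OF refl])
    fix E :: "'k ratfun set" assume E: "E \<in> prime_divisors (hirzebruch a)"
    have "vanishing_order E (g * z powi n) = vanishing_order E g + n * vanishing_order E z"
      using vanishing_order_mult_prime_divisor(1)[OF E False, of "z powi n"]
        vanishing_order_mult_prime_divisor(2)[OF E z z, of n] z by simp
    then show "vanishing_order E g + n * lookup D E \<ge> 0 \<longleftrightarrow> vanishing_order E (g * z powi n) + \<delta> E \<ge> 0"
      unfolding D[OF E] by (simp add: add_ac)
  qed
  also have "\<dots> \<longleftrightarrow> g * z powi n \<in> chars_eval ` supported {m. \<forall>v\<in>hirzebruch_rays a. pairing m v + \<delta> (ray_divisor v) \<ge> 0}"
    by (rule hirzebruch_regular_sections[OF F]) (auto simp: \<delta>_def hirzebruch_rays_def)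
  also have "{m. \<forall>v\<in>hirzebruch_rays a. pairing m v + \<delta> (ray_divisor v) \<ge> 0} = section_polytope a c d n"
  proof -
    have inj: "ray_divisor u = (ray_divisor v :: 'k ratfun set) \<longleftrightarrow> u = v"
      if "u \<in> hirzebruch_rays a" "v \<in> hirzebruch_rays a" for u v
      using ray_divisor_inj[OF that] by blast
    have "\<delta> (ray_divisor (1, 0)) = n * c" "\<delta> (ray_divisor (0, 1)) = 0" "\<delta> (ray_divisor (-1, a)) = 0"
      "\<delta> (ray_divisor (0, -1)) = n * d"
      unfolding \<delta>_def by (simp_all add: inj hirzebruch_rays_def)
    then show ?thesis
      by (auto simp: section_polytope_def hirzebruch_rays_def pairing_def algebra_simps)
  qed
  finally show ?thesis .
qed

section \<open>The section ring as an affine toric ring\<close>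

text \<open>The power of z undoes the twist, so a monomial with exponent in the cone is a section
  for a multiple of D itself and not of its torus-invariant representative.\<close>

definition section_monomial :: "'k::field ratfun \<Rightarrow> int \<times> int \<times> int \<Rightarrow> int \<Rightarrow>\<^sub>0 'k ratfun" where
  "section_monomial z w = single (snd (snd w)) (character (fst w, fst (snd w)) * z powi (- snd (snd w)))"

definition section_functionals :: "int \<Rightarrow> int \<Rightarrow> int \<Rightarrow> (int \<times> int \<times> int \<Rightarrow> int) set" where
  "section_functionals a c d = {\<lambda>w. fst w + snd (snd w) * c, \<lambda>w. fst (snd w),
     \<lambda>w. a * fst (snd w) - fst w, \<lambda>w. snd (snd w) * d - fst (snd w)}"

definition slice :: "int \<Rightarrow> (int \<times> int \<times> int \<Rightarrow>\<^sub>0 'k::comm_monoid_add) \<Rightarrow> int \<times> int \<Rightarrow>\<^sub>0 'k" where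
  "slice n = Poly_Mapping.map_key (\<lambda>m. (fst m, snd m, n))"

lemma lookup_slice: "lookup (slice n f) m = lookup f (fst m, snd m, n)"
proof -
  have "inj (\<lambda>m :: int \<times> int. (fst m, snd m, n))" by (auto simp: inj_def)
  then show ?thesis unfolding slice_def by (simp add: map_key.rep_eq)
qed

lemma slice_add: "slice n (f + g) = slice n f + slice n g"
  by (rule poly_mapping_eqI) (simp add: lookup_slice lookup_add)

lemma slice_single: "slice n (single w c) =
    (if n = snd (snd w) then single (fst w, fst (snd w)) c else 0)"
  by (rule poly_mapping_eqI) (auto simp: lookup_slice lookup_single when_def prod_eq_iff)

lemma to_fract_eval:
  assumes "monomial_eval \<iota> \<mu>"
  shows "monomial_eval (\<lambda>c. to_fract (\<iota> c)) (\<lambda>w. to_fract (\<mu> w))"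
    "mon_eval (\<lambda>c. to_fract (\<iota> c)) (\<lambda>w. to_fract (\<mu> w)) f = to_fract (mon_eval \<iota> \<mu> f)"
proof -
  interpret monomial_eval \<iota> \<mu> by (rule assms)
  show "monomial_eval (\<lambda>c. to_fract (\<iota> c)) (\<lambda>w. to_fract (\<mu> w))"
    by standard (simp_all add: \<iota>_1 \<iota>_add \<iota>_mult \<mu>_0 \<mu>_add)
  show "mon_eval (\<lambda>c. to_fract (\<iota> c)) (\<lambda>w. to_fract (\<mu> w)) f = to_fract (mon_eval \<iota> \<mu> f)"
    by (simp add: mon_eval_def)
qed

locale section_ring_toric =
  fixes a c d :: int and z :: "'k::alg_closed_field ratfun" and D :: "'k ratfun set \<Rightarrow>\<^sub>0 int"
  assumes a: "a \<ge> 2" and c: "c \<ge> 1" and d: "d \<ge> 1" and char_pos': "CHAR('k) > 0" and z: "z \<noteq> 0"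
    and lookup_D: "\<And>E. E \<in> prime_divisors (hirzebruch a) \<Longrightarrow> lookup D E =
      lookup (frag_cmul c (frag_of (hirzebruch_divisor a 1)) + frag_cmul d (frag_of (hirzebruch_divisor a 4))) E
        + vanishing_order E z"
begin

abbreviation const :: "'k \<Rightarrow> int \<Rightarrow>\<^sub>0 'k ratfun" where "const x \<equiv> single 0 (scalar x)"

lemma monomial_eval_section: "monomial_eval const (section_monomial z)"
proof
  show "section_monomial z 0 = 1" by (simp add: section_monomial_def character_0 flip: zero_prod_def)
  show "section_monomial z (u + v) = section_monomial z u * section_monomial z v" for u v
  proof -
    have "(character (fst (u + v), fst (snd (u + v))) :: 'k ratfun)
        = character (fst u, fst (snd u)) * character (fst v, fst (snd v))"
      by (simp flip: character_add)
    moreover have "z powi (- snd (snd (u + v))) = z powi (- snd (snd u)) * z powi (- snd (snd v))"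
      using z by (simp flip: power_int_add)
    ultimately show ?thesis by (simp add: section_monomial_def mult_single mult_ac)
  qed
qed (simp_all add: chars.\<iota>_1 chars.\<iota>_add chars.\<iota>_mult single_add mult_single)

sublocale sec: monomial_eval const "section_monomial z" by (rule monomial_eval_section)

lemma lookup_section: "lookup (sec.ev f) n = chars_eval (slice n f) * z powi (- n)"
proof (induction f rule: poly_mapping_single_plus_induct)
  case (single w x)
  show ?case unfolding sec.ev_single
    by (auto simp: slice_single section_monomial_def mult_single lookup_single when_def)
qed (simp add: slice_add lookup_add distrib_right)

lemma section_independent: "sec.ev f = 0 \<Longrightarrow> f = 0"
proof -
  assume *: "sec.ev f = 0"
  have "slice n f = 0" for n
  proof -
    have "chars_eval (slice n f) * z powi (- n) = 0" unfolding lookup_section[symmetric] * by simp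
    then have "chars_eval (slice n f) = 0" using z by simp
    then show ?thesis by (rule chars_independent)
  qed
  then have "lookup f (i, j, n) = 0" for i j n
    using lookup_slice[of n f "(i, j)"] by simp
  then show "f = 0" by (intro poly_mapping_eqI) (simp add: split_paired_all)
qed

abbreviation fconst :: "'k \<Rightarrow> (int \<Rightarrow>\<^sub>0 'k ratfun) fract" where "fconst x \<equiv> to_fract (const x)"

abbreviation fmon :: "int \<times> int \<times> int \<Rightarrow> (int \<Rightarrow>\<^sub>0 'k ratfun) fract" where
  "fmon w \<equiv> to_fract (section_monomial z w)"

lemma ev_fract: "mon_eval fconst fmon f = to_fract (sec.ev f)"
  by (rule to_fract_eval(2)[OF monomial_eval_section])

lemma section_box_eq: "{w. \<forall>l\<in>section_functionals a c d. 0 \<le> l w \<and> l w < q} = section_box a c d q"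
  by (auto simp: section_functionals_def section_box_def)

sublocale toric_ring3 fconst fmon "section_functionals a c d"
proof -
  interpret monomial_eval fconst fmon by (rule to_fract_eval(1)[OF monomial_eval_section])
  show "toric_ring3 fconst fmon (section_functionals a c d)"
  proof unfold_locales
    show "f = 0" if "mon_eval fconst fmon f = 0" for f
      using that unfolding ev_fract to_fract_eq_0_iff by (rule section_independent)
    show "CHAR('k) > 0" by (rule char_pos')
    show "l (u + v) = l u + l v" if "l \<in> section_functionals a c d" for l u v
      using that unfolding section_functionals_def by (auto simp: algebra_simps)
    show "w = 0" if "\<And>l. l \<in> section_functionals a c d \<Longrightarrow> l w = 0" for w
    proof -
      have "fst (snd w) = 0" "a * fst (snd w) - fst w = 0" "fst w + snd (snd w) * c = 0"
        using that unfolding section_functionals_def by blast+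
      then show ?thesis using c by (simp add: prod_eq_iff)
    qed
    show "finite {w. \<forall>l\<in>section_functionals a c d. 0 \<le> l w \<and> l w < int q}" for q
    proof (cases "q = 0")
      case True
      have "section_box a c d 0 = {}" by (auto simp: section_box_def)
      then show ?thesis using True by (simp add: section_box_eq)
    next
      case False
      then show ?thesis unfolding section_box_eq using card_section_box(1)[OF a c d, of "int q"] by simp
    qed
    show "\<exists>s. l s = -1 \<and> (\<forall>l'\<in>section_functionals a c d. l' \<noteq> l \<longrightarrow> l' s \<ge> 0)"
      if "l \<in> section_functionals a c d" for l
    proof -
      have "l = (\<lambda>w. fst w + snd (snd w) * c) \<or> l = (\<lambda>w. fst (snd w)) \<or>
          l = (\<lambda>w. a * fst (snd w) - fst w) \<or> l = (\<lambda>w. snd (snd w) * d - fst (snd w))"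
        using that unfolding section_functionals_def by blast
      \<comment> \<open>In the order m + n c, y, a y - m, n d - y the witnesses have the values (-1,
        0, 1 + c, d), (a c - a, -1, 0, a d + 1), (1 + c, 0, -1, d) and (0, 1, a, -1).\<close>
      then have "\<exists>s. l s = -1 \<and> (\<forall>l'\<in>section_functionals a c d - {l}. l' s \<ge> 0)"
      proof (elim disjE)
        assume l: "l = (\<lambda>w. fst w + snd (snd w) * c)"
        show ?thesis unfolding l section_functionals_def
          by (rule exI[of _ "(-1 - c, 0, 1)"]) (use c d in auto)
      next
        assume l: "l = (\<lambda>w. fst (snd w))"
        have "a \<le> a * c" using a c by simp
        moreover have "0 \<le> a * d" using a d by simp
        ultimately show ?thesis unfolding l section_functionals_def
          by (intro exI[of _ "(- a, -1, a)"]) auto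
      next
        assume l: "l = (\<lambda>w. a * fst (snd w) - fst w)"
        show ?thesis unfolding l section_functionals_def
          by (rule exI[of _ "(1, 0, 1)"]) (use c d in auto)
      next
        assume l: "l = (\<lambda>w. snd (snd w) * d - fst (snd w))"
        show ?thesis unfolding l section_functionals_def
          by (rule exI[of _ "(0, 1, 0)"]) (use a in auto)
      qed
      then show ?thesis by blast
    qed
    \<comment> \<open>The values are 2 c, 1, a and 2 d - 1. Degree 2 keeps the last one positive
      also for d = 1.\<close>
    show "\<exists>t. \<forall>l\<in>section_functionals a c d. l t \<ge> 1"
      by (rule exI[of _ "(0, 1, 2)"]) (use a c d in \<open>auto simp: section_functionals_def\<close>)
  qed
qed

section \<open>Identification of the localized section ring\<close>

lemma cone_eq: "cone = {w. 0 \<le> fst w + snd (snd w) * c \<and> 0 \<le> fst (snd w) \<and> 0 \<le> a * fst (snd w) - fst w \<and>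
    0 \<le> snd (snd w) * d - fst (snd w)}"
  unfolding cone_def unfolding section_functionals_def by auto

lemma cone_iff: "(i, j, n) \<in> cone \<longleftrightarrow> (i, j) \<in> section_polytope a c d n"
  by (auto simp: cone_eq section_polytope_def)

text \<open>The degree is nonnegative on the cone and vanishes only at the vertex, which is why the
  toric maximal ideal is the irrelevant ideal.\<close>

lemma cone_degree_nonneg: "w \<in> cone \<Longrightarrow> 0 \<le> snd (snd w)"
  and cone_degree_0: "w \<in> cone \<Longrightarrow> snd (snd w) = 0 \<Longrightarrow> w = 0"
proof -
  assume w: "w \<in> cone"
  then have *: "0 \<le> fst w + snd (snd w) * c" "0 \<le> fst (snd w)" "0 \<le> a * fst (snd w) - fst w"
    "0 \<le> snd (snd w) * d - fst (snd w)"
    unfolding cone_eq by auto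
  then have "0 \<le> snd (snd w) * d" by linarith
  then show "0 \<le> snd (snd w)" using d by (simp add: zero_le_mult_iff)
  show "w = 0" if "snd (snd w) = 0" using * that by (simp add: prod_eq_iff)
qed

lemma supported_cone_iff: "f \<in> supported cone \<longleftrightarrow> (\<forall>n. slice n f \<in> supported (section_polytope a c d n))"
  unfolding supported_def by (force simp: in_keys_iff lookup_slice cone_iff)

lemma section_ring_eq: "section_ring (hirzebruch a) D = sec.ev ` kS"
proof (intro equalityI subsetI)
  fix s assume "s \<in> sec.ev ` kS"
  then obtain f where f: "s = sec.ev f" "f \<in> kS" by auto
  have "lookup s n * z powi n = chars_eval (slice n f)" for n
    unfolding f(1) lookup_section using z by (simp add: power_int_minus)
  then show "s \<in> section_ring (hirzebruch a) D"
    unfolding section_ring_def using global_sections_hirzebruch[OF z lookup_D] f(2)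
    by (auto simp: supported_cone_iff)
next
  fix s assume s: "s \<in> section_ring (hirzebruch a) D"
  have "\<exists>g. lookup s n * z powi n = chars_eval g \<and> g \<in> supported (section_polytope a c d n)" for n
    using s global_sections_hirzebruch[OF z lookup_D] unfolding section_ring_def by blast
  then obtain g where g: "\<And>n. lookup s n * z powi n = chars_eval (g n)"
    "\<And>n. g n \<in> supported (section_polytope a c d n)" by metis
  \<comment> \<open>\<open>g n\<close> exists in every degree, but only the finitely many degrees
    occurring in s are summed.\<close>
  define f where "f = (\<Sum>n\<in>keys s. \<Sum>m\<in>keys (g n).
    single (fst m, snd m, n) (lookup (g n) m))"
  have "f \<in> kS"
    unfolding f_def
  proof (intro supported_sum supported_single)
    fix n m assume "m \<in> keys (g n)"
    then show "(fst m, snd m, n) \<in> cone" using g(2)[of n] by (auto simp: supported_def cone_iff)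
  qed
  moreover have "sec.ev f = s"
  proof -
    have "sec.ev f = (\<Sum>n\<in>keys s. single n (chars_eval (g n) * z powi (- n)))"
      unfolding f_def sec.ev_sum
    proof (rule sum.cong[OF refl])
      fix n
      have "(\<Sum>m\<in>T. sec.ev (single (fst m, snd m, n) (lookup (g n) m)))
          = single n ((\<Sum>m\<in>T. scalar (lookup (g n) m) * character m) * z powi (- n))" for T
        unfolding sec.ev_single
        by (induction T rule: infinite_finite_induct)
           (simp_all add: section_monomial_def mult_single single_add distrib_right mult.assoc)
      then show "(\<Sum>m\<in>keys (g n). sec.ev (single (fst m, snd m, n) (lookup (g n) m)))
          = single n (chars_eval (g n) * z powi (- n))" unfolding mon_eval_def[of scalar] .
    qed
    also have "\<dots> = (\<Sum>n\<in>keys s. single n (lookup s n))"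
      unfolding g(1)[symmetric] using z by (simp add: power_int_minus mult.assoc)
    also have "\<dots> = s" using poly_mapping_sum_single[OF finite_keys subset_refl, of s] by simp
    finally show ?thesis .
  qed
  ultimately show "s \<in> sec.ev ` kS" by blast
qed

lemma irrelevant_ideal_eq: "irrelevant_ideal (section_ring (hirzebruch a) D) = sec.ev ` kS_max"
proof -
  have iff: "(\<forall>n\<le>0. lookup (sec.ev f) n = 0) \<longleftrightarrow> f \<in> kS_max" if f: "f \<in> kS" for f
  proof -
    have zero_iff: "lookup (sec.ev f) n = 0 \<longleftrightarrow> slice n f = 0" for n
      unfolding lookup_section using z chars_eval_inj[of "slice n f" 0] by simp
    show ?thesis
    proof
      assume "\<forall>n\<le>0. lookup (sec.ev f) n = 0"
      then have "slice 0 f = 0" using zero_iff by simp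
      then have "lookup f 0 = 0" using lookup_slice[of 0 f 0] by (simp add: zero_prod_def)
      then show "f \<in> kS_max" using kS_max_iff[OF f] by simp
    next
      assume *: "f \<in> kS_max"
      have "lookup f (i, j, n) = 0" if "n \<le> 0" for i j n
      proof (rule ccontr)
        assume "lookup f (i, j, n) \<noteq> 0"
        then have w: "(i, j, n) \<in> cone" "(i, j, n) \<noteq> 0" using * by (auto simp: supported_def in_keys_iff)
        then show False using cone_degree_nonneg[OF w(1)] cone_degree_0[OF w(1)] that by simp
      qed
      then have "slice n f = 0" if "n \<le> 0" for n
        using that by (intro poly_mapping_eqI) (simp add: lookup_slice)
      then show "\<forall>n\<le>0. lookup (sec.ev f) n = 0" using zero_iff by simp
    qed
  qed
  have "kS_max \<subseteq> kS" by (auto simp: supported_def)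
  then show ?thesis unfolding irrelevant_ideal_def section_ring_eq using iff by blast
qed

lemma localized_section_ring_eq: "localized_section_ring (hirzebruch a) D = local_ring"
  unfolding localized_section_ring_def Let_def irrelevant_ideal_eq unfolding section_ring_eq local_ring_def
  by (simp add: ev_fract image_image)

text \<open>The chain comes from a flag of faces: the facet y = 0, its edge with m + n c = 0,
  spanned by (-c, 0, 1), and the vertex. On the facet y = 0 the sum y + (m + n c) reduces to m + n
  c, so its zero set in the cone is that edge.\<close>

lemma krull_dim_section: "krull_dim local_ring = enat 3"
proof (rule antisym[OF krull_dim_local_ring_le])
  define l :: "nat \<Rightarrow> int \<times> int \<times> int \<Rightarrow> int" where
    "l i = (if i = 0 then (\<lambda>w. fst (snd w)) else if i = 1 then (\<lambda>w. fst (snd w) + (fst w + snd (snd w) * c))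
      else (\<lambda>w. snd (snd w)))" for i
  have cone: "0 \<le> fst w + snd (snd w) * c" "0 \<le> fst (snd w)" if "w \<in> cone" for w
    using that unfolding cone_eq by auto
  have mem: "(0, 0, 1) \<in> cone" "(- c, 0, 1) \<in> cone" "(0, 1, 1) \<in> cone"
    using a c d by (auto simp: cone_iff section_polytope_def)
  show "enat 3 \<le> krull_dim local_ring"
  proof (rule krull_dim_local_ring_ge)
    show "face_functional (l i)" for i
      unfolding face_functional_def
    proof (intro conjI allI ballI)
      show "l i (u + v) = l i u + l i v" for u v by (simp add: l_def algebra_simps)
      show "0 \<le> l i w" if "w \<in> cone" for w
        using add_nonneg_nonneg[OF cone(2)[OF that] cone(1)[OF that]] cone(2)[OF that] cone_degree_nonneg[OF that]
        unfolding l_def by simp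
    qed
    show "{w \<in> cone. l i w > 0} \<subset> {w \<in> cone. l (Suc i) w > 0}" if i: "Suc i < 3" for i
    proof -
      consider "i = 0" | "i = 1" using i by linarith
      then show ?thesis
      proof cases
        case 1
        have "{w \<in> cone. l 0 w > 0} \<subseteq> {w \<in> cone. l 1 w > 0}"
          using cone by (auto simp: l_def intro: add_pos_nonneg)
        moreover have "(0, 0, 1) \<in> {w \<in> cone. l 1 w > 0}" "(0, 0, 1) \<notin> {w \<in> cone. l 0 w > 0}"
          using mem c by (simp_all add: l_def)
        ultimately show ?thesis unfolding 1 by auto
      next
        case 2
        have "{w \<in> cone. l 1 w > 0} \<subseteq> {w \<in> cone. l 2 w > 0}"
        proof
          fix w assume w: "w \<in> {w \<in> cone. l 1 w > 0}"
          have "snd (snd w) \<noteq> 0"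
          proof
            assume "snd (snd w) = 0"
            then have "w = 0" using cone_degree_0 w by blast
            then show False using w by (simp add: l_def)
          qed
          then show "w \<in> {w \<in> cone. l 2 w > 0}" using w cone_degree_nonneg[of w] by (simp add: l_def)
        qed
        moreover have "(- c, 0, 1) \<in> {w \<in> cone. l 2 w > 0}" "(- c, 0, 1) \<notin> {w \<in> cone. l 1 w > 0}"
          using mem by (simp_all add: l_def)
        ultimately show ?thesis unfolding 2 by (auto simp: numeral_2_eq_2)
      qed
    qed
    have "(0, 1, 1) \<in> {w \<in> cone. l 0 w > 0}" using mem by (simp add: l_def)
    then show "{w \<in> cone. l 0 w > 0} \<noteq> {}" by blast
  qed
qed

theorem has_F_signature_section_ring:
  "has_F_signature (localized_section_ring (hirzebruch a) D) ((1 - d / c * tent_int2 (c / d)) / (a * d + c))"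
  unfolding localized_section_ring_eq
proof (rule has_F_signature_local_ring[OF krull_dim_section])
  have box: "box q = section_box a c d (int q)" for q
    unfolding box_def section_box_eq ..
  have "CHAR('k) > 1" using char_prime by (rule prime_gt_1_nat)
  \<comment> \<open>The density is known along all q, and the powers of the characteristic are a
    subsequence.\<close>
  then have "strict_mono (\<lambda>e. CHAR('k) ^ e)" by (intro strict_monoI power_strict_increasing)
  from LIMSEQ_subseq_LIMSEQ[OF section_box_density[OF a c d] this]
  show "(\<lambda>e. real (card (box (CHAR('k) ^ e))) / real (CHAR('k) ^ e) ^ 3)
      \<longlonglongrightarrow> (1 - d / c * tent_int2 (c / d)) / (a * d + c)"
    unfolding box by (simp add: comp_def)
qed

end

theorem theoremB:
  fixes a c d :: int
    and D :: "'k::alg_closed_field ratfun set \<Rightarrow>\<^sub>0 int"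
  assumes "a \<ge> 2"
    and "CHAR('k) > 0"
    and "c \<ge> 1" and "d \<ge> 1"
    and "D \<in> divisors (hirzebruch a)"
    and "linearly_equivalent (hirzebruch a) D
           (frag_cmul c (frag_of (hirzebruch_divisor a 1)) +
            frag_cmul d (frag_of (hirzebruch_divisor a 4)))"
  shows "(c \<le> d \<longrightarrow>
            has_F_signature (localized_section_ring (hirzebruch a) D)
              ((6 * d^2 - c^2) / (6 * d^2 * (a * d + c)))) \<and>
         (d \<le> c \<and> c \<le> 2 * d \<longrightarrow>
            has_F_signature (localized_section_ring (hirzebruch a) D)
              ((6 * d^3 - (2 * d - c)^3) / (6 * c * d^2 * (a * d + c)))) \<and>
         (2 * d \<le> c \<longrightarrow>
            has_F_signature (localized_section_ring (hirzebruch a) D)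
              (d / (c * (a * d + c))))"
proof -
  obtain z where z: "z \<noteq> 0" "\<forall>E\<in>prime_divisors (hirzebruch a). lookup D E =
      lookup (frag_cmul c (frag_of (hirzebruch_divisor a 1)) + frag_cmul d (frag_of (hirzebruch_divisor a 4))) E
        + vanishing_order E z"
    using assms(6) unfolding linearly_equivalent_def by (elim exE conjE)
  interpret section_ring_toric a c d z D
    by standard (use assms z in auto)
  note sig = has_F_signature_section_ring and density = section_box_density_cases[OF assms(1,3,4)]
  show ?thesis
  proof (intro conjI impI)
    assume "c \<le> d"
    from sig[unfolded density(1)[OF this]] show "has_F_signature (localized_section_ring (hirzebruch a) D)
        ((6 * d^2 - c^2) / (6 * d^2 * (a * d + c)))" by simp
  next
    assume "d \<le> c \<and> c \<le> 2 * d"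
    then have "d \<le> c" "c \<le> 2 * d" by simp_all
    from sig[unfolded density(2)[OF this]] show "has_F_signature (localized_section_ring (hirzebruch a) D)
        ((6 * d^3 - (2 * d - c)^3) / (6 * c * d^2 * (a * d + c)))" by simp
  next
    assume "2 * d \<le> c"
    from sig[unfolded density(3)[OF this]] show "has_F_signature (localized_section_ring (hirzebruch a) D)
        (d / (c * (a * d + c)))" by simp
  qed
qed

end
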